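(* Let $X$ be a compact geodesic space, let $p\in X$, and let $G$ be a finite metric graph. Then $$d_{\mathrm{GH}}(X,R_p) \leq \bigl(8\,b_1(X)+8\,b_1(G)+13\bigr)\,d_{\mathrm{GH}}(X,G). $$
   Context: Geodesic space: a metric space in which any two points are joined by a path whose length equals their distance. $b_1$ denotes the first Betti number, i.e. the dimension of first singular homology with real coefficients ($b_1(X)$ may be infinite). A finite metric graph is a geodesic space homeomorphic to a finite CW-complex of dimension at most one. $d_{\mathrm{GH}}$ is the Gromov-Hausdorff distance. $R_p$ denotes the Reeb metric graph of the function $f:X\to\mathbb{R}$, $f(x)=d_X(p,x)$, defined as follows. As a topological space it is the quotient of $X$ identifying points that lie in the same connected component of a fiber $f^{-1}(c)$, $c\in\mathbb{R}$; the class of $x$ is $[x]$, and $\bar f([x])=f(x)$. It is endowed with the Reeb metric $d_p([x],[y]) := \inf_\beta \mathrm{length}_{\mathbb{R}}(\bar f\circ\beta)$, where $\beta$ ranges over all continuous paths in the quotient space from $[x]$ to $[y]$, and $\mathrm{length}_{\mathbb{R}}$ is the length (total variation) of a path in $\mathbb{R}$. *)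

theory Defs
  imports "HOL-Analysis.Analysis" "HOL-Homology.Homology" "HOL-Library.Extended_Nat"
begin

section \<open>Length of paths and geodesic spaces\<close>

text \<open>
  The metric \<open>d\<close> is an arbitrary real-valued function, so that for \<open>d = dist\<close> on the reals
  \<open>path_length\<close> is the total variation over \<open>{0..1}\<close>. No continuity is required.
\<close>

definition path_length :: "('a \<Rightarrow> 'a \<Rightarrow> real) \<Rightarrow> (real \<Rightarrow> 'a) \<Rightarrow> ennreal" where
  "path_length d g =
     (SUP ts \<in> {ts. sorted ts \<and> set ts \<subseteq> {0..1}}.
        \<Sum>i<length ts - 1. ennreal (d (g (ts ! i)) (g (ts ! Suc i))))"

definition geodesic_space :: "'a set \<Rightarrow> ('a \<Rightarrow> 'a \<Rightarrow> real) \<Rightarrow> bool" where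
  "geodesic_space M d \<longleftrightarrow>
     Metric_space M d \<and>
     (\<forall>x\<in>M. \<forall>y\<in>M. \<exists>g. pathin (Metric_space.mtopology M d) g \<and> g 0 = x \<and> g 1 = y \<and>
        path_length d g = ennreal (d x y))"


section \<open>Finite metric graphs\<close>

text \<open>
  A CW structure of dimension at most one on a Hausdorff space: \<open>V\<close> is the set of 0-cells and
  \<open>\<Phi>\<close> the set of characteristic maps of the 1-cells. For finitely many cells the
  closure-finiteness and weak topology axioms hold automatically.
\<close>

definition finite_cw_structure_le_1 :: "'a topology \<Rightarrow> 'a set \<Rightarrow> (real \<Rightarrow> 'a) set \<Rightarrow> bool" where
  "finite_cw_structure_le_1 T V \<Phi> \<longleftrightarrow>
     Hausdorff_space T \<and> finite V \<and> finite \<Phi> \<and> V \<subseteq> topspace T \<and>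
     (\<forall>\<phi>\<in>\<Phi>. continuous_map (top_of_set {0..1}) T \<phi> \<and> \<phi> 0 \<in> V \<and> \<phi> 1 \<in> V \<and>
        embedding_map (top_of_set {0<..<1}) T \<phi>) \<and>
     (\<forall>\<phi>\<in>\<Phi>. \<phi> ` {0<..<1} \<inter> V = {}) \<and>
     (\<forall>\<phi>\<in>\<Phi>. \<forall>\<psi>\<in>\<Phi>. \<phi> \<noteq> \<psi> \<longrightarrow> \<phi> ` {0<..<1} \<inter> \<psi> ` {0<..<1} = {}) \<and>
     topspace T = V \<union> (\<Union>\<phi>\<in>\<Phi>. \<phi> ` {0<..<1})"

text \<open>
  A CW structure is transported by homeomorphisms, so it suffices to consider complexes on the
  type of the points of the graph.
\<close>

definition finite_metric_graph :: "'a set \<Rightarrow> ('a \<Rightarrow> 'a \<Rightarrow> real) \<Rightarrow> bool" where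
  "finite_metric_graph M d \<longleftrightarrow>
     geodesic_space M d \<and>
     (\<exists>(T :: 'a topology) V \<Phi>. finite_cw_structure_le_1 T V \<Phi> \<and>
        Metric_space.mtopology M d homeomorphic_space T)"


section \<open>Gromov-Hausdorff distance\<close>

definition hausdorff_distance :: "('a \<Rightarrow> 'a \<Rightarrow> real) \<Rightarrow> 'a set \<Rightarrow> 'a set \<Rightarrow> ennreal" where
  "hausdorff_distance d A B =
     max (SUP a\<in>A. INF b\<in>B. ennreal (d a b)) (SUP b\<in>B. INF a\<in>A. ennreal (d a b))"

definition isometric_embedding ::
    "'a set \<Rightarrow> ('a \<Rightarrow> 'a \<Rightarrow> real) \<Rightarrow> 'b set \<Rightarrow> ('b \<Rightarrow> 'b \<Rightarrow> real) \<Rightarrow> ('a \<Rightarrow> 'b) \<Rightarrow> bool" where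
  "isometric_embedding M d N e f \<longleftrightarrow> f \<in> M \<rightarrow> N \<and> (\<forall>x\<in>M. \<forall>y\<in>M. e (f x) (f y) = d x y)"

text \<open>
  Infimum of the Hausdorff distances over all isometric embeddings into a common metric space
  \<open>(Z, dZ)\<close>. Only the union of the two images in \<open>Z\<close> matters, and it is in bijection with a subset
  of the sum type, so letting \<open>Z\<close> range over the subsets of \<open>'a + 'b\<close> loses no generality.
\<close>

definition gh_distance ::
    "'a set \<Rightarrow> ('a \<Rightarrow> 'a \<Rightarrow> real) \<Rightarrow> 'b set \<Rightarrow> ('b \<Rightarrow> 'b \<Rightarrow> real) \<Rightarrow> ennreal" where
  "gh_distance M d N e =
     Inf {hausdorff_distance dZ (f ` M) (g ` N) | (Z :: ('a + 'b) set) dZ f g.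
            Metric_space Z dZ \<and> isometric_embedding M d Z dZ f \<and> isometric_embedding N e Z dZ g}"


section \<open>Singular homology with real coefficients\<close>

instantiation poly_mapping :: (type, real_vector) real_vector
begin

definition scaleR_poly_mapping :: "real \<Rightarrow> ('a \<Rightarrow>\<^sub>0 'b) \<Rightarrow> 'a \<Rightarrow>\<^sub>0 'b" where
  "scaleR_poly_mapping r c = Poly_Mapping.map (scaleR r) c"

lemma lookup_scaleR: "Poly_Mapping.lookup (r *\<^sub>R c) s = r *\<^sub>R Poly_Mapping.lookup c s"
  for c :: "'a \<Rightarrow>\<^sub>0 'b"
  unfolding scaleR_poly_mapping_def by transfer (auto simp: when_def)

instance
proof
  fix a b :: real and x y :: "'a \<Rightarrow>\<^sub>0 'b"
  show "a *\<^sub>R (x + y) = a *\<^sub>R x + a *\<^sub>R y"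
    by (rule poly_mapping_eqI) (simp add: lookup_scaleR lookup_add scaleR_add_right)
  show "(a + b) *\<^sub>R x = a *\<^sub>R x + b *\<^sub>R x"
    by (rule poly_mapping_eqI) (simp add: lookup_scaleR lookup_add scaleR_add_left)
  show "a *\<^sub>R b *\<^sub>R x = (a * b) *\<^sub>R x"
    by (rule poly_mapping_eqI) (simp add: lookup_scaleR)
  show "1 *\<^sub>R x = x"
    by (rule poly_mapping_eqI) (simp add: lookup_scaleR)
qed

end

text \<open>
  The simplices, their faces and the sign convention are those of the integral theory in
  \<open>HOL-Homology\<close>.
\<close>

type_synonym 'a real_chain = "((nat \<Rightarrow> real) \<Rightarrow> 'a) \<Rightarrow>\<^sub>0 real"

definition real_singular_chains :: "nat \<Rightarrow> 'a topology \<Rightarrow> 'a real_chain set" where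
  "real_singular_chains n X = {c. Poly_Mapping.keys c \<subseteq> singular_simplex_set n X}"

definition real_chain_boundary :: "nat \<Rightarrow> 'a real_chain \<Rightarrow> 'a real_chain" where
  "real_chain_boundary n c =
     (if n = 0 then 0 else
      \<Sum>s\<in>Poly_Mapping.keys c. \<Sum>k\<le>n.
        Poly_Mapping.single (singular_face n k s) ((-1) ^ k * Poly_Mapping.lookup c s))"

definition real_cycles :: "nat \<Rightarrow> 'a topology \<Rightarrow> 'a real_chain set" where
  "real_cycles n X = {c \<in> real_singular_chains n X. real_chain_boundary n c = 0}"

definition real_boundaries :: "nat \<Rightarrow> 'a topology \<Rightarrow> 'a real_chain set" where
  "real_boundaries n X = real_chain_boundary (Suc n) ` real_singular_chains (Suc n) X"

text \<open>
  The dimension of the quotient vector space \<open>Z / B\<close>: the largest number of elements of \<open>Z\<close> whose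
  classes modulo \<open>B\<close> are linearly independent, and \<open>\<infinity>\<close> if there is no bound on this number.
\<close>

definition independent_mod :: "'v::real_vector set \<Rightarrow> 'v set \<Rightarrow> bool" where
  "independent_mod B S \<longleftrightarrow>
     finite S \<and> (\<forall>u. (\<Sum>v\<in>S. u v *\<^sub>R v) \<in> B \<longrightarrow> (\<forall>v\<in>S. u v = 0))"

definition quotient_dim :: "'v::real_vector set \<Rightarrow> 'v set \<Rightarrow> enat" where
  "quotient_dim Z B = (SUP S \<in> {S. S \<subseteq> Z \<and> independent_mod B S}. enat (card S))"

definition betti_number :: "nat \<Rightarrow> 'a topology \<Rightarrow> enat" where
  "betti_number n X = quotient_dim (real_cycles n X) (real_boundaries n X)"


section \<open>The Reeb metric graph of a distance function\<close>

definition quotient_topology :: "'a topology \<Rightarrow> ('a \<Rightarrow> 'b) \<Rightarrow> 'b topology" where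
  "quotient_topology X q =
     topology (\<lambda>U. U \<subseteq> q ` topspace X \<and> openin X {x \<in> topspace X. q x \<in> U})"

lemma openin_quotient_topology:
  "openin (quotient_topology X q) U \<longleftrightarrow>
     U \<subseteq> q ` topspace X \<and> openin X {x \<in> topspace X. q x \<in> U}"
proof -
  have int: "{x \<in> topspace X. q x \<in> S \<inter> T} =
      {x \<in> topspace X. q x \<in> S} \<inter> {x \<in> topspace X. q x \<in> T}" for S T
    by auto
  have un: "{x \<in> topspace X. q x \<in> \<Union>K} = (\<Union>S\<in>K. {x \<in> topspace X. q x \<in> S})" for K
    by auto
  have "istopology (\<lambda>U. U \<subseteq> q ` topspace X \<and> openin X {x \<in> topspace X. q x \<in> U})"
    unfolding istopology_def int un by (blast intro: openin_Int openin_Union)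
  then show ?thesis
    by (simp add: quotient_topology_def)
qed

lemma topspace_quotient_topology: "topspace (quotient_topology X q) = q ` topspace X"
proof -
  have "{x \<in> topspace X. q x \<in> q ` topspace X} = topspace X"
    by auto
  then have "openin (quotient_topology X q) (q ` topspace X)"
    by (simp add: openin_quotient_topology)
  then show ?thesis
    using openin_quotient_topology[of X q "topspace (quotient_topology X q)"]
    by (simp add: openin_subset subset_antisym)
qed

lemma quotient_map_quotient_topology: "quotient_map X (quotient_topology X q) q"
  by (auto simp: quotient_map_def topspace_quotient_topology openin_quotient_topology)

definition reeb_class :: "'a set \<Rightarrow> ('a \<Rightarrow> 'a \<Rightarrow> real) \<Rightarrow> 'a \<Rightarrow> 'a \<Rightarrow> 'a set" where
  "reeb_class M d p x =
     connected_component_of_set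
       (subtopology (Metric_space.mtopology M d) {y \<in> M. d p y = d p x}) x"

definition reeb_space :: "'a set \<Rightarrow> ('a \<Rightarrow> 'a \<Rightarrow> real) \<Rightarrow> 'a \<Rightarrow> 'a set set" where
  "reeb_space M d p = reeb_class M d p ` M"

definition reeb_topology :: "'a set \<Rightarrow> ('a \<Rightarrow> 'a \<Rightarrow> real) \<Rightarrow> 'a \<Rightarrow> 'a set topology" where
  "reeb_topology M d p = quotient_topology (Metric_space.mtopology M d) (reeb_class M d p)"

definition reeb_height :: "('a \<Rightarrow> 'a \<Rightarrow> real) \<Rightarrow> 'a \<Rightarrow> 'a set \<Rightarrow> real" where
  "reeb_height d p C = the_elem (d p ` C)"

lemma reeb_height_reeb_class:
  assumes "Metric_space M d" "x \<in> M"
  shows "reeb_height d p (reeb_class M d p x) = d p x"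
proof -
  interpret Metric_space M d
    by fact
  let ?F = "subtopology mtopology {y \<in> M. d p y = d p x}"
  have "reeb_class M d p x \<subseteq> topspace ?F"
    unfolding reeb_class_def by (rule connected_component_of_subset_topspace)
  then have "d p y = d p x" if "y \<in> reeb_class M d p x" for y
    using that by auto
  moreover have "x \<in> reeb_class M d p x"
    using assms by (auto simp: reeb_class_def connected_component_of_refl)
  ultimately have "d p ` reeb_class M d p x = {d p x}"
    by blast
  then show ?thesis
    by (simp add: reeb_height_def)
qed

text \<open>
  In a geodesic space the infimum is finite, since the image of a geodesic from \<open>x\<close> to \<open>y\<close> has
  length at most \<open>d x y\<close>; hence the conversion to the reals is harmless.
\<close>

definition reeb_metric :: "'a set \<Rightarrow> ('a \<Rightarrow> 'a \<Rightarrow> real) \<Rightarrow> 'a \<Rightarrow> 'a set \<Rightarrow> 'a set \<Rightarrow> real" where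
  "reeb_metric M d p C D =
     enn2real (INF \<beta> \<in> {\<beta>. pathin (reeb_topology M d p) \<beta> \<and> \<beta> 0 = C \<and> \<beta> 1 = D}.
       path_length dist (reeb_height d p \<circ> \<beta>))"

end

theory Submission
  imports Defs
begin

text \<open>
  Write \<open>\<delta>\<close> for a number just above the Gromov-Hausdorff distance of \<open>X\<close> and \<open>G\<close>. The canonical map
  from \<open>X\<close> to its Reeb space does not increase distances, so the two spaces are within
  Gromov-Hausdorff distance \<open>r\<close> as soon as \<open>d x y \<le> d_p [x] [y] + 2 r\<close> for all points
  (\<open>gh_distance_le_if_contraction\<close>). That the Reeb metric separates points comes from compactness:
  different components of a fibre are separated by open sets that contain all points of nearly the
  same height (\<open>cls_eq_if_reeb_metric_zero\<close>).

  For the inequality, let \<open>\<beta>\<close> be a path of the Reeb space from \<open>[x]\<close> to \<open>[y]\<close> whose height profile has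
  length about \<open>d_p [x] [y]\<close>. It need not lift to \<open>X\<close>, but its short pieces are covered by connected
  subsets of \<open>X\<close> of nearly constant height (\<open>connected_lift\<close>). Walking through these sets in small steps,
  mapping the steps to \<open>G\<close> by an almost isometry and joining their images by geodesics gives a path
  \<open>\<gamma>\<close> of \<open>G\<close> on which the distance to the image \<open>q\<close> of \<open>p\<close> follows the same profile up to about \<open>4 \<delta>\<close>
  (\<open>follows_reeb_path\<close>).

  It remains to bound the distance of the ends of \<open>\<gamma>\<close> by the profile. In a tree rooted at \<open>q\<close> this is
  easy, because the points \<open>u\<close> and \<open>v\<close> at the ends of a path satisfy \<open>d u v \<le> |u| + |v| - 2 m\<close>, where \<open>|.|\<close>
  is the distance to \<open>q\<close> and \<open>m\<close> its minimum on the path. The graph \<open>G\<close> becomes such a tree after a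
  few cuts. Subdivide its edges until along each of them distances are increments of the distance
  to \<open>q\<close> (\<open>ascending_graph_exists\<close>), choose for every vertex other than \<open>q\<close> one edge that arrives from
  below, and call the remaining edges chords. Off one cut point near the top of every chord the tree
  bound holds with an arbitrarily small error (\<open>tree_like_off_chord_points\<close>). After the removal of all
  detours between visits to the same cut point, the path \<open>\<gamma>\<close> falls into at most \<open>N + 1\<close> uncut pieces,
  \<open>N\<close> being the number of chords, and every piece exceeds the variation of its part of the profile by
  at most four times the error \<open>4 \<delta>\<close> (\<open>tree_like_bound\<close>). Together this yields \<open>r = (8 N + 9) \<delta>\<close>.

  Finally \<open>N \<le> b\<^sub>1(G)\<close> (\<open>card_chords_le_betti\<close>): a chord together with the descents from its two ends
  is a cycle, and collapsing the complement of the chord maps \<open>G\<close> to a circle. The winding number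
  under this map is a real cocycle that is 1 on the cycle of the chord and 0 on those of all others.
\<close>

section \<open>Lengths of polygonal chains and paths\<close>

fun chain_length :: "('a \<Rightarrow> 'a \<Rightarrow> real) \<Rightarrow> 'a list \<Rightarrow> real" where
  "chain_length d (x # y # zs) = d x y + chain_length d (y # zs)"
| "chain_length d _ = 0"

lemma chain_length_nonneg:
  assumes "\<And>x y. 0 \<le> d x y"
  shows "0 \<le> chain_length d xs"
  using assms by (induction d xs rule: chain_length.induct) auto

lemma sum_ennreal_eq_chain_length:
  assumes "\<And>x y. 0 \<le> d x y"
  shows "(\<Sum>i<length xs - 1. ennreal (d (xs ! i) (xs ! Suc i))) = ennreal (chain_length d xs)"
  using assms
proof (induction d xs rule: chain_length.induct)
  case (1 d x y zs)
  then show ?case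
    by (simp add: sum.lessThan_Suc_shift chain_length_nonneg del: sum.lessThan_Suc)
qed auto

lemma path_length_le_iff:
  assumes "\<And>x y. 0 \<le> d x y" "0 \<le> L"
  shows "path_length d g \<le> ennreal L \<longleftrightarrow>
    (\<forall>ts. sorted ts \<longrightarrow> set ts \<subseteq> {0..1} \<longrightarrow> chain_length d (map g ts) \<le> L)"
proof -
  have eq: "(\<Sum>i<length ts - 1. ennreal (d (g (ts ! i)) (g (ts ! Suc i)))) =
      ennreal (chain_length d (map g ts))" for ts
  proof -
    have "(\<Sum>i<length ts - 1. ennreal (d (g (ts ! i)) (g (ts ! Suc i)))) =
      (\<Sum>i<length (map g ts) - 1. ennreal (d (map g ts ! i) (map g ts ! Suc i)))"
      by (rule sum.cong) auto
    then show ?thesis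
      using sum_ennreal_eq_chain_length[of d "map g ts"] assms(1) by simp
  qed
  show ?thesis
    using assms unfolding path_length_def eq by (auto simp: SUP_le_iff ennreal_le_iff)
qed

lemma chain_length_append_ge:
  assumes "\<And>x y. 0 \<le> d x y"
  shows "chain_length d xs + chain_length d ys \<le> chain_length d (xs @ ys)"
  using assms
proof (induction d xs rule: chain_length.induct)
  case (1 d x y zs)
  then show ?case by simp
next
  case ("2_2" d v)
  then show ?case by (cases ys) auto
qed auto

lemma chain_length_append_shared:
  "chain_length d (xs @ [c]) + chain_length d (c # ys) = chain_length d (xs @ c # ys)"
proof (induction d xs rule: chain_length.induct)
  case ("2_2" d v)
  then show ?case by (cases ys) auto
qed auto

lemma (in Metric_space) chain_length_insert:
  assumes "set xs \<subseteq> M" "set ys \<subseteq> M" "c \<in> M"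
  shows "chain_length d (xs @ ys) \<le> chain_length d (xs @ c # ys)"
  using assms
proof (induction xs rule: induct_list012)
  case 1
  then show ?case by (cases ys) auto
next
  case (2 x)
  then show ?case by (cases ys) (auto simp: triangle)
qed auto

lemma chain_length_rev:
  assumes "\<And>x y. d x y = d y x"
  shows "chain_length d (rev xs) = chain_length d xs"
  using assms
proof (induction d xs rule: chain_length.induct)
  case (1 d x y zs)
  have "chain_length d ((rev zs @ [y]) @ [x]) = chain_length d (rev zs @ [y]) + chain_length d [y, x]"
    using chain_length_append_shared[of d "rev zs" y "[x]"] by simp
  with 1 show ?case by simp
qed auto

lemma chain_length_mono:
  assumes "\<And>x y. x \<in> set xs \<Longrightarrow> y \<in> set xs \<Longrightarrow> e (f x) (f y) \<le> d x y"
  shows "chain_length e (map f xs) \<le> chain_length d xs"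
  using assms by (induction xs rule: induct_list012) (auto intro!: add_mono)

definition join_paths :: "(real \<Rightarrow> 'a) \<Rightarrow> (real \<Rightarrow> 'a) \<Rightarrow> real \<Rightarrow> 'a" where
  "join_paths g h = (\<lambda>t. if t \<le> 1/2 then g (2 * t) else h (2 * t - 1))"

lemma join_paths_ends [simp]: "join_paths g h 0 = g 0" "join_paths g h 1 = h 1"
  by (simp_all add: join_paths_def)

lemma pathin_affine:
  assumes "pathin X g" "\<And>t. t \<in> S \<Longrightarrow> a * t + b \<in> {0..1}"
  shows "continuous_map (top_of_set S) X (\<lambda>t. g (a * t + b))"
proof -
  have "continuous_map (top_of_set S) (top_of_set {0..1}) (\<lambda>t. a * t + b)"
    using assms(2) by (auto simp: continuous_map_in_subtopology intro!: continuous_intros)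
  then show ?thesis
    using assms(1) continuous_map_compose[of _ _ _ X g] unfolding pathin_def comp_def by blast
qed

lemma pathin_join:
  assumes g: "pathin X g" and h: "pathin X h" and eq: "g 1 = h 0"
  shows "pathin X (join_paths g h)"
  unfolding pathin_def
proof (rule pasting_lemma_closed[where I = "{True, False}" and f = "\<lambda>b. if b then (\<lambda>t. g (2 * t)) else (\<lambda>t. h (2 * t - 1))"
      and T = "\<lambda>b. if b then {0..1/2} else {1/2..1}"])
  fix b :: bool
  show "continuous_map (subtopology (top_of_set {0..1}) (if b then {0..1/2} else {1/2..1})) X
     (if b then (\<lambda>t. g (2 * t)) else (\<lambda>t. h (2 * t - 1)))"
    using pathin_affine[OF g, of "{0..1/2}" 2 0] pathin_affine[OF h, of "{1/2..1}" 2 "-1"]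
    by (auto simp: subtopology_subtopology inf_absorb2)
next
  fix i j :: bool and x :: real
  assume "x \<in> topspace (top_of_set {0..1}) \<inter> (if i then {0..1/2} else {1/2..1}) \<inter> (if j then {0..1/2} else {1/2..1})"
  then show "(if i then (\<lambda>t. g (2 * t)) else (\<lambda>t. h (2 * t - 1))) x = (if j then (\<lambda>t. g (2 * t)) else (\<lambda>t. h (2 * t - 1))) x"
  proof -
    assume "x \<in> topspace (top_of_set {0..1}) \<inter> (if i then {0..1/2} else {1/2..1}) \<inter> (if j then {0..1/2} else {1/2..1})"
    then consider "i = j" | "x = 1/2" by (auto split: if_splits)
    then show ?thesis
    proof cases
      case 2
      show ?thesis unfolding 2 using eq by simp
    qed simp
  qed
next
  fix x :: real assume "x \<in> topspace (top_of_set {0..1})"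
  then show "\<exists>j. j \<in> {True, False} \<and> x \<in> (if j then {0..1/2} else {1/2..1}) \<and>
       join_paths g h x = (if j then (\<lambda>t. g (2 * t)) else (\<lambda>t. h (2 * t - 1))) x"
    by (intro exI[of _ "x \<le> 1/2"]) (auto simp: join_paths_def)
qed (auto simp: closedin_closed_eq)

lemma pathin_reverse:
  assumes "pathin X g"
  shows "pathin X (\<lambda>t. g (1 - t))"
  using pathin_affine[OF assms, of "{0..1}" "-1" 1] by (simp add: pathin_def)

lemma sorted_split_at:
  fixes ts :: "real list"
  assumes "sorted ts"
  shows "ts = filter (\<lambda>t. t \<le> c) ts @ filter (\<lambda>t. c < t) ts"
  using assms
proof (induction ts)
  case (Cons t ts)
  show ?case
  proof (cases "t \<le> c")
    case True
    then show ?thesis using Cons by auto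
  next
    case False
    then have "\<forall>x \<in> set ts. c < x" using Cons by auto
    then have "filter (\<lambda>t. t \<le> c) ts = []" "filter (\<lambda>t. c < t) ts = ts"
      by (auto simp: filter_empty_conv filter_id_conv)
    then show ?thesis using False by auto
  qed
qed auto

lemma (in Metric_space) path_length_join_le:
  assumes "g ` {0..1} \<subseteq> M" "h ` {0..1} \<subseteq> M" "g 1 = h 0" "0 \<le> K" "0 \<le> L"
    and "path_length d g \<le> ennreal K" "path_length d h \<le> ennreal L"
  shows "path_length d (join_paths g h) \<le> ennreal (K + L)"
proof -
  have K: "chain_length d (map g us) \<le> K" and L: "chain_length d (map h us) \<le> L"
    if "sorted us" "set us \<subseteq> {0..1}" for us
    using that assms by (simp_all add: path_length_le_iff)
  have "chain_length d (map (join_paths g h) ts) \<le> K + L" if ts: "sorted ts" "set ts \<subseteq> {0..1}" for ts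
  proof -
    define as where "as = filter (\<lambda>t. t \<le> 1/2) ts"
    define bs where "bs = filter (\<lambda>t. 1/2 < t) ts"
    have eq: "ts = as @ bs"
      unfolding as_def bs_def by (rule sorted_split_at[OF ts(1)])
    have mem: "join_paths g h t \<in> M" if "t \<in> {0..1}" for t
      using that assms(1,2) by (auto simp: join_paths_def image_subset_iff)
    have "chain_length d (map (join_paths g h) ts) \<le>
        chain_length d (map (join_paths g h) as @ join_paths g h (1/2) # map (join_paths g h) bs)"
      unfolding eq map_append using ts mem eq by (intro chain_length_insert) auto
    also have "\<dots> = chain_length d (map (join_paths g h) (as @ [1/2])) +
        chain_length d (map (join_paths g h) (1/2 # bs))"
      using chain_length_append_shared[of d "map (join_paths g h) as"] by simp
    also have "map (join_paths g h) (as @ [1/2]) = map g (map (\<lambda>t. 2 * t) (as @ [1/2]))"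
      by (auto simp: as_def join_paths_def)
    also have "map (join_paths g h) (1/2 # bs) = map h (map (\<lambda>t. 2 * t - 1) (1/2 # bs))"
      using assms(3) by (auto simp: bs_def join_paths_def)
    also have "chain_length d (map g (map (\<lambda>t. 2 * t) (as @ [1/2]))) \<le> K"
    proof -
      have "sorted (map (\<lambda>t. 2 * t) (as @ [1/2]))" "set (map (\<lambda>t. 2 * t) (as @ [1/2])) \<subseteq> {0..1}"
        using ts by (auto simp: sorted_append sorted_map as_def sorted_wrt_filter)
      then show ?thesis by (rule K)
    qed
    also have "chain_length d (map h (map (\<lambda>t. 2 * t - 1) (1/2 # bs))) \<le> L"
    proof -
      have "sorted (map (\<lambda>t. 2 * t - 1) (1/2 # bs))" "set (map (\<lambda>t. 2 * t - 1) (1/2 # bs)) \<subseteq> {0..1}"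
        using ts by (auto simp: sorted_map bs_def sorted_wrt_filter)
      then show ?thesis by (rule L)
    qed
    finally show ?thesis by simp
  qed
  then show ?thesis
    using assms(4,5) by (subst path_length_le_iff) auto
qed

lemma (in Metric_space) path_length_reverse_le:
  assumes "0 \<le> L" "path_length d g \<le> ennreal L"
  shows "path_length d (\<lambda>t. g (1 - t)) \<le> ennreal L"
proof -
  have "chain_length d (map (\<lambda>t. g (1 - t)) ts) \<le> L" if ts: "sorted ts" "set ts \<subseteq> {0..1}" for ts
  proof -
    define us where "us = map (\<lambda>t. 1 - t) (rev ts)"
    have "sorted us" "set us \<subseteq> {0..1}"
      using ts by (auto simp: us_def sorted_map sorted_wrt_rev)
    then have "chain_length d (map g us) \<le> L"
      using assms by (simp add: path_length_le_iff)
    moreover have "map g us = rev (map (\<lambda>t. g (1 - t)) ts)"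
      by (simp add: us_def rev_map comp_def)
    ultimately show ?thesis
      by (simp add: chain_length_rev commute)
  qed
  with assms show ?thesis by (simp add: path_length_le_iff)
qed

lemma geodesicE:
  assumes "geodesic_space M d" "x \<in> M" "y \<in> M"
  obtains g where "pathin (Metric_space.mtopology M d) g" "g 0 = x" "g 1 = y"
    "path_length d g \<le> ennreal (d x y)"
    "\<And>s t. 0 \<le> s \<Longrightarrow> s \<le> t \<Longrightarrow> t \<le> 1 \<Longrightarrow> d x (g s) + d (g s) (g t) + d (g t) y \<le> d x y"
proof -
  interpret Metric_space M d
    using assms(1) by (simp add: geodesic_space_def)
  obtain g where g: "pathin mtopology g" "g 0 = x" "g 1 = y" "path_length d g = ennreal (d x y)"
    using assms unfolding geodesic_space_def by meson
  have "d x (g s) + d (g s) (g t) + d (g t) y \<le> d x y" if "0 \<le> s" "s \<le> t" "t \<le> 1" for s t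
  proof -
    have "\<forall>ts. sorted ts \<longrightarrow> set ts \<subseteq> {0..1} \<longrightarrow> chain_length d (map g ts) \<le> d x y"
      using g(4) path_length_le_iff[of d "d x y" g] by simp
    from this[rule_format, of "[0, s, t, 1]"] show ?thesis
      using that g by simp
  qed
  with that g show ?thesis by simp
qed

lemma (in Metric_space) continuous_dist: "x \<in> M \<Longrightarrow> continuous_map mtopology euclideanreal (d x)"
proof -
  assume x: "x \<in> M"
  show ?thesis
    unfolding mtopology_is_euclidean[symmetric]
  proof (subst metric_continuous_map[OF Met_TC.Metric_space_axioms]; safe)
    fix a and e :: real assume "a \<in> M" "0 < e"
    then show "\<exists>r>0. \<forall>y. y \<in> M \<and> d a y < r \<longrightarrow> dist (d x a) (d x y) < e"
      using mdist_reverse_triangle x commute by (intro exI[of _ e]) (smt (verit) dist_real_def)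
  qed auto
qed

section \<open>An upper bound for the Gromov-Hausdorff distance\<close>

text \<open>
  Since \<open>q\<close> contracts distances, \<open>e (q x) v + r\<close> is already a metric between a point \<open>x\<close> of \<open>M\<close> and a
  point \<open>v\<close> of \<open>N\<close> on the disjoint union; no infimum over intermediate points has to be taken.
\<close>

lemma gh_distance_le_if_contraction:
  assumes M: "Metric_space M d" and N: "Metric_space N e" and q: "q ` M = N" and r: "0 < r"
    and contr: "\<And>x y. x \<in> M \<Longrightarrow> y \<in> M \<Longrightarrow> e (q x) (q y) \<le> d x y"
    and dist: "\<And>x y. x \<in> M \<Longrightarrow> y \<in> M \<Longrightarrow> d x y \<le> e (q x) (q y) + 2 * r"
  shows "gh_distance M d N e \<le> ennreal r"
proof -
  interpret M: Metric_space M d by fact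
  interpret N: Metric_space N e by fact
  define D where "D = (\<lambda>a b. case (a, b) of
      (Inl x, Inl y) \<Rightarrow> d x y | (Inr u, Inr v) \<Rightarrow> e u v
    | (Inl x, Inr v) \<Rightarrow> e (q x) v + r | (Inr u, Inl y) \<Rightarrow> e u (q y) + r)"
  have D [simp]: "D (Inl x) (Inl y) = d x y" "D (Inr u) (Inr v) = e u v"
    "D (Inl x) (Inr v) = e (q x) v + r" "D (Inr u) (Inl y) = e u (q y) + r" for x y u v
    by (simp_all add: D_def)
  let ?Z = "Inl ` M \<union> Inr ` N"
  have qN: "q x \<in> N" if "x \<in> M" for x
    using q that by blast
  have Z: "Metric_space ?Z D"
  proof
    fix a b :: "'a + 'b"
    show "0 \<le> D a b" "D a b = D b a"
      using r by (cases a; cases b; simp add: M.commute N.commute)+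
    show "D a b = 0 \<longleftrightarrow> a = b" if "a \<in> ?Z" "b \<in> ?Z"
      using that r by (auto simp: add_nonneg_eq_0_iff)
    fix c assume "a \<in> ?Z" "b \<in> ?Z" "c \<in> ?Z"
    moreover have "e (q x) (q z) \<le> e (q x) v + e v (q z)" if "x \<in> M" "z \<in> M" "v \<in> N" for x z v
      using that N.triangle qN by blast
    ultimately show "D a c \<le> D a b + D b c"
      apply (elim UnE imageE; simp)
      subgoal for x y z using M.triangle by simp
      subgoal for x y w using N.triangle[of "q x" "q y" w] contr[of x y] qN by simp
      subgoal for x v z using N.triangle[of "q x" v "q z"] dist[of x z] qN by fastforce
      subgoal for x v w using N.triangle[of "q x" v w] qN by simp
      subgoal for u y z using N.triangle[of u "q y" "q z"] contr[of y z] qN by simp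
      subgoal for u y w using N.triangle[of u "q y" w] qN r by simp
      subgoal for u v z using N.triangle[of u v "q z"] qN by simp
      subgoal for u v w using N.triangle[of u v w] by simp
      done
  qed
  have H: "hausdorff_distance D (Inl ` M) (Inr ` N) \<le> ennreal r"
    unfolding hausdorff_distance_def
  proof (intro max.boundedI SUP_least)
    fix a :: "'a + 'b" assume "a \<in> Inl ` M"
    then obtain x where x: "x \<in> M" "a = Inl x" by auto
    show "(INF b\<in>Inr ` N. ennreal (D a b)) \<le> ennreal r"
      using x qN by (intro INF_lower2[of "Inr (q x)"]) auto
  next
    fix b :: "'a + 'b" assume "b \<in> Inr ` N"
    then obtain x where x: "x \<in> M" "b = Inr (q x)" using q by auto
    show "(INF a\<in>Inl ` M. ennreal (D a b)) \<le> ennreal r"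
      using x qN by (intro INF_lower2[of "Inl x"]) auto
  qed
  have "isometric_embedding M d ?Z D Inl" "isometric_embedding N e ?Z D Inr"
    by (auto simp: isometric_embedding_def)
  with Z have "gh_distance M d N e \<le> hausdorff_distance D (Inl ` M) (Inr ` N)"
    unfolding gh_distance_def by (intro Inf_lower) blast
  with H show ?thesis by simp
qed

text \<open>Sending every point to a nearby point in a common ambient space is an almost isometry.\<close>

lemma gh_distance_lessE:
  assumes "gh_distance M d N e < ennreal r"
  obtains k where "\<And>x. x \<in> M \<Longrightarrow> k x \<in> N"
    "\<And>x y. x \<in> M \<Longrightarrow> y \<in> M \<Longrightarrow> \<bar>d x y - e (k x) (k y)\<bar> \<le> 2 * r"
proof -
  obtain Z :: "('a + 'b) set" and D f g where Z: "Metric_space Z D" "isometric_embedding M d Z D f" "isometric_embedding N e Z D g"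
    "hausdorff_distance D (f ` M) (g ` N) < ennreal r"
    using assms unfolding gh_distance_def Inf_less_iff by blast
  interpret Z: Metric_space Z D by fact
  have "\<exists>u\<in>N. D (f x) (g u) < r" if "x \<in> M" for x
  proof -
    have "(INF b\<in>g ` N. ennreal (D (f x) b)) \<le> hausdorff_distance D (f ` M) (g ` N)"
      unfolding hausdorff_distance_def using that
      by (intro max.coboundedI1 SUP_upper) auto
    then have "(INF b\<in>g ` N. ennreal (D (f x) b)) < ennreal r"
      using Z(4) by (rule le_less_trans)
    then show ?thesis
      by (auto simp: INF_less_iff ennreal_less_iff)
  qed
  then obtain k where k: "\<And>x. x \<in> M \<Longrightarrow> k x \<in> N" "\<And>x. x \<in> M \<Longrightarrow> D (f x) (g (k x)) < r"
    by metis
  show thesis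
  proof
    fix x y assume xy: "x \<in> M" "y \<in> M"
    have mem: "f x \<in> Z" "f y \<in> Z" "g (k x) \<in> Z" "g (k y) \<in> Z"
      using xy k Z by (auto simp: isometric_embedding_def)
    have "d x y = D (f x) (f y)" "e (k x) (k y) = D (g (k x)) (g (k y))"
      using xy k Z by (auto simp: isometric_embedding_def)
    moreover have "D (f x) (g (k x)) < r" "D (f y) (g (k y)) < r"
      using k(2) xy by auto
    moreover have "D (f x) (f y) \<le> D (f x) (g (k x)) + D (g (k x)) (g (k y)) + D (f y) (g (k y))"
      using Z.triangle[OF mem(1,3,2)] Z.triangle[OF mem(3,4,2)] Z.commute[of "f y"] by simp
    moreover have "D (g (k x)) (g (k y)) \<le> D (f x) (g (k x)) + D (f x) (f y) + D (f y) (g (k y))"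
      using Z.triangle[OF mem(3,1,4)] Z.triangle[OF mem(1,2,4)] Z.commute[of "f x"] by simp
    ultimately show "\<bar>d x y - e (k x) (k y)\<bar> \<le> 2 * r"
      by linarith
  qed (use k in auto)
qed

section \<open>The Reeb metric of a distance function\<close>

lemma normal_spaceD:
  assumes "normal_space X" "closedin X A" "closedin X B" "disjnt A B"
  shows "\<exists>U W. openin X U \<and> openin X W \<and> A \<subseteq> U \<and> B \<subseteq> W \<and> disjnt U W"
  using assms by (simp add: normal_space_def)

lemma quasi_eq_connected_component_of_compact:
  assumes "compact_space X" "Hausdorff_space X" "quasi_component_of X x y"
  shows "connected_component_of X x y"
proof -
  let ?C = "quasi_component_of_set X x"
  have xy: "x \<in> topspace X" "y \<in> topspace X"
    using quasi_component_in_topspace[OF assms(3)] by auto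
  then have "?C \<in> quasi_components_of X"
    by (auto simp: quasi_components_of_def)
  moreover from this have "compactin X ?C"
    using assms(1) closedin_compact_space closedin_quasi_components_of by blast
  ultimately have "?C \<in> connected_components_of X"
    using compact_quasi_eq_connected_components_of[of X ?C] assms
      compact_imp_locally_compact_space by blast
  then have "connectedin X ?C"
    by (rule connectedin_connected_components_of)
  then show ?thesis
    unfolding connected_component_of_def using assms(3) xy by auto
qed

locale reeb_graph = Metric_space M d for M :: "'a set" and d +
  fixes p :: 'a
  assumes geodesic: "geodesic_space M d" and base: "p \<in> M"
begin

abbreviation "cls \<equiv> reeb_class M d p"
abbreviation "height \<equiv> reeb_height d p"

lemma height_cls: "x \<in> M \<Longrightarrow> height (cls x) = d p x"
  using reeb_height_reeb_class[OF Metric_space_axioms] .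

lemma mem_cls: "x \<in> M \<Longrightarrow> x \<in> cls x"
  by (simp add: reeb_class_def connected_component_of_refl)

lemma cls_subset: "cls x \<subseteq> {y \<in> M. d p y = d p x}"
  using connected_component_of_subset_topspace unfolding reeb_class_def by fastforce

lemma cls_eqI:
  assumes "y \<in> cls x"
  shows "cls y = cls x"
proof -
  have eq: "d p y = d p x"
    using cls_subset assms by blast
  have "connected_component_of (subtopology mtopology {y \<in> M. d p y = d p x}) x y"
    using assms by (simp add: reeb_class_def)
  then show ?thesis
    unfolding reeb_class_def eq by (simp add: connected_component_of_equiv)
qed

lemma connectedin_cls: "connectedin mtopology (cls x)"
  using connectedin_connected_component_of[of "subtopology mtopology {y \<in> M. d p y = d p x}" x]
  by (simp add: reeb_class_def connectedin_subtopology)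

lemma quotient_map_cls: "quotient_map mtopology (reeb_topology M d p) cls"
  unfolding reeb_topology_def by (rule quotient_map_quotient_topology)

lemma topspace_reeb: "topspace (reeb_topology M d p) = reeb_space M d p"
  by (simp add: reeb_topology_def topspace_quotient_topology reeb_space_def)

lemma continuous_height: "continuous_map (reeb_topology M d p) euclideanreal height"
proof (rule continuous_compose_quotient_map[OF quotient_map_cls])
  show "continuous_map mtopology euclideanreal (height \<circ> cls)"
    using continuous_dist[OF base] by (rule continuous_map_eq) (simp add: height_cls)
qed

lemma connected_in_ball:
  assumes "x \<in> M" "z \<in> mball x r"
  obtains K where "connectedin mtopology K" "x \<in> K" "z \<in> K" "K \<subseteq> mball x r"
proof -
  have z: "z \<in> M" "d x z < r"
    using assms by auto
  obtain g where g: "pathin mtopology g" "g 0 = x" "g 1 = z"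
    "\<And>s t. 0 \<le> s \<Longrightarrow> s \<le> t \<Longrightarrow> t \<le> 1 \<Longrightarrow> d x (g s) + d (g s) (g t) + d (g t) z \<le> d x z"
    using geodesicE[OF geodesic assms(1) z(1)] by metis
  have "g s \<in> mball x r" if "s \<in> {0..1}" for s
  proof -
    have "g s \<in> M"
      using path_image_subset_topspace[OF g(1)] that by auto
    moreover have "d x (g s) \<le> d x z"
    proof -
      have "d x (g s) + d (g s) (g s) + d (g s) z \<le> d x z"
        using g(4)[of s s] that by simp
      then show ?thesis
        using nonneg[of "g s" z] nonneg[of "g s" "g s"] by linarith
    qed
    ultimately show ?thesis
      using assms z by simp
  qed
  then show thesis
    using that[of "g ` {0..1}"] g connectedin_path_image[OF g(1)] by force
qed

text \<open>
  Why a connected set downstairs yields a connected one upstairs although its preimage need not be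
  connected: the open set of points whose height lies between two bounds is saturated, and its connected
  components are open and saturated as well, so they project to disjoint open sets of the Reeb
  space, only one of which can meet the given set.
\<close>

lemma connected_lift:
  assumes S: "connectedin (reeb_topology M d p) S" and ab: "\<And>c. c \<in> S \<Longrightarrow> a < height c \<and> height c < b"
    and xy: "x \<in> M" "y \<in> M" "cls x \<in> S" "cls y \<in> S"
  obtains K where "connectedin mtopology K" "x \<in> K" "y \<in> K"
    "K \<subseteq> {z \<in> M. a < d p z \<and> d p z < b}"
proof -
  define U where "U = {z \<in> topspace mtopology. d p z \<in> {a<..<b}}"
  define A where "A = connected_component_of_set (subtopology mtopology U) x"
  have openU: "openin mtopology U"
    unfolding U_def by (rule openin_continuous_map_preimage[OF continuous_dist[OF base]]) auto
  have AU: "A \<subseteq> U" "connectedin mtopology A"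
    using connectedin_connected_component_of[of "subtopology mtopology U" x]
    by (auto simp: A_def connectedin_subtopology)
  have absorb: "K \<subseteq> A" if K: "connectedin mtopology K" "K \<subseteq> U" "K \<inter> A \<noteq> {}" for K
  proof -
    obtain z where z: "z \<in> K" "z \<in> A" using K(3) by auto
    have "connected_component_of (subtopology mtopology U) z w" if "w \<in> K" for w
      using z K(1,2) that
      unfolding connected_component_of_def connectedin_subtopology by blast
    with z show ?thesis
      unfolding A_def by (auto intro: connected_component_of_trans)
  qed
  have open_pieces: "openin mtopology A" "openin mtopology (U - A)"
  proof -
    have *: "\<exists>r>0. mball z r \<subseteq> U \<and> (z \<in> A \<longrightarrow> mball z r \<subseteq> A) \<and> (z \<notin> A \<longrightarrow> mball z r \<inter> A = {})"
      if zU: "z \<in> U" for z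
    proof -
      obtain r where r: "r > 0" "mball z r \<subseteq> U"
        using openU zU unfolding openin_mtopology by blast
      have "w \<in> A \<longleftrightarrow> z \<in> A" if w: "w \<in> mball z r" for w
      proof -
        have "z \<in> M" using w by simp
        then obtain K where "connectedin mtopology K" "z \<in> K" "w \<in> K" "K \<subseteq> mball z r"
          using connected_in_ball w by blast
        then show ?thesis
          using absorb[of K] r by blast
      qed
      with r show ?thesis by (intro exI[of _ r]) auto
    qed
    have UM: "U \<subseteq> M" by (auto simp: U_def)
    show "openin mtopology A"
      unfolding openin_mtopology
    proof (intro conjI allI impI)
      show "A \<subseteq> M" using AU UM by blast
      show "\<exists>r>0. mball z r \<subseteq> A" if "z \<in> A" for z
        using *[of z] that AU(1) by blast
    qed
    show "openin mtopology (U - A)"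
      unfolding openin_mtopology
    proof (intro conjI allI impI)
      show "U - A \<subseteq> M" using UM by blast
      show "\<exists>r>0. mball z r \<subseteq> U - A" if "z \<in> U - A" for z
        using *[of z] that by blast
    qed
  qed
  have sat: "cls z \<subseteq> U" if "z \<in> U" for z
    using that cls_subset[of z] by (auto simp: U_def)
  have satA: "cls z \<subseteq> A" if "z \<in> A" for z
    using absorb[OF connectedin_cls, of z] sat[of z] AU mem_cls[of z] that by (auto simp: U_def)
  have open_image: "openin (reeb_topology M d p) (cls ` V)"
    if "openin mtopology V" "\<And>z. z \<in> V \<Longrightarrow> cls z \<subseteq> V" for V
  proof -
    have "V \<subseteq> M" using openin_subset[OF that(1)] by simp
    moreover from this have "{z \<in> M. cls z \<in> cls ` V} = V"
      using that(2) mem_cls by blast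
    ultimately show ?thesis
      using that(1) by (auto simp: reeb_topology_def openin_quotient_topology)
  qed
  have satB: "cls z \<subseteq> U - A" if "z \<in> U - A" for z
  proof -
    have "z \<in> cls w" if "w \<in> cls z" for w
      using that cls_eqI[OF that] mem_cls[of z] \<open>z \<in> U - A\<close> by (auto simp: U_def)
    then show ?thesis
      using satA sat that by blast
  qed
  have x: "x \<in> A"
  proof -
    have "x \<in> U" using ab[OF xy(3)] xy by (auto simp: U_def height_cls)
    then show ?thesis
      using xy by (auto simp: A_def connected_component_of_refl)
  qed
  have "y \<in> A"
  proof (rule ccontr)
    assume "y \<notin> A"
    moreover have "y \<in> U" using ab[OF xy(4)] xy by (auto simp: U_def height_cls)
    ultimately have y: "y \<in> U - A" by simp
    have cover: "S \<subseteq> cls ` A \<union> cls ` (U - A)"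
    proof
      fix c assume c: "c \<in> S"
      then obtain z where z: "z \<in> M" "c = cls z"
        using connectedin_subset_topspace[OF S] by (auto simp: topspace_reeb reeb_space_def)
      then have "z \<in> U" using ab[OF c] by (auto simp: U_def height_cls)
      then show "c \<in> cls ` A \<union> cls ` (U - A)" using z by blast
    qed
    have disj: "cls ` A \<inter> cls ` (U - A) = {}"
    proof -
      have False if "z \<in> A" "w \<in> U - A" "cls z = cls w" for z w
        using satA[OF that(1)] mem_cls[of w] that by (auto simp: U_def)
      then show ?thesis by blast
    qed
    show False
      using connectedinD[OF S open_image[OF open_pieces(1) satA] open_image[OF open_pieces(2) satB] cover]
        disj x y xy by blast
  qed
  then show thesis
    using that[of A] AU x by (force simp: U_def)
qed

lemma connected_lift_path:
  assumes \<beta>: "pathin (reeb_topology M d p) \<beta>" and st: "0 \<le> s" "s \<le> t" "t \<le> 1"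
    and ab: "\<And>u. s \<le> u \<Longrightarrow> u \<le> t \<Longrightarrow> a < height (\<beta> u) \<and> height (\<beta> u) < b"
    and xy: "x \<in> M" "y \<in> M" "\<beta> s = cls x" "\<beta> t = cls y"
  obtains K where "connectedin mtopology K" "x \<in> K" "y \<in> K"
    "K \<subseteq> {z \<in> M. a < d p z \<and> d p z < b}"
proof -
  have S: "connectedin (reeb_topology M d p) (\<beta> ` {s..t})"
  proof (rule connectedin_continuous_map_image)
    show "continuous_map (top_of_set {0..1}) (reeb_topology M d p) \<beta>"
      using \<beta> by (simp add: pathin_def)
    show "connectedin (top_of_set {0..1}) {s..t}"
      using st by (auto simp: connectedin_subtopology)
  qed
  have "cls x \<in> \<beta> ` {s..t}" "cls y \<in> \<beta> ` {s..t}"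
    unfolding xy(3,4)[symmetric] using st by auto
  moreover have "a < height c \<and> height c < b" if "c \<in> \<beta> ` {s..t}" for c
    using that ab by auto
  ultimately obtain K where "connectedin mtopology K" "x \<in> K" "y \<in> K"
    "K \<subseteq> {z \<in> M. a < d p z \<and> d p z < b}"
    using connected_lift[OF S, of a b x y] xy(1,2) by blast
  then show thesis by (rule that)
qed

lemma height_path_continuous:
  assumes "pathin (reeb_topology M d p) \<beta>"
  shows "continuous_on {0..1} (height \<circ> \<beta>)"
  using pathin_compose[OF assms continuous_height] by (simp add: path_def)

definition reeb_connects :: "real \<Rightarrow> (real \<Rightarrow> 'a set) \<Rightarrow> 'a set \<Rightarrow> 'a set \<Rightarrow> bool" where
  "reeb_connects L \<beta> C D \<longleftrightarrow> pathin (reeb_topology M d p) \<beta> \<and> \<beta> 0 = C \<and> \<beta> 1 = D \<and>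
     path_length dist (height \<circ> \<beta>) \<le> ennreal L"

lemma reeb_connects_geodesic:
  assumes "x \<in> M" "y \<in> M"
  shows "\<exists>\<beta>. reeb_connects (d x y) \<beta> (cls x) (cls y)"
proof -
  obtain g where g: "pathin mtopology g" "g 0 = x" "g 1 = y" "path_length d g \<le> ennreal (d x y)"
    using geodesicE[OF geodesic assms] by metis
  have mem: "g t \<in> M" if "t \<in> {0..1}" for t
    using path_image_subset_topspace[OF g(1)] that by auto
  have "chain_length dist (map (height \<circ> (cls \<circ> g)) ts) \<le> d x y" if ts: "sorted ts" "set ts \<subseteq> {0..1}" for ts
  proof -
    have *: "dist (height (cls u)) (height (cls v)) \<le> d u v" if "u \<in> M" "v \<in> M" for u v
      using that mdist_reverse_triangle[of u p v] base by (simp add: height_cls dist_real_def commute)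
    have "chain_length dist (map (height \<circ> cls) (map g ts)) \<le> chain_length d (map g ts)"
      using ts mem * by (intro chain_length_mono) (auto simp: subset_iff)
    also have "\<dots> \<le> d x y"
      using g(4) ts by (simp add: path_length_le_iff)
    finally show ?thesis by (simp add: comp_assoc)
  qed
  then have "path_length dist (height \<circ> (cls \<circ> g)) \<le> ennreal (d x y)"
    by (subst path_length_le_iff) auto
  moreover have "pathin (reeb_topology M d p) (cls \<circ> g)"
    using g(1) quotient_imp_continuous_map[OF quotient_map_cls] by (rule pathin_compose)
  ultimately show ?thesis
    unfolding reeb_connects_def using g by (intro exI[of _ "cls \<circ> g"]) auto
qed

lemma reeb_metric_le:
  assumes "reeb_connects L \<beta> C D" "0 \<le> L"
  shows "reeb_metric M d p C D \<le> L"
  unfolding reeb_metric_def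
proof (rule enn2real_leI)
  show "(INF \<beta> \<in> {\<beta>. pathin (reeb_topology M d p) \<beta> \<and> \<beta> 0 = C \<and> \<beta> 1 = D}.
       path_length dist (height \<circ> \<beta>)) \<le> ennreal L"
    using assms unfolding reeb_connects_def by (intro INF_lower2[of \<beta>]) auto
qed (use assms in auto)

lemma reeb_metric_lessE:
  assumes "C \<in> reeb_space M d p" "D \<in> reeb_space M d p" "reeb_metric M d p C D < L"
  obtains \<beta> where "reeb_connects L \<beta> C D"
proof -
  let ?I = "INF \<beta> \<in> {\<beta>. pathin (reeb_topology M d p) \<beta> \<and> \<beta> 0 = C \<and> \<beta> 1 = D}.
       path_length dist (height \<circ> \<beta>)"
  obtain x y where xy: "x \<in> M" "y \<in> M" "C = cls x" "D = cls y"
    using assms by (auto simp: reeb_space_def)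
  then obtain \<gamma> where "reeb_connects (d x y) \<gamma> C D"
    using reeb_connects_geodesic by blast
  then have "?I \<le> ennreal (d x y)"
    unfolding reeb_connects_def by (intro INF_lower2[of \<gamma>]) auto
  then have "?I < \<infinity>"
    by (rule le_less_trans) simp
  then have "?I = ennreal (enn2real ?I)" by simp
  also have "\<dots> < ennreal L"
    using assms(3) unfolding reeb_metric_def by (intro ennreal_lessI) (auto intro: le_less_trans[OF enn2real_nonneg])
  finally have "?I < ennreal L" .
  then show thesis
    using that unfolding INF_less_iff reeb_connects_def by (auto intro: less_imp_le)
qed

lemma reeb_connects_height:
  assumes "reeb_connects L \<beta> C D" "0 \<le> L" "s \<in> {0..1}" "t \<in> {0..1}"
  shows "\<bar>height (\<beta> s) - height (\<beta> t)\<bar> \<le> L"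
proof -
  have "\<forall>ts. sorted ts \<longrightarrow> set ts \<subseteq> {0..1} \<longrightarrow> chain_length dist (map (height \<circ> \<beta>) ts) \<le> L"
    using assms(1,2) by (auto simp: reeb_connects_def path_length_le_iff)
  from this[rule_format, of "[min s t, max s t]"]
  have "chain_length dist (map (height \<circ> \<beta>) [min s t, max s t]) \<le> L"
    using assms(3,4) by (simp add: min_def max_def)
  then show ?thesis
    by (auto simp: min_def max_def dist_real_def split: if_splits)
qed

lemma reeb_metric_le_dist: "x \<in> M \<Longrightarrow> y \<in> M \<Longrightarrow> reeb_metric M d p (cls x) (cls y) \<le> d x y"
  using reeb_connects_geodesic reeb_metric_le nonneg by meson

text \<open>
  In a compact space the components of a fibre are its quasi-components, so distinct ones are
  separated by disjoint open sets which together contain all points of nearly the same height.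
\<close>

lemma cls_eq_if_reeb_metric_zero:
  assumes compact: "compact_space mtopology" and xy: "x \<in> M" "y \<in> M"
    and zero: "reeb_metric M d p (cls x) (cls y) = 0"
  shows "cls x = cls y"
proof (rule ccontr)
  assume ne: "cls x \<noteq> cls y"
  have conn: "\<exists>K. connectedin mtopology K \<and> x \<in> K \<and> y \<in> K \<and> (\<forall>z\<in>K. z \<in> M \<and> \<bar>d p z - d p x\<bar> < e)"
    if "0 < e" for e
  proof -
    obtain \<beta> where \<beta>: "reeb_connects (e/2) \<beta> (cls x) (cls y)"
      using reeb_metric_lessE[of "cls x" "cls y" "e/2"] \<open>0 < e\<close> xy zero by (auto simp: reeb_space_def)
    have bounds: "d p x - e < height (\<beta> u) \<and> height (\<beta> u) < d p x + e" if "0 \<le> u" "u \<le> 1" for u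
    proof -
      have "\<bar>height (\<beta> u) - d p x\<bar> \<le> e/2"
        using reeb_connects_height[OF \<beta>, of u 0] \<beta> that \<open>0 < e\<close> xy by (auto simp: reeb_connects_def height_cls)
      then show ?thesis using \<open>0 < e\<close> unfolding abs_le_iff by auto
    qed
    have ends: "pathin (reeb_topology M d p) \<beta>" "\<beta> 0 = cls x" "\<beta> 1 = cls y"
      using \<beta> by (auto simp: reeb_connects_def)
    obtain K where K: "connectedin mtopology K" "x \<in> K" "y \<in> K"
        "K \<subseteq> {z \<in> M. d p x - e < d p z \<and> d p z < d p x + e}"
      by (rule connected_lift_path[OF ends(1) order_refl zero_le_one order_refl bounds xy ends(2,3)])
    have "z \<in> M \<and> \<bar>d p z - d p x\<bar> < e" if "z \<in> K" for z
      using subsetD[OF K(4) that] unfolding abs_less_iff by auto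
    with K(1-3) show ?thesis by blast
  qed
  have same: "d p y = d p x"
  proof (rule ccontr)
    assume "d p y \<noteq> d p x"
    then obtain K where "y \<in> K" "\<forall>z\<in>K. \<bar>d p z - d p x\<bar> < \<bar>d p y - d p x\<bar>"
      using conn[of "\<bar>d p y - d p x\<bar>"] by auto
    then show False by blast
  qed
  define F where "F = {z \<in> topspace mtopology. d p z \<in> {d p x}}"
  have F: "F = {z \<in> M. d p z = d p x}"
    by (auto simp: F_def)
  have closedF: "closedin mtopology F"
    unfolding F_def by (rule closedin_continuous_map_preimage[OF continuous_dist[OF base]]) auto
  have "compact_space (subtopology mtopology F)"
    using closedin_compact_space[OF compact closedF] by (simp add: compact_space_subtopology)
  moreover have "Hausdorff_space (subtopology mtopology F)"
    by (simp add: Hausdorff_space_mtopology Hausdorff_space_subtopology)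
  ultimately have quasi: "quasi_component_of (subtopology mtopology F) x y \<Longrightarrow>
      connected_component_of (subtopology mtopology F) x y"
    by (rule quasi_eq_connected_component_of_compact)
  have "\<not> connected_component_of (subtopology mtopology F) x y"
  proof
    assume "connected_component_of (subtopology mtopology F) x y"
    then have "y \<in> cls x"
      by (simp add: reeb_class_def F)
    then show False
      using cls_eqI ne by metis
  qed
  with quasi obtain A B where AB: "openin (subtopology mtopology F) A" "openin (subtopology mtopology F) B"
      "A \<union> B = F" "disjnt A B" "x \<in> A" "y \<in> B"
    using xy same unfolding quasi_component_of_alt by (auto simp: F)
  have "closedin (subtopology mtopology F) A" "closedin (subtopology mtopology F) B"
  proof -
    have "A = F - B" "B = F - A" using AB by (auto simp: disjnt_iff)
    moreover have "topspace (subtopology mtopology F) = F"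
      by (auto simp: F_def)
    ultimately show "closedin (subtopology mtopology F) A" "closedin (subtopology mtopology F) B"
      using AB(1,2) by (metis closedin_diff closedin_topspace)+
  qed
  then have closed: "closedin mtopology A" "closedin mtopology B"
    using closedF closedin_trans_full by blast+
  have "normal_space mtopology"
    by (simp add: compact compact_Hausdorff_or_regular_imp_normal_space Hausdorff_space_mtopology)
  then obtain U W where UW: "openin mtopology U" "openin mtopology W" "A \<subseteq> U" "B \<subseteq> W" "disjnt U W"
    using normal_spaceD closed AB(4) by metis
  define Q where "Q = M - (U \<union> W)"
  have "compactin mtopology Q"
    unfolding Q_def using UW by (intro closedin_compact_space[OF compact] closedin_diff) auto
  then have cQ: "compact (d p ` Q)"
    using image_compactin[OF _ continuous_dist[OF base]] by simp
  have "d p x \<notin> d p ` Q"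
  proof
    assume "d p x \<in> d p ` Q"
    then obtain z where z: "z \<in> M" "z \<notin> U \<union> W" "d p z = d p x"
      unfolding Q_def by force
    then have "z \<in> A \<union> B" unfolding AB(3) F by blast
    then show False using z(2) UW(3,4) by blast
  qed
  then obtain e where e0: "0 < e" "\<forall>c\<in>d p ` Q. e \<le> dist (d p x) c"
    using separate_point_closed[OF compact_imp_closed[OF cQ]] by metis
  then have e: "0 < e" "e \<le> \<bar>d p z - d p x\<bar>" if "z \<in> Q" for z
    using that by (auto simp: dist_real_def abs_minus_commute)
  obtain K where K: "connectedin mtopology K" "x \<in> K" "y \<in> K" "\<forall>z\<in>K. z \<in> M \<and> \<bar>d p z - d p x\<bar> < e"
    using conn[OF e0(1)] by blast
  have "K \<subseteq> U \<union> W"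
  proof
    fix z assume "z \<in> K"
    then have "z \<in> M" "\<bar>d p z - d p x\<bar> < e" using K(4) by auto
    then show "z \<in> U \<union> W" using e(2)[of z] by (auto simp: Q_def)
  qed
  then show False
    using connectedinD[OF K(1) UW(1,2)] UW(3-5) K(2,3) AB(5,6) unfolding disjnt_def by blast
qed

text \<open>
  Symmetry is demanded for all arguments; if one of them lies outside the Reeb space, the infimum runs
  over the empty set, and its value \<open>\<infinity>\<close> is converted to 0.
\<close>

lemma Metric_space_reeb:
  assumes compact: "compact_space mtopology"
  shows "Metric_space (reeb_space M d p) (reeb_metric M d p)"
proof
  have sym_le: "reeb_metric M d p C D \<le> reeb_metric M d p D C" if CD: "C \<in> reeb_space M d p" "D \<in> reeb_space M d p" for C D
  proof (rule field_le_epsilon)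
    fix e :: real assume "0 < e"
    define L where "L = reeb_metric M d p D C + e"
    have L: "0 \<le> L" using \<open>0 < e\<close> by (simp add: L_def reeb_metric_def)
    have "reeb_metric M d p D C < L" using \<open>0 < e\<close> by (simp add: L_def)
    then obtain \<beta> where "reeb_connects L \<beta> D C"
      using reeb_metric_lessE[OF CD(2,1)] by blast
    then have "reeb_connects L (\<lambda>t. \<beta> (1 - t)) C D"
      using pathin_reverse[of _ \<beta>] Met_TC.path_length_reverse_le[OF L, of "height \<circ> \<beta>"]
      by (auto simp: reeb_connects_def comp_def)
    then show "reeb_metric M d p C D \<le> reeb_metric M d p D C + e"
      using reeb_metric_le L by (simp add: L_def)
  qed
  show "0 \<le> reeb_metric M d p C D" for C D
    by (simp add: reeb_metric_def)
  show "reeb_metric M d p C D = reeb_metric M d p D C" for C D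
  proof (cases "C \<in> reeb_space M d p \<and> D \<in> reeb_space M d p")
    case False
    then have empty: "{\<beta>. pathin (reeb_topology M d p) \<beta> \<and> \<beta> 0 = C \<and> \<beta> 1 = D} = {}"
        "{\<beta>. pathin (reeb_topology M d p) \<beta> \<and> \<beta> 0 = D \<and> \<beta> 1 = C} = {}"
      using path_start_in_topspace path_finish_in_topspace topspace_reeb by blast+
    show ?thesis
      unfolding reeb_metric_def empty by simp
  qed (use sym_le in \<open>auto intro: order_antisym\<close>)
  show "reeb_metric M d p C D = 0 \<longleftrightarrow> C = D" if CD: "C \<in> reeb_space M d p" "D \<in> reeb_space M d p" for C D
  proof
    obtain x y where xy: "x \<in> M" "y \<in> M" "C = cls x" "D = cls y"
      using CD by (auto simp: reeb_space_def)
    show "reeb_metric M d p C D = 0 \<Longrightarrow> C = D"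
      using cls_eq_if_reeb_metric_zero[OF compact] xy by blast
    assume "C = D"
    then have "reeb_metric M d p C D \<le> 0"
      using reeb_metric_le_dist[of x x] xy by simp
    then show "reeb_metric M d p C D = 0"
      by (simp add: reeb_metric_def order_antisym)
  qed
  fix C D E assume CDE: "C \<in> reeb_space M d p" "D \<in> reeb_space M d p" "E \<in> reeb_space M d p"
  show "reeb_metric M d p C E \<le> reeb_metric M d p C D + reeb_metric M d p D E"
  proof (rule field_le_epsilon)
    fix e :: real assume "0 < e"
    define K where "K = reeb_metric M d p C D + e/2"
    define L where "L = reeb_metric M d p D E + e/2"
    have KL: "0 \<le> K" "0 \<le> L" using \<open>0 < e\<close> by (simp_all add: K_def L_def reeb_metric_def)
    have "reeb_metric M d p C D < K" "reeb_metric M d p D E < L"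
      using \<open>0 < e\<close> by (simp_all add: K_def L_def)
    then obtain \<beta> \<gamma> where \<beta>: "reeb_connects K \<beta> C D" and \<gamma>: "reeb_connects L \<gamma> D E"
      using reeb_metric_lessE[OF CDE(1,2)] reeb_metric_lessE[OF CDE(2,3)] by metis
    have "height \<circ> join_paths \<beta> \<gamma> = join_paths (height \<circ> \<beta>) (height \<circ> \<gamma>)"
      by (auto simp: join_paths_def)
    then have "reeb_connects (K + L) (join_paths \<beta> \<gamma>) C E"
      using \<beta> \<gamma> pathin_join[of _ \<beta> \<gamma>] Met_TC.path_length_join_le[of "height \<circ> \<beta>" "height \<circ> \<gamma>" K L] KL
      by (auto simp: reeb_connects_def simp del: ennreal_plus)
    then have "reeb_metric M d p C E \<le> K + L"
      using reeb_metric_le KL by simp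
    then show "reeb_metric M d p C E \<le> reeb_metric M d p C D + reeb_metric M d p D E + e"
      by (simp add: K_def L_def)
  qed
qed

end

section \<open>Finite one-dimensional complexes\<close>

text \<open>
  Edges are required to be injective inside rather than embeddings there, a condition that passes to
  the parts of an edge at once; compactness makes the two equivalent.
\<close>

definition one_complex :: "'b topology \<Rightarrow> 'b set \<Rightarrow> (real \<Rightarrow> 'b) set \<Rightarrow> bool" where
  "one_complex T V E \<longleftrightarrow>
     Hausdorff_space T \<and> finite V \<and> finite E \<and> V \<subseteq> topspace T \<and>
     (\<forall>e\<in>E. pathin T e \<and> e 0 \<in> V \<and> e 1 \<in> V \<and> inj_on e {0<..<1} \<and> e ` {0<..<1} \<inter> V = {}) \<and>
     (\<forall>e\<in>E. \<forall>e'\<in>E. e \<noteq> e' \<longrightarrow> e ` {0<..<1} \<inter> e' ` {0<..<1} = {}) \<and>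
     topspace T = V \<union> (\<Union>e\<in>E. e ` {0<..<1})"

lemma one_complex_homeomorphic:
  assumes "finite_cw_structure_le_1 T V \<Phi>" "X homeomorphic_space T"
  obtains W E where "one_complex X W E"
proof -
  obtain f g where fg: "homeomorphic_maps X T f g"
    using assms(2) by (auto simp: homeomorphic_space_def)
  have f: "continuous_map X T f" and g: "continuous_map T X g"
    and gf: "\<And>x. x \<in> topspace X \<Longrightarrow> g (f x) = x" and fg': "\<And>y. y \<in> topspace T \<Longrightarrow> f (g y) = y"
    using fg unfolding homeomorphic_maps_def by simp_all
  have inj: "inj_on g (topspace T)"
    by (rule inj_on_inverseI[of _ f]) (rule fg')
  have T: "Hausdorff_space T" "finite V" "finite \<Phi>" "V \<subseteq> topspace T"
    and \<Phi>: "\<And>\<phi>. \<phi> \<in> \<Phi> \<Longrightarrow> pathin T \<phi> \<and> \<phi> 0 \<in> V \<and> \<phi> 1 \<in> V \<and> embedding_map (top_of_set {0<..<1}) T \<phi> \<and> \<phi> ` {0<..<1} \<inter> V = {}"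
    and disj: "\<And>\<phi> \<psi>. \<phi> \<in> \<Phi> \<Longrightarrow> \<psi> \<in> \<Phi> \<Longrightarrow> \<phi> \<noteq> \<psi> \<Longrightarrow> \<phi> ` {0<..<1} \<inter> \<psi> ` {0<..<1} = {}"
    and top: "topspace T = V \<union> (\<Union>\<phi>\<in>\<Phi>. \<phi> ` {0<..<1})"
    using assms(1) unfolding finite_cw_structure_le_1_def pathin_def by simp_all
  have sub: "\<phi> ` {0<..<1} \<subseteq> topspace T" if "\<phi> \<in> \<Phi>" for \<phi>
    using top that by blast
  have img: "(g \<circ> \<phi>) ` {0<..<1} = g ` (\<phi> ` {0<..<1})" for \<phi> :: "real \<Rightarrow> _"
    by (simp add: image_comp)
  have "one_complex X (g ` V) ((\<lambda>\<phi>. g \<circ> \<phi>) ` \<Phi>)"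
    unfolding one_complex_def
  proof (intro conjI ballI impI)
    show "Hausdorff_space X"
      using homeomorphic_Hausdorff_space[OF assms(2)] T(1) by simp
    have gtop: "g ` topspace T = topspace X"
      using f g gf by (force simp: continuous_map_def image_iff Pi_iff)
    show "g ` V \<subseteq> topspace X"
      using gtop T(4) by blast
    show "topspace X = g ` V \<union> (\<Union>e\<in>(\<lambda>\<phi>. g \<circ> \<phi>) ` \<Phi>. e ` {0<..<1})"
      unfolding gtop[symmetric] top by (auto simp: image_Un)
    fix e assume "e \<in> (\<lambda>\<phi>. g \<circ> \<phi>) ` \<Phi>"
    then obtain \<phi> where \<phi>: "\<phi> \<in> \<Phi>" "e = g \<circ> \<phi>" by auto
    show "pathin X e" "e 0 \<in> g ` V" "e 1 \<in> g ` V"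
      using \<Phi>[OF \<phi>(1)] g pathin_compose \<phi>(2) by auto
    have "inj_on \<phi> {0<..<1}"
      using \<Phi>[OF \<phi>(1)] by (auto simp: embedding_map_def dest!: homeomorphic_imp_injective_map)
    then show "inj_on e {0<..<1}"
      unfolding \<phi>(2) using inj_on_subset[OF inj sub[OF \<phi>(1)]] by (rule comp_inj_on)
    show "e ` {0<..<1} \<inter> g ` V = {}"
      unfolding \<phi>(2) img using \<Phi>[OF \<phi>(1)]
      by (metis inj inj_on_image_Int sub[OF \<phi>(1)] T(4) image_empty)
    fix e' assume "e' \<in> (\<lambda>\<phi>. g \<circ> \<phi>) ` \<Phi>" "e \<noteq> e'"
    then obtain \<psi> where \<psi>: "\<psi> \<in> \<Phi>" "e' = g \<circ> \<psi>" "\<phi> \<noteq> \<psi>" using \<phi> by auto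
    show "e ` {0<..<1} \<inter> e' ` {0<..<1} = {}"
      unfolding \<phi>(2) \<psi>(2) img using disj[OF \<phi>(1) \<psi>(1,3)]
      by (metis inj inj_on_image_Int sub[OF \<phi>(1)] sub[OF \<psi>(1)] image_empty)
  qed (use T(2,3) in simp_all)
  then show thesis by (rule that)
qed

locale graph_complex =
  fixes T :: "'b topology" and V E
  assumes complex: "one_complex T V E"
begin

lemma hausdorff: "Hausdorff_space T" and finV: "finite V" and finE: "finite E"
  and V_sub: "V \<subseteq> topspace T" and top: "topspace T = V \<union> (\<Union>e\<in>E. e ` {0<..<1})"
  using complex unfolding one_complex_def by simp_all

lemma edge_path: "e \<in> E \<Longrightarrow> pathin T e" and edge_ends: "e \<in> E \<Longrightarrow> e 0 \<in> V" "e \<in> E \<Longrightarrow> e 1 \<in> V"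
  and edge_inj: "e \<in> E \<Longrightarrow> inj_on e {0<..<1}"
  using complex unfolding one_complex_def by simp_all

lemma edge_notin_V: "e \<in> E \<Longrightarrow> 0 < u \<Longrightarrow> u < 1 \<Longrightarrow> e u \<notin> V"
proof -
  assume e: "e \<in> E" "0 < u" "u < 1"
  then have "e ` {0<..<1} \<inter> V = {}" "e u \<in> e ` {0<..<1}"
    using complex unfolding one_complex_def by simp_all
  then show ?thesis by blast
qed

lemma edges_disjoint:
  assumes "e \<in> E" "e' \<in> E" "0 < u" "u < 1" "0 < u'" "u' < 1" "e u = e' u'"
  shows "e = e' \<and> u = u'"
proof -
  have "e = e'"
  proof (rule ccontr)
    assume "e \<noteq> e'"
    then have "e ` {0<..<1} \<inter> e' ` {0<..<1} = {}"
      using complex assms(1,2) unfolding one_complex_def by simp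
    moreover have "e u \<in> e ` {0<..<1}" using assms(3,4) by simp
    moreover have "e u \<in> e' ` {0<..<1}" unfolding assms(7) using assms(5,6) by simp
    ultimately show False by blast
  qed
  then show ?thesis
    using edge_inj[OF assms(1)] assms by (auto dest: inj_onD)
qed

lemma edge_eq_interior:
  assumes "e \<in> E" "e' \<in> E" "0 < u" "u < 1" "0 \<le> u'" "u' \<le> 1" "e u = e' u'"
  shows "e = e' \<and> u = u'"
proof -
  have "e' u' \<notin> V" using edge_notin_V assms by metis
  then have "u' \<noteq> 0" "u' \<noteq> 1" using edge_ends[OF assms(2)] by auto
  then have "0 < u'" "u' < 1" using assms(5,6) by auto
  then show ?thesis using edges_disjoint[OF assms(1-4) _ _ assms(7)] by simp
qed

lemma edge_in_top: "e \<in> E \<Longrightarrow> 0 \<le> u \<Longrightarrow> u \<le> 1 \<Longrightarrow> e u \<in> topspace T"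
  using path_image_subset_topspace[OF edge_path, of e] by auto

lemma closedin_subedge:
  assumes "e \<in> E" "0 \<le> a" "b \<le> 1"
  shows "closedin T (e ` {a..b})"
proof (rule compactin_imp_closedin[OF hausdorff])
  have "compactin (top_of_set {0..1}) {a..b}"
    using assms by (simp add: compactin_subtopology)
  then show "compactin T (e ` {a..b})"
    using edge_path[OF assms(1)] unfolding pathin_def by (rule image_compactin)
qed

lemma openin_subedge:
  assumes "e \<in> E" "0 \<le> a" "a \<le> b" "b \<le> 1"
  shows "openin T (e ` {a<..<b})"
proof -
  let ?C = "V \<union> (\<Union>e'\<in>E - {e}. e' ` {0..1}) \<union> e ` {0..a} \<union> e ` {b..1}"
  have "closedin T V"
    using V_sub finV hausdorff by (simp add: closedin_Hausdorff_finite)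
  moreover have "closedin T (\<Union>e'\<in>E - {e}. e' ` {0..1})"
    using finE by (intro closedin_Union) (auto intro: closedin_subedge)
  ultimately have "closedin T ?C"
    using assms by (intro closedin_Un closedin_subedge) auto
  moreover have "topspace T - ?C = e ` {a<..<b}"
  proof (intro equalityI subsetI)
    fix x assume x: "x \<in> topspace T - ?C"
    then obtain e' u where u: "e' \<in> E" "x = e' u" "0 < u" "u < 1"
      by (auto simp: top)
    then have "e' = e" using x by force
    then show "x \<in> e ` {a<..<b}"
      using u x by (force simp: not_le)
  next
    fix x assume "x \<in> e ` {a<..<b}"
    then obtain u where u: "x = e u" "a < u" "u < b" by auto
    then have u01: "0 < u" "u < 1" using assms by auto
    have "x \<notin> V" using edge_notin_V[OF assms(1) u01] u by simp
    moreover have "x \<noteq> e' u'" if "e' \<in> E - {e}" "u' \<in> {0..1}" for e' u'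
      using edge_eq_interior[OF assms(1) _ u01] that u by force
    moreover have "x \<noteq> e u'" if "u' \<in> {0..a} \<union> {b..1}" for u'
      using edge_eq_interior[OF assms(1,1) u01, of u'] that u assms by auto
    moreover have "x \<in> topspace T"
      using edge_in_top[OF assms(1)] u01 u by simp
    ultimately show "x \<in> topspace T - ?C" by blast
  qed
  ultimately show ?thesis
    by (metis openin_diff openin_topspace)
qed

text \<open>
  If the set missed a point on either side, the open segment between these points would be
  separated from everything else.
\<close>

lemma connected_escape:
  assumes S: "connectedin T S" and e: "e \<in> E" "0 < t" "t < 1" "e t \<in> S"
    and out: "w \<in> S" "w \<notin> e ` {0<..<1}"
  shows "e ` {0<..<t} \<subseteq> S \<or> e ` {t<..<1} \<subseteq> S"
proof (rule disjCI, rule ccontr)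
  assume no: "\<not> e ` {t<..<1} \<subseteq> S" "\<not> e ` {0<..<t} \<subseteq> S"
  obtain a where a: "0 < a" "a < t" "e a \<notin> S"
    using no(2) unfolding subset_eq ball_simps by force
  obtain b where b: "t < b" "b < 1" "e b \<notin> S"
    using no(1) unfolding subset_eq ball_simps by force
  note ab = a b
  have opens: "openin T (e ` {a<..<b})" "openin T (topspace T - e ` {a..b})"
    using e(1) ab by (auto intro!: openin_subedge openin_diff closedin_subedge)
  have "S \<subseteq> e ` {a<..<b} \<union> (topspace T - e ` {a..b})"
  proof
    fix x assume x: "x \<in> S"
    show "x \<in> e ` {a<..<b} \<union> (topspace T - e ` {a..b})"
    proof (cases "x \<in> e ` {a..b}")
      case True
      then obtain u where "x = e u" "a \<le> u" "u \<le> b" by auto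
      moreover from this have "u \<noteq> a" "u \<noteq> b" using x ab by auto
      ultimately show ?thesis by auto
    qed (use x connectedin_subset_topspace[OF S] in auto)
  qed
  moreover have "e ` {a<..<b} \<inter> (topspace T - e ` {a..b}) \<inter> S = {}"
    by auto
  moreover have "e t \<in> e ` {a<..<b} \<inter> S" using ab e by auto
  moreover have "w \<in> (topspace T - e ` {a..b}) \<inter> S"
    using out connectedin_subset_topspace[OF S] ab by auto
  ultimately show False
    using connectedinD[OF S opens] by blast
qed

end

text \<open>
  Both halves of an edge run towards the point of subdivision, so that an edge which first ascends
  and then descends falls into two ascending ones. A half of length zero is left out.
\<close>

definition lower_half :: "real \<Rightarrow> (real \<Rightarrow> 'b) \<Rightarrow> real \<Rightarrow> 'b" where
  "lower_half c e = (\<lambda>u. e (c * u))"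

definition upper_half :: "real \<Rightarrow> (real \<Rightarrow> 'b) \<Rightarrow> real \<Rightarrow> 'b" where
  "upper_half c e = (\<lambda>u. e (1 - (1 - c) * u))"

definition half_edges :: "((real \<Rightarrow> 'b) \<Rightarrow> real) \<Rightarrow> (real \<Rightarrow> 'b) set \<Rightarrow> (real \<Rightarrow> 'b) set" where
  "half_edges c E = (\<lambda>e. lower_half (c e) e) ` {e \<in> E. 0 < c e} \<union> (\<lambda>e. upper_half (c e) e) ` {e \<in> E. c e < 1}"

lemma card_half_edges: "finite E \<Longrightarrow> card (half_edges c E) \<le> 2 * card E"
proof -
  assume "finite E"
  then have "card (f ` {e \<in> E. P e}) \<le> card E" for f :: "(real \<Rightarrow> 'a) \<Rightarrow> real \<Rightarrow> 'a" and P
    by (intro order_trans[OF card_image_le card_mono]) auto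
  then show ?thesis
    unfolding half_edges_def mult_2 by (intro order_trans[OF card_Un_le add_mono])
qed

lemma lower_half_image: "0 < c \<Longrightarrow> lower_half c e ` {0<..<1} = e ` {0<..<c}"
proof -
  assume "0 < c"
  then have "(\<lambda>u. c * u) ` {0<..<1} = {0<..<c}"
  proof (intro equalityI subsetI)
    fix x assume "x \<in> {0<..<c}"
    then have "x = c * (x / c)" "x / c \<in> {0<..<1}" using \<open>0 < c\<close> by auto
    then show "x \<in> (\<lambda>u. c * u) ` {0<..<1}" by blast
  qed auto
  then have "e ` (\<lambda>u. c * u) ` {0<..<1} = e ` {0<..<c}" by simp
  then show ?thesis by (simp add: lower_half_def image_image)
qed

lemma upper_half_image: "c < 1 \<Longrightarrow> upper_half c e ` {0<..<1} = e ` {c<..<1}"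
proof -
  assume "c < 1"
  then have "(\<lambda>u. 1 - (1 - c) * u) ` {0<..<1} = {c<..<1}"
  proof (intro equalityI subsetI)
    fix x assume "x \<in> {c<..<1}"
    then have "x = 1 - (1 - c) * ((1 - x) / (1 - c))" "(1 - x) / (1 - c) \<in> {0<..<1}"
      by (auto simp: field_simps)
    then show "x \<in> (\<lambda>u. 1 - (1 - c) * u) ` {0<..<1}" by blast
  next
    fix x assume "x \<in> (\<lambda>u. 1 - (1 - c) * u) ` {0<..<1}"
    then obtain u where u: "x = 1 - (1 - c) * u" and "u \<in> {0<..<1}" by blast
    then have "0 < (1 - c) * u" "(1 - c) * u < (1 - c) * 1"
      using \<open>c < 1\<close> by (auto simp del: mult_1_right)
    then show "x \<in> {c<..<1}" using u by auto
  qed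
  then have "e ` (\<lambda>u. 1 - (1 - c) * u) ` {0<..<1} = e ` {c<..<1}" by simp
  then show ?thesis by (simp add: upper_half_def image_image)
qed

lemma (in graph_complex) one_complex_half_edges:
  assumes c: "\<And>e. e \<in> E \<Longrightarrow> 0 \<le> c e \<and> c e \<le> 1"
  shows "one_complex T (V \<union> (\<lambda>e. e (c e)) ` E) (half_edges c E)"
proof -
  let ?V = "V \<union> (\<lambda>e. e (c e)) ` E"
  define piece where "piece = (\<lambda>h. if h then (\<lambda>e. {0<..<c e}) else (\<lambda>e. {c e<..<1 :: real}))"
  have "\<exists>h. e' ` {0<..<1} = e ` piece h e \<and> e' = (if h then lower_half (c e) e else upper_half (c e) e)"
    if "e \<in> E" "(0 < c e \<and> e' = lower_half (c e) e) \<or> (c e < 1 \<and> e' = upper_half (c e) e)" for e e'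
    using that(2)
  proof (elim disjE conjE)
    assume "0 < c e" "e' = lower_half (c e) e"
    then show ?thesis
      using lower_half_image[of "c e" e] by (intro exI[of _ True]) (simp add: piece_def)
  next
    assume "c e < 1" "e' = upper_half (c e) e"
    then show ?thesis
      using upper_half_image[of "c e" e] by (intro exI[of _ False]) (simp add: piece_def)
  qed
  then have pieces: "\<exists>e\<in>E. \<exists>h. e' ` {0<..<1} = e ` piece h e \<and> e' = (if h then lower_half (c e) e else upper_half (c e) e)"
    if "e' \<in> half_edges c E" for e'
    using that unfolding half_edges_def by blast
  have piece_sub: "piece h e \<subseteq> {0<..<1}" if "e \<in> E" for h e
    using c[OF that] by (auto simp: piece_def)
  have edge: "pathin T e' \<and> e' 0 \<in> ?V \<and> e' 1 \<in> ?V \<and> inj_on e' {0<..<1}"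
    if "e' \<in> half_edges c E" for e'
    using that unfolding half_edges_def
  proof (elim UnE imageE CollectE conjE)
    fix e assume e: "e' = lower_half (c e) e" "e \<in> E" "0 < c e"
    have "pathin T e'"
      using pathin_affine[OF edge_path[OF e(2)], of "{0..1}" "c e" 0] c[OF e(2)] e(1)
      by (auto simp: pathin_def lower_half_def mult_le_one)
    moreover have "inj_on e' {0<..<1}"
    proof (rule inj_onI)
      fix u v :: real assume uv: "u \<in> {0<..<1}" "v \<in> {0<..<1}" "e' u = e' v"
      have *: "0 < c e * w" "c e * w < 1" if "w \<in> {0<..<1}" for w
      proof -
        have "c e * w \<le> w" using c[OF e(2)] that by (intro mult_left_le_one_le) auto
        then show "c e * w < 1" by (rule le_less_trans) (use that in simp)
        show "0 < c e * w" using e(3) that by simp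
      qed
      have "c e * u = c e * v"
        using edges_disjoint[OF e(2,2) *[OF uv(1)] *[OF uv(2)]] uv(3) e(1) by (simp add: lower_half_def)
      then show "u = v" using e(3) by simp
    qed
    ultimately show ?thesis
      using edge_ends[OF e(2)] e by (auto simp: lower_half_def)
  next
    fix e assume e: "e' = upper_half (c e) e" "e \<in> E" "c e < 1"
    have bounds: "0 \<le> (1 - c e) * u" "(1 - c e) * u \<le> 1" if "0 \<le> u" "u \<le> 1" for u
      using c[OF e(2)] that by (auto intro!: mult_le_one)
    have "pathin T e'"
      using pathin_affine[OF edge_path[OF e(2)], of "{0..1}" "- (1 - c e)" 1] bounds e(1)
      by (auto simp: pathin_def upper_half_def algebra_simps)
    moreover have "inj_on e' {0<..<1}"
    proof (rule inj_onI)
      fix u v :: real assume uv: "u \<in> {0<..<1}" "v \<in> {0<..<1}" "e' u = e' v"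
      have *: "0 < 1 - (1 - c e) * w" "1 - (1 - c e) * w < 1" if "w \<in> {0<..<1}" for w
      proof -
        have "(1 - c e) * w \<le> w" using c[OF e(2)] that by (intro mult_left_le_one_le) auto
        then have "(1 - c e) * w < 1" by (rule le_less_trans) (use that in simp)
        then show "0 < 1 - (1 - c e) * w" by simp
        show "1 - (1 - c e) * w < 1" using e(3) that by simp
      qed
      have "1 - (1 - c e) * u = 1 - (1 - c e) * v"
        using edges_disjoint[OF e(2,2) *[OF uv(1)] *[OF uv(2)]] uv(3) e(1) by (simp add: upper_half_def)
      then show "u = v" using e(3) by simp
    qed
    ultimately show ?thesis
      using edge_ends[OF e(2)] e by (auto simp: upper_half_def)
  qed
  show ?thesis
    unfolding one_complex_def
  proof (intro conjI ballI impI)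
    show "finite (half_edges c E)"
      using finE by (simp add: half_edges_def)
    show "?V \<subseteq> topspace T"
      using V_sub edge_in_top c by auto
    have E_image: "e ` {0<..<1} \<subseteq> {e (c e)} \<union> (\<Union>e'\<in>half_edges c E. e' ` {0<..<1})" if "e \<in> E" for e
    proof
      fix x assume "x \<in> e ` {0<..<1}"
      then obtain u where u: "x = e u" "0 < u" "u < 1" by auto
      consider "u < c e" | "u = c e" | "c e < u" by linarith
      then show "x \<in> {e (c e)} \<union> (\<Union>e'\<in>half_edges c E. e' ` {0<..<1})"
      proof cases
        case 1
        then have "x \<in> lower_half (c e) e ` {0<..<1}"
          using u lower_half_image[of "c e" e] by auto
        then show ?thesis using that 1 u unfolding half_edges_def by auto
      next
        case 3
        then have "x \<in> upper_half (c e) e ` {0<..<1}"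
          using u upper_half_image[of "c e" e] by auto
        then show ?thesis using that 3 u unfolding half_edges_def by auto
      qed (use u in auto)
    qed
    show "topspace T = ?V \<union> (\<Union>e\<in>half_edges c E. e ` {0<..<1})"
    proof
      show "topspace T \<subseteq> ?V \<union> (\<Union>e\<in>half_edges c E. e ` {0<..<1})"
        unfolding top using E_image by blast
      have "e' ` {0<..<1} \<subseteq> topspace T" if e': "e' \<in> half_edges c E" for e'
        using path_image_subset_topspace[of T e'] edge[OF e'] by auto
      then show "?V \<union> (\<Union>e\<in>half_edges c E. e ` {0<..<1}) \<subseteq> topspace T"
        using V_sub edge_in_top c by auto
    qed
    fix e' assume e': "e' \<in> half_edges c E"
    show "pathin T e'" "e' 0 \<in> ?V" "e' 1 \<in> ?V" "inj_on e' {0<..<1}"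
      using edge[OF e'] by auto
    obtain e h where e: "e \<in> E" "e' ` {0<..<1} = e ` piece h e" "e' = (if h then lower_half (c e) e else upper_half (c e) e)"
      using pieces[OF e'] by blast
    have "e u \<notin> ?V" if "u \<in> piece h e" for u
    proof -
      have u: "0 < u" "u < 1" using piece_sub[OF e(1)] that by force+
      have "e u \<noteq> e2 (c e2)" if "e2 \<in> E" for e2
        using edge_eq_interior[OF e(1) that u, of "c e2"] c[OF that] \<open>u \<in> piece h e\<close>
        by (auto simp: piece_def split: if_splits)
      then show ?thesis using edge_notin_V[OF e(1) u] by auto
    qed
    then show "e' ` {0<..<1} \<inter> ?V = {}"
      unfolding e(2) by blast
    fix e2' assume e2': "e2' \<in> half_edges c E" "e' \<noteq> e2'"
    obtain e2 h2 where e2: "e2 \<in> E" "e2' ` {0<..<1} = e2 ` piece h2 e2" "e2' = (if h2 then lower_half (c e2) e2 else upper_half (c e2) e2)"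
      using pieces[OF e2'(1)] by blast
    show "e' ` {0<..<1} \<inter> e2' ` {0<..<1} = {}"
    proof (rule ccontr)
      assume "e' ` {0<..<1} \<inter> e2' ` {0<..<1} \<noteq> {}"
      then obtain u v where uv: "u \<in> piece h e" "v \<in> piece h2 e2" "e u = e2 v"
        unfolding e(2) e2(2) by auto
      moreover have "0 < u" "u < 1" "0 < v" "v < 1"
        using piece_sub[OF e(1)] piece_sub[OF e2(1)] uv by force+
      ultimately have "e = e2" "u = v"
        using edges_disjoint[OF e(1) e2(1)] by blast+
      moreover from this have "h = h2"
        using uv by (auto simp: piece_def split: if_splits)
      ultimately show False using e(3) e2(3) e2'(2) by metis
    qed
  qed (use hausdorff finV finE in auto)
qed

section \<open>The distance to a vertex along the edges\<close>

lemma (in Metric_space) continuous_on_dist_paths: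
  fixes S :: "'t::metric_space set"
  assumes "continuous_map (top_of_set S) mtopology f" "continuous_map (top_of_set S) mtopology g"
  shows "continuous_on S (\<lambda>t. d (f t) (g t))"
  unfolding continuous_on_iff
proof (intro ballI allI impI)
  fix s :: 't and e :: real assume s: "s \<in> S" and e: "0 < e"
  have mem: "f t \<in> M" "g t \<in> M" if "t \<in> S" for t
    using assms that by (auto simp: continuous_map_def Pi_iff)
  have near: "\<exists>r>0. \<forall>t\<in>S. dist t s < r \<longrightarrow> d (h s) (h t) < e/2"
    if h: "continuous_map (top_of_set S) mtopology h" and hs: "h s \<in> M" for h
  proof -
    have "continuous_on S (\<lambda>t. d (h s) (h t))"
      using continuous_map_compose[OF h continuous_dist[OF hs]] by (simp add: comp_def)
    then obtain r where "r > 0" "\<forall>t\<in>S. dist t s < r \<longrightarrow> dist (d (h s) (h t)) (d (h s) (h s)) < e/2"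
      using s e unfolding continuous_on_iff by (meson half_gt_zero)
    then show ?thesis using hs by (auto simp: dist_real_def)
  qed
  obtain r1 where r1: "r1 > 0" "\<forall>t\<in>S. dist t s < r1 \<longrightarrow> d (f s) (f t) < e/2"
    using near[OF assms(1) mem(1)[OF s]] by blast
  obtain r2 where r2: "r2 > 0" "\<forall>t\<in>S. dist t s < r2 \<longrightarrow> d (g s) (g t) < e/2"
    using near[OF assms(2) mem(2)[OF s]] by blast
  have "dist (d (f t) (g t)) (d (f s) (g s)) < e" if t: "t \<in> S" "dist t s < min r1 r2" for t
  proof -
    have "d (f t) (g t) \<le> d (f s) (f t) + d (f s) (g s) + d (g s) (g t)"
      using triangle[of "f t" "f s" "g t"] triangle[of "f s" "g s" "g t"] mem[OF s] mem[OF t(1)] commute[of "f s" "f t"] by simp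
    moreover have "d (f s) (g s) \<le> d (f s) (f t) + d (f t) (g t) + d (g s) (g t)"
      using triangle[of "f s" "f t" "g s"] triangle[of "f t" "g t" "g s"] mem[OF s] mem[OF t(1)] commute[of "g s" "g t"] by simp
    moreover have "d (f s) (f t) < e/2" "d (g s) (g t) < e/2"
      using r1 r2 t by auto
    ultimately show ?thesis by (simp add: dist_real_def abs_less_iff)
  qed
  then show "\<exists>r>0. \<forall>t\<in>S. dist t s < r \<longrightarrow> dist (d (f t) (g t)) (d (f s) (g s)) < e"
    using r1(1) r2(1) by (intro exI[of _ "min r1 r2"]) auto
qed

text \<open>Equality in the triangle inequality makes distances along the geodesic differences of heights.\<close>

lemma (in Metric_space) geodesic_to_base:
  assumes "geodesic_space M d" "q \<in> M" "x \<in> M"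
  obtains \<sigma> where "pathin mtopology \<sigma>" "\<sigma> 0 = x" "\<sigma> 1 = q"
    "\<And>s t. 0 \<le> s \<Longrightarrow> s \<le> t \<Longrightarrow> t \<le> 1 \<Longrightarrow> d (\<sigma> s) (\<sigma> t) = d q (\<sigma> s) - d q (\<sigma> t)"
proof -
  obtain \<sigma> where \<sigma>: "pathin mtopology \<sigma>" "\<sigma> 0 = x" "\<sigma> 1 = q"
    "\<And>s t. 0 \<le> s \<Longrightarrow> s \<le> t \<Longrightarrow> t \<le> 1 \<Longrightarrow> d x (\<sigma> s) + d (\<sigma> s) (\<sigma> t) + d (\<sigma> t) q \<le> d x q"
    using geodesicE[OF assms(1,3,2)] by metis
  have mem: "\<sigma> t \<in> M" if "0 \<le> t" "t \<le> 1" for t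
    using path_image_subset_topspace[OF \<sigma>(1)] that by auto
  have "d (\<sigma> s) (\<sigma> t) = d q (\<sigma> s) - d q (\<sigma> t)" if "0 \<le> s" "s \<le> t" "t \<le> 1" for s t
  proof -
    have m: "\<sigma> s \<in> M" "\<sigma> t \<in> M" using mem that by auto
    show ?thesis
      using \<sigma>(4)[OF that] triangle[OF assms(3) m(1) assms(2)] triangle[OF m(1,2) assms(2)]
      by (simp add: commute[of q])
  qed
  with that \<sigma> show thesis by blast
qed

locale pointed_graph = Metric_space M d + graph_complex mtopology V E
  for M :: "'b set" and d V E +
  fixes q :: 'b
  assumes geodesic: "geodesic_space M d" and base: "q \<in> V"
begin

lemma base_in: "q \<in> M"
  using base V_sub by auto

lemma edge_in: "e \<in> E \<Longrightarrow> 0 \<le> u \<Longrightarrow> u \<le> 1 \<Longrightarrow> e u \<in> M"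
  using edge_in_top by simp

lemma continuous_on_edge:
  assumes "e \<in> E" "\<And>s. s \<in> S \<Longrightarrow> a * s + b \<in> {0..1}"
  shows "continuous_map (top_of_set S) mtopology (\<lambda>s. e (a * s + b))"
  using pathin_affine[OF edge_path[OF assms(1)]] assms(2) by blast

lemma continuous_height_edge: "e \<in> E \<Longrightarrow> continuous_on {0..1} (\<lambda>u. d q (e u))"
  using pathin_compose[OF edge_path continuous_dist[OF base_in]] by (simp add: path_def comp_def)

definition ascends :: "(real \<Rightarrow> 'b) \<Rightarrow> real \<Rightarrow> real \<Rightarrow> bool" where
  "ascends e a b \<longleftrightarrow> (\<forall>u v. a \<le> u \<longrightarrow> u \<le> v \<longrightarrow> v \<le> b \<longrightarrow> d (e u) (e v) = d q (e v) - d q (e u))"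

definition descends :: "(real \<Rightarrow> 'b) \<Rightarrow> real \<Rightarrow> real \<Rightarrow> bool" where
  "descends e a b \<longleftrightarrow> (\<forall>u v. a \<le> u \<longrightarrow> u \<le> v \<longrightarrow> v \<le> b \<longrightarrow> d (e u) (e v) = d q (e u) - d q (e v))"

text \<open>
  The geodesic from an interior point of an edge to the base vertex leaves the edge, so it
  sweeps one of the two sides, and distances along a geodesic to the base are differences of heights.
\<close>

lemma ascends_or_descends:
  assumes e: "e \<in> E" and t: "0 < t" "t < 1"
  shows "(\<forall>a>0. ascends e a t) \<or> (\<forall>b<1. descends e t b)"
proof -
  have et: "e t \<in> M" using edge_in e t by simp
  obtain \<sigma> where \<sigma>: "pathin mtopology \<sigma>" "\<sigma> 0 = e t" "\<sigma> 1 = q"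
    "\<And>r s. 0 \<le> r \<Longrightarrow> r \<le> s \<Longrightarrow> s \<le> 1 \<Longrightarrow> d (\<sigma> r) (\<sigma> s) = d q (\<sigma> r) - d q (\<sigma> s)"
    using geodesic_to_base[OF geodesic base_in et] by metis
  define S where "S = \<sigma> ` {0..1}"
  have S: "connectedin mtopology S" "e t \<in> S" "q \<in> S"
    using connectedin_path_image[OF \<sigma>(1)] \<sigma>(2,3) unfolding S_def by (simp_all add: image_iff) (force+)
  have diff: "d x y = \<bar>d q x - d q y\<bar>" if xy: "x \<in> S" "y \<in> S" for x y
  proof -
    obtain r s where rs: "x = \<sigma> r" "0 \<le> r" "r \<le> 1" "y = \<sigma> s" "0 \<le> s" "s \<le> 1"
      using xy by (auto simp: S_def)
    show ?thesis
    proof (cases "r \<le> s")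
      case True
      then show ?thesis using \<sigma>(4)[of r s] rs nonneg[of x y] by auto
    next
      case False
      then show ?thesis using \<sigma>(4)[of s r] rs nonneg[of y x] commute[of x y] by auto
    qed
  qed
  have top_height: "d q x \<le> d q (e t)" if xS: "x \<in> S" for x
  proof -
    obtain s where "x = \<sigma> s" "0 \<le> s" "s \<le> 1" using xS by (auto simp: S_def)
    then show ?thesis using \<sigma>(4)[of 0 s] \<sigma>(2) nonneg[of "e t" x] by auto
  qed
  have inj: "inj_on (\<lambda>u. d q (e u)) I" if "I \<subseteq> {0<..<1}" "\<And>u. u \<in> I \<Longrightarrow> e u \<in> S" for I
  proof (rule inj_onI)
    fix u v assume uv: "u \<in> I" "v \<in> I" "d q (e u) = d q (e v)"
    then have "d (e u) (e v) = 0" using diff that by simp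
    moreover have u01: "0 < u" "u < 1" "0 < v" "v < 1" using that(1) uv by auto
    ultimately have "e u = e v" using edge_in[OF e] by simp
    then show "u = v" using edges_disjoint[OF e e u01] by simp
  qed
  have cont: "continuous_on I (\<lambda>u. d q (e u))" if "I \<subseteq> {0..1}" for I
    using continuous_height_edge[OF e] that continuous_on_subset by blast
  have "q \<notin> e ` {0<..<1}"
    using edge_notin_V[OF e] base by auto
  then consider "e ` {0<..<t} \<subseteq> S" | "e ` {t<..<1} \<subseteq> S"
    using connected_escape[OF S(1) e t S(2,3)] by blast
  then show ?thesis
  proof cases
    case 1
    have "ascends e a t" if "0 < a" for a
      unfolding ascends_def
    proof (intro allI impI)
      fix u v assume uv: "a \<le> u" "u \<le> v" "v \<le> t"
      have mem: "e w \<in> S" if "u \<le> w" "w \<le> t" for w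
      proof (cases "w = t")
        case False
        then show ?thesis using 1 that uv \<open>0 < a\<close> by force
      qed (use S in simp)
      have "d q (e u) \<le> d q (e v)"
      proof (cases "u < v \<and> v < t")
        case True
        have "continuous_on {u..t} (\<lambda>w. d q (e w))"
          by (rule cont) (use uv t \<open>0 < a\<close> in auto)
        moreover have "inj_on (\<lambda>w. d q (e w)) {u..t}"
          by (rule inj) (use uv t \<open>0 < a\<close> mem in auto)
        ultimately have "(d q (e u) < d q (e v) \<and> d q (e v) < d q (e t)) \<or> (d q (e t) < d q (e v) \<and> d q (e v) < d q (e u))"
          using continuous_inj_imp_mono[of u v t "\<lambda>w. d q (e w)"] True by blast
        then show ?thesis using top_height[of "e v"] mem uv by auto
      next
        case False
        then have "u = v \<or> v = t" using uv by auto
        then show ?thesis using top_height[of "e u"] mem uv by auto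
      qed
      then show "d (e u) (e v) = d q (e v) - d q (e u)"
        using diff[of "e u" "e v"] mem uv by auto
    qed
    then show ?thesis by blast
  next
    case 2
    have "descends e t b" if "b < 1" for b
      unfolding descends_def
    proof (intro allI impI)
      fix u v assume uv: "t \<le> u" "u \<le> v" "v \<le> b"
      have mem: "e w \<in> S" if "t \<le> w" "w \<le> v" for w
      proof (cases "w = t")
        case False
        then show ?thesis using 2 that uv \<open>b < 1\<close> by force
      qed (use S in simp)
      have "d q (e v) \<le> d q (e u)"
      proof (cases "t < u \<and> u < v")
        case True
        have "continuous_on {t..v} (\<lambda>w. d q (e w))"
          by (rule cont) (use uv t \<open>b < 1\<close> in auto)
        moreover have "inj_on (\<lambda>w. d q (e w)) {t..v}"
          by (rule inj) (use uv t \<open>b < 1\<close> mem in auto)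
        ultimately have "(d q (e t) < d q (e u) \<and> d q (e u) < d q (e v)) \<or> (d q (e v) < d q (e u) \<and> d q (e u) < d q (e t))"
          using continuous_inj_imp_mono[of t u v "\<lambda>w. d q (e w)"] True by blast
        then show ?thesis using top_height[of "e u"] mem uv by auto
      next
        case False
        then have "u = v \<or> u = t" using uv by auto
        then show ?thesis using top_height[of "e v"] mem uv by auto
      qed
      then show "d (e u) (e v) = d q (e u) - d q (e v)"
        using diff[of "e u" "e v"] mem uv by auto
    qed
    then show ?thesis by blast
  qed
qed

text \<open>Additivity of heights is a closed condition, so it passes to the ends of an edge.\<close>

lemma closed_extension:
  assumes e: "e \<in> E" and ab: "0 \<le> a" "a < b" "b \<le> 1"
    and inner: "\<And>u v. a < u \<Longrightarrow> u \<le> v \<Longrightarrow> v < b \<Longrightarrow> d (e u) (e v) = k * (d q (e v) - d q (e u))"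
    and uv: "a \<le> u" "u \<le> v" "v \<le> b"
  shows "d (e u) (e v) = k * (d q (e v) - d q (e u))"
proof -
  define m where "m = (a + b) / 2"
  define p where "p = (\<lambda>w s. (m - w) * s + w)"
  have m: "a < m" "m < b" using ab by (auto simp: m_def)
  have p_bounds: "a \<le> p w s" "p w s \<le> b" "0 < s \<Longrightarrow> a < p w s" "0 < s \<Longrightarrow> p w s < b"
    if "a \<le> w" "w \<le> b" "s \<in> {0..1}" for w s
  proof -
    have eq: "p w s = (1 - s) * w + s * m" by (simp add: p_def algebra_simps)
    have "(1 - s) * a + s * a \<le> p w s" "p w s \<le> (1 - s) * b + s * b"
      unfolding eq using that m by (auto intro!: add_mono mult_left_mono)
    then show "a \<le> p w s" "p w s \<le> b" by (simp_all add: algebra_simps)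
    assume "0 < s"
    then have "(1 - s) * a + s * a < p w s" "p w s < (1 - s) * b + s * b"
      unfolding eq using that m by (auto intro!: add_le_less_mono mult_left_mono mult_strict_left_mono)
    then show "a < p w s" "p w s < b" by (simp_all add: algebra_simps)
  qed
  have p_mono: "p u s \<le> p v s" if "s \<in> {0..1}" for s
  proof -
    have "(1 - s) * u \<le> (1 - s) * v" using that uv by (intro mult_left_mono) auto
    then show ?thesis by (simp add: p_def algebra_simps)
  qed
  have path: "continuous_map (top_of_set {0..1}) mtopology (\<lambda>s. e (p w s))" if "a \<le> w" "w \<le> b" for w
    unfolding p_def
  proof (rule continuous_on_edge[OF e])
    fix s :: real assume "s \<in> {0..1}"
    then show "(m - w) * s + w \<in> {0..1}"
      using p_bounds(1,2)[OF that, of s] ab(1,3) by (simp add: p_def)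
  qed
  have height: "continuous_on {0..1} (\<lambda>s. d q (e (p w s)))" if "a \<le> w" "w \<le> b" for w
    using continuous_on_dist_paths[of "{0..1}" "\<lambda>_. q"] path[OF that] base_in by simp
  define F where "F = (\<lambda>s. d (e (p u s)) (e (p v s)) - k * (d q (e (p v s)) - d q (e (p u s))))"
  have bnds: "a \<le> u" "u \<le> b" "a \<le> v" "v \<le> b" using uv by auto
  have "continuous_on (closure {0<..1::real}) F"
    unfolding F_def closure_greaterThanAtMost[OF zero_less_one]
    by (intro continuous_intros height continuous_on_dist_paths path bnds)
  moreover have "F s = 0" if "s \<in> {0<..1}" for s :: real
    using inner[of "p u s" "p v s"] p_bounds[OF bnds(1,2), of s] p_bounds[OF bnds(3,4), of s] p_mono[of s] that
    by (auto simp: F_def)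
  ultimately have "F 0 = 0"
    using continuous_constant_on_closure[of "{0<..1}" F 0 0] closure_greaterThanAtMost[of 0 "1::real"] by auto
  then show ?thesis by (simp add: F_def p_def)
qed

text \<open>
  The points from which one can descend towards the lower parameters form an initial segment of the
  edge, and its supremum is the highest point. It may be an end of the edge.
\<close>

lemma edge_top:
  assumes e: "e \<in> E"
  obtains c where "0 \<le> c" "c \<le> 1" "ascends e 0 c" "descends e c 1"
proof -
  define A where "A = {t. 0 < t \<and> t < 1 \<and> (\<forall>a>0. ascends e a t)}"
  define c where "c = Sup (insert 0 A)"
  have bdd: "bdd_above (insert 0 A)"
    by (rule bdd_aboveI[of _ 1]) (auto simp: A_def)
  have c: "0 \<le> c" "c \<le> 1"
    unfolding c_def using bdd by (auto intro!: cSup_upper cSup_least simp: A_def)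
  have zero: "d (e u) (e u) = 0" if "0 \<le> u" "u \<le> 1" for u
    using edge_in[OF e] that by simp
  have "ascends e 0 c"
  proof (cases "c = 0")
    case True
    have "d (e u) (e v) = d q (e v) - d q (e u)" if "0 \<le> u" "u \<le> v" "v \<le> c" for u v
    proof -
      have "v = u" using that True by simp
      then show ?thesis using zero[of u] that c by simp
    qed
    then show ?thesis by (simp add: ascends_def)
  next
    case False
    have inner: "d (e u) (e v) = 1 * (d q (e v) - d q (e u))" if uv: "0 < u" "u \<le> v" "v < c" for u v
    proof -
      obtain t where "t \<in> insert 0 A" "v < t"
        using uv(3) unfolding c_def by (meson less_cSupE insert_not_empty)
      then have "ascends e u t" "v < t" using uv by (auto simp: A_def)
      then show ?thesis using uv by (auto simp: ascends_def)
    qed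
    show ?thesis
      unfolding ascends_def
      using closed_extension[OF e order_refl _ c(2) inner] c False by auto
  qed
  moreover have "descends e c 1"
  proof (cases "c = 1")
    case True
    have "d (e u) (e v) = d q (e u) - d q (e v)" if "c \<le> u" "u \<le> v" "v \<le> 1" for u v
    proof -
      have "v = u" using that True by simp
      then show ?thesis using zero[of u] that c by simp
    qed
    then show ?thesis by (simp add: descends_def)
  next
    case False
    have inner: "d (e u) (e v) = (-1) * (d q (e v) - d q (e u))" if uv: "c < u" "u \<le> v" "v < 1" for u v
    proof -
      have "u \<notin> A"
        using cSup_upper[OF _ bdd, of u] uv by (auto simp: c_def)
      then have "descends e u v"
        using ascends_or_descends[OF e, of u] uv c by (auto simp: A_def)
      then show ?thesis using uv by (auto simp: descends_def)
    qed
    show ?thesis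
      unfolding descends_def
      using closed_extension[OF e c(1) _ order_refl inner] c False by auto
  qed
  ultimately show thesis using c that by blast
qed

end

locale ascending_graph = pointed_graph +
  assumes ascending: "e \<in> E \<Longrightarrow> ascends e 0 1"
begin

lemma edge_dist: "e \<in> E \<Longrightarrow> 0 \<le> u \<Longrightarrow> u \<le> v \<Longrightarrow> v \<le> 1 \<Longrightarrow> d (e u) (e v) = d q (e v) - d q (e u)"
  using ascending unfolding ascends_def by blast

lemma edge_mono: "e \<in> E \<Longrightarrow> 0 \<le> u \<Longrightarrow> u \<le> v \<Longrightarrow> v \<le> 1 \<Longrightarrow> d q (e u) \<le> d q (e v)"
  using edge_dist[of e u v] nonneg[of "e u" "e v"] by linarith

lemma edge_strict_mono:
  assumes "e \<in> E" "0 \<le> u" "u < v" "v \<le> 1"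
  shows "d q (e u) < d q (e v)"
proof -
  define a where "a = (2 * u + v) / 3"
  define b where "b = (u + 2 * v) / 3"
  have ab: "u < a" "a < b" "b < v" using assms by (auto simp: a_def b_def)
  have "e a \<noteq> e b"
    using edges_disjoint[OF assms(1,1), of a b] ab assms by auto
  then have "0 < d (e a) (e b)"
    using edge_in[OF assms(1)] ab assms by simp
  then show ?thesis
    using edge_dist[OF assms(1), of a b] edge_mono[OF assms(1), of u a] edge_mono[OF assms(1), of b v] ab assms by auto
qed

text \<open>
  A geodesic from a vertex to the base starts along an edge; as heights decrease along it, the
  vertex is the upper end of that edge.
\<close>

lemma parent_edge_exists:
  assumes v: "v \<in> V" "v \<noteq> q"
  shows "\<exists>e\<in>E. e 1 = v"
proof -
  have vM: "v \<in> M" using v V_sub by auto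
  have fin: "finite (d v ` (V - {v}))" using finV by simp
  define \<rho> where "\<rho> = Min (d v ` (V - {v}))"
  have ne: "d v ` (V - {v}) \<noteq> {}" using v base by auto
  have \<rho>: "0 < \<rho>" "\<And>w. w \<in> V \<Longrightarrow> w \<noteq> v \<Longrightarrow> \<rho> \<le> d v w"
    unfolding \<rho>_def using fin ne vM V_sub by (auto simp: Min_gr_iff)
  obtain \<sigma> where \<sigma>: "pathin mtopology \<sigma>" "\<sigma> 0 = v" "\<sigma> 1 = q"
    "\<And>r s. 0 \<le> r \<Longrightarrow> r \<le> s \<Longrightarrow> s \<le> 1 \<Longrightarrow> d (\<sigma> r) (\<sigma> s) = d q (\<sigma> r) - d q (\<sigma> s)"
    using geodesic_to_base[OF geodesic base_in vM] by metis
  have "continuous_on {0..1} (\<lambda>s. d v (\<sigma> s))"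
    using pathin_compose[OF \<sigma>(1) continuous_dist[OF vM]] by (simp add: path_def comp_def)
  moreover have "\<rho> \<le> d v q" using \<rho>(2)[OF base] v by simp
  ultimately obtain s where s: "0 \<le> s" "s \<le> 1" "d v (\<sigma> s) = \<rho> / 2"
    using IVT'[of "\<lambda>s. d v (\<sigma> s)" 0 "\<rho>/2" 1] \<sigma>(2,3) \<rho>(1) vM by auto
  have "\<sigma> s \<in> M"
    using path_image_subset_topspace[OF \<sigma>(1)] s by auto
  moreover have "\<sigma> s \<notin> V"
    using \<rho> s vM by force
  ultimately obtain e t where e: "e \<in> E" "\<sigma> s = e t" "0 < t" "t < 1"
    using top by auto
  define S where "S = \<sigma> ` {0..s}"
  have S: "connectedin mtopology S"
    unfolding S_def
  proof (rule connectedin_continuous_map_image)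
    show "continuous_map (top_of_set {0..1}) mtopology \<sigma>"
      using \<sigma>(1) by (simp add: pathin_def)
    show "connectedin (top_of_set {0..1}) {0..s}"
      using s by (auto simp: connectedin_subtopology)
  qed
  have close: "d v x \<le> \<rho> / 2" if xS: "x \<in> S" for x
  proof -
    obtain r where r: "x = \<sigma> r" "0 \<le> r" "r \<le> s" using xS by (auto simp: S_def)
    show ?thesis
      using \<sigma>(4)[of 0 r] \<sigma>(4)[of 0 s] \<sigma>(4)[of r s] r s \<sigma>(2) nonneg[of "\<sigma> r" "\<sigma> s"] by auto
  qed
  have limit: "e w = v" if w: "w = 0 \<or> w = 1" "\<And>u. u \<in> I \<Longrightarrow> e u \<in> S" and I: "w \<in> closure I" "closure I \<subseteq> {0..1}" for w I
  proof (rule ccontr)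
    assume "e w \<noteq> v"
    then have "\<rho> \<le> d v (e w)" using w(1) edge_ends[OF e(1)] \<rho>(2) by auto
    moreover have "d v (e w) \<le> \<rho> / 2"
    proof (rule continuous_le_on_closure[of I "\<lambda>u. d v (e u)"])
      show "continuous_on (closure I) (\<lambda>u. d v (e u))"
        using pathin_compose[OF edge_path[OF e(1)] continuous_dist[OF vM]] I(2)
        by (auto simp: path_def comp_def intro: continuous_on_subset)
    qed (use w I close in auto)
    ultimately show False using \<rho>(1) by simp
  qed
  have "v \<in> S" "e t \<in> S"
    using \<sigma>(2) s e(2) unfolding S_def by (force, force)
  moreover have "v \<notin> e ` {0<..<1}"
    using edge_notin_V[OF e(1)] v by auto
  ultimately consider "e ` {0<..<t} \<subseteq> S" | "e ` {t<..<1} \<subseteq> S"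
    using connected_escape[OF S e(1,3,4)] by blast
  then show ?thesis
  proof cases
    case 1
    have "e 0 = v"
      by (rule limit[of 0 "{0<..<t}"]) (use 1 e in \<open>auto simp: closure_greaterThanLessThan\<close>)
    then have "d q v \<le> d q (e t)"
      using edge_mono[OF e(1), of 0 t] e by simp
    then show ?thesis
      using \<sigma>(4)[of 0 s] s \<sigma>(2) e(2) \<rho>(1) by simp
  next
    case 2
    have "e 1 = v"
      by (rule limit[of 1 "{t<..<1}"]) (use 2 e in \<open>auto simp: closure_greaterThanLessThan\<close>)
    then show ?thesis using e by blast
  qed
qed

end

text \<open>
  Subdividing first at the base point and then at the highest point of every edge turns any
  finite complex into one whose edges all ascend; each subdivision at most doubles their number.
\<close>

lemma ascending_graph_exists:
  assumes "finite_metric_graph M d"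
  shows "\<exists>K. \<forall>q\<in>M. \<exists>V E. ascending_graph M d V E q \<and> card E \<le> K"
proof -
  have geo: "geodesic_space M d"
    using assms by (simp add: finite_metric_graph_def)
  then interpret Metric_space M d
    by (simp add: geodesic_space_def)
  obtain V E where VE: "one_complex mtopology V E"
    using assms one_complex_homeomorphic unfolding finite_metric_graph_def by meson
  interpret G: graph_complex mtopology V E
    using VE by unfold_locales
  have "\<exists>V' E'. ascending_graph M d V' E' q \<and> card E' \<le> 4 * card E" if q: "q \<in> M" for q
  proof -
    \<comment> \<open>edges that do not contain \<open>q\<close> are left whole: subdividing at 1 leaves out the upper half\<close>
    define c where "c = (\<lambda>e. if \<exists>t\<in>{0<..<1}. e t = q then SOME t. t \<in> {0<..<1} \<and> e t = q else 1 :: real)"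
    have c: "c e \<in> {0<..<1} \<and> e (c e) = q" if "t \<in> {0<..<1}" "e t = q" for e t
      using someI[of "\<lambda>t. t \<in> {0<..<1} \<and> e t = q" t] that unfolding c_def by auto
    have c01: "0 \<le> c e \<and> c e \<le> 1" for e
    proof (cases "\<exists>t\<in>{0<..<1}. e t = q")
      case True
      then show ?thesis using c[of _ e] by force
    qed (auto simp: c_def)
    define V1 where "V1 = V \<union> (\<lambda>e. e (c e)) ` E"
    define E1 where "E1 = half_edges c E"
    have "one_complex mtopology V1 E1"
      unfolding V1_def E1_def by (rule G.one_complex_half_edges) (rule c01)
    moreover have "q \<in> V1"
    proof -
      have "q \<in> V \<union> (\<Union>e\<in>E. e ` {0<..<1})"
        using G.top q by simp
      then consider "q \<in> V" | e t where "e \<in> E" "t \<in> {0<..<1}" "e t = q" by blast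
      then show ?thesis
      proof cases
        case 2
        then have "e (c e) = q" using c by blast
        then show ?thesis using \<open>e \<in> E\<close> by (auto simp: V1_def)
      qed (simp add: V1_def)
    qed
    ultimately interpret G1: pointed_graph M d V1 E1 q
      using geo by unfold_locales
    have "\<exists>t. 0 \<le> t \<and> t \<le> 1 \<and> G1.ascends e 0 t \<and> G1.descends e t 1" if "e \<in> E1" for e
      by (rule G1.edge_top[OF that]) blast
    then obtain b where b: "\<And>e. e \<in> E1 \<Longrightarrow> 0 \<le> b e \<and> b e \<le> 1 \<and> G1.ascends e 0 (b e) \<and> G1.descends e (b e) 1"
      by metis
    define V2 where "V2 = V1 \<union> (\<lambda>e. e (b e)) ` E1"
    define E2 where "E2 = half_edges b E1"
    have "one_complex mtopology V2 E2"
      unfolding V2_def E2_def using b by (intro G1.one_complex_half_edges) blast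
    moreover have "q \<in> V2"
      unfolding V2_def using G1.base by simp
    ultimately interpret G2: pointed_graph M d V2 E2 q
      using geo by unfold_locales
    have "G2.ascends e' 0 1" if "e' \<in> E2" for e'
      using that unfolding E2_def half_edges_def
    proof (elim UnE imageE CollectE conjE)
      fix e assume e: "e' = lower_half (b e) e" "e \<in> E1" "0 < b e"
      show ?thesis
        unfolding G2.ascends_def
      proof (intro allI impI)
        fix u v :: real assume uv: "0 \<le> u" "u \<le> v" "v \<le> 1"
        have "b e * u \<le> b e * v" "b e * v \<le> b e" "0 \<le> b e * u"
          using e(3) uv by (auto simp: mult_left_le)
        then show "d (e' u) (e' v) = d q (e' v) - d q (e' u)"
          using b[OF e(2)] unfolding G1.ascends_def e(1) lower_half_def by blast
      qed
    next
      fix e assume e: "e' = upper_half (b e) e" "e \<in> E1" "b e < 1"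
      show ?thesis
        unfolding G2.ascends_def
      proof (intro allI impI)
        fix u v :: real assume uv: "0 \<le> u" "u \<le> v" "v \<le> 1"
        have "(1 - b e) * u \<le> (1 - b e) * v" "(1 - b e) * v \<le> 1 - b e" "0 \<le> (1 - b e) * u"
          using e(3) uv by (auto simp: mult_left_le)
        then have "b e \<le> 1 - (1 - b e) * v" "1 - (1 - b e) * v \<le> 1 - (1 - b e) * u" "1 - (1 - b e) * u \<le> 1"
          by auto
        then have "d (e' v) (e' u) = d q (e' v) - d q (e' u)"
          using b[OF e(2)] unfolding G1.descends_def e(1) upper_half_def by blast
        then show "d (e' u) (e' v) = d q (e' v) - d q (e' u)"
          by (simp add: commute)
      qed
    qed
    then have "ascending_graph M d V2 E2 q"
      by unfold_locales
    moreover have "card E2 \<le> 2 * card E1" "card E1 \<le> 2 * card E"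
      using card_half_edges[OF G1.finE, of b] card_half_edges[OF G.finE, of c]
      by (simp_all add: E1_def E2_def)
    ultimately show ?thesis by (intro exI[of _ V2] exI[of _ E2] conjI) auto
  qed
  then show ?thesis by blast
qed

section \<open>Cutting a graph into a tree\<close>

lemma locally_constant_on_connected:
  assumes S: "connectedin X S"
    and loc: "\<And>y. y \<in> S \<Longrightarrow> \<exists>N. openin X N \<and> y \<in> N \<and> (\<forall>w\<in>N \<inter> S. a w = a y)"
    and xy: "x \<in> S" "y \<in> S"
  shows "a x = a y"
proof (rule ccontr)
  assume ne: "a x \<noteq> a y"
  obtain N where N: "openin X (N w)" "w \<in> N w" "\<forall>z\<in>N w \<inter> S. a z = a w" if "w \<in> S" for w
    using loc by metis
  let ?A = "\<Union>w\<in>{w\<in>S. a w = a x}. N w" and ?B = "\<Union>w\<in>{w\<in>S. a w \<noteq> a x}. N w"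
  have opens: "openin X ?A" "openin X ?B"
    using N(1) by (auto intro!: openin_Union)
  have cover: "S \<subseteq> ?A \<union> ?B"
    using N(2) by auto
  have disj: "?A \<inter> ?B \<inter> S = {}"
  proof -
    have False if "z \<in> S" "w \<in> S" "w' \<in> S" "a w = a x" "a w' \<noteq> a x" "z \<in> N w" "z \<in> N w'" for z w w'
    proof -
      have "a z = a w" "a z = a w'" using N(3)[OF that(2)] N(3)[OF that(3)] that(1,6,7) by blast+
      then show False using that(4,5) by simp
    qed
    then show ?thesis by blast
  qed
  have "x \<in> ?A \<inter> S" "y \<in> ?B \<inter> S"
    using N(2) xy ne by auto
  then show False
    using connectedinD[OF S opens cover disj] by blast
qed

context ascending_graph
begin

text \<open>
  One edge is chosen among those that arrive at a vertex from below. At the base there is none, and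
  the value is arbitrary. The edges chosen form a spanning tree.
\<close>

definition parent :: "'a \<Rightarrow> real \<Rightarrow> 'a" where
  "parent v = (SOME e. e \<in> E \<and> e 1 = v)"

definition chords :: "(real \<Rightarrow> 'a) set" where
  "chords = {e \<in> E. e \<noteq> parent (e 1)}"

lemma parent: "v \<in> V \<Longrightarrow> v \<noteq> q \<Longrightarrow> parent v \<in> E \<and> parent v 1 = v"
  using someI_ex[of "\<lambda>e. e \<in> E \<and> e 1 = v"] parent_edge_exists unfolding parent_def by blast

lemma edge_top_ne_base:
  assumes "e \<in> E"
  shows "e 1 \<noteq> q"
proof
  assume "e 1 = q"
  then have "d q (e 0) < 0"
    using edge_strict_mono[OF assms, of 0 1] base_in by simp
  then show False by (meson nonneg not_le)
qed

definition point_at :: "(real \<Rightarrow> 'a) \<Rightarrow> real \<Rightarrow> 'a" where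
  "point_at e m = e (SOME u. 0 \<le> u \<and> u \<le> 1 \<and> d q (e u) = m)"

lemma point_at:
  assumes e: "e \<in> E" and m: "d q (e 0) \<le> m" "m \<le> d q (e u)" and u: "0 \<le> u" "u \<le> 1"
  shows "point_at e m \<in> M" "d (e u) (point_at e m) = d q (e u) - m"
proof -
  have "continuous_on {0..u} (\<lambda>w. d q (e w))"
    by (rule continuous_on_subset[OF continuous_height_edge[OF e]]) (use u in auto)
  then obtain w where w: "0 \<le> w" "w \<le> u" "d q (e w) = m"
    using IVT'[of "\<lambda>w. d q (e w)" 0 m u] m u by auto
  then have ex: "\<exists>w. 0 \<le> w \<and> w \<le> 1 \<and> d q (e w) = m"
    using u by (intro exI[of _ w]) auto
  define v where "v = (SOME w. 0 \<le> w \<and> w \<le> 1 \<and> d q (e w) = m)"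
  have v: "0 \<le> v \<and> v \<le> 1 \<and> d q (e v) = m"
    unfolding v_def by (rule someI_ex[OF ex])
  show "point_at e m \<in> M"
    using edge_in[OF e] v by (simp add: point_at_def v_def)
  have "v \<le> u"
  proof (rule ccontr)
    assume "\<not> v \<le> u"
    then have "d q (e u) < d q (e v)"
      using edge_strict_mono[OF e, of u v] u v by auto
    then show False using m v by simp
  qed
  then have "d (e v) (e u) = d q (e u) - m"
    using edge_dist[OF e, of v u] u v by simp
  then show "d (e u) (point_at e m) = d q (e u) - m"
    by (simp add: point_at_def v_def commute[of "e u"])
qed

text \<open>
  The point of height \<open>m\<close> that is reached from a vertex along parent edges. The recursion
  terminates because heights decrease and there are finitely many vertices.
\<close>

lemma ancestor_exists:
  "\<exists>A. A q = q \<and> (\<forall>v\<in>V - {q}. A v =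
     (if d q (parent v 0) \<le> m then point_at (parent v) m else A (parent v 0)))"
proof -
  define R where "R = {(w, v). w \<in> V \<and> v \<in> V \<and> d q w < d q v}"
  have "R \<subseteq> Wellfounded.measure (\<lambda>v. card {w \<in> V. d q w < d q v})"
  proof (rule subrelI)
    fix w v assume wv: "(w, v) \<in> R"
    then have "{x \<in> V. d q x < d q w} \<subset> {x \<in> V. d q x < d q v}"
      by (auto simp: R_def)
    then show "(w, v) \<in> Wellfounded.measure (\<lambda>v. card {w \<in> V. d q w < d q v})"
      using finV by (auto intro: psubset_card_mono)
  qed
  then have wf: "wf R"
    using wf_measure wf_subset by blast
  define F where "F = (\<lambda>A v. if v = q then q else if d q (parent v 0) \<le> m then point_at (parent v) m else A (parent v 0))"
  define A where "A = wfrec R F"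
  have A: "A v = F (cut A R v) v" for v
    unfolding A_def using wf by (rule wfrec)
  have "(parent v 0, v) \<in> R" if "v \<in> V - {q}" for v
    using parent[of v] that edge_ends[of "parent v"] edge_strict_mono[of "parent v" 0 1] by (auto simp: R_def)
  then have "A v = (if d q (parent v 0) \<le> m then point_at (parent v) m else A (parent v 0))" if "v \<in> V - {q}" for v
    using A[of v] that by (simp add: F_def cut_apply)
  moreover have "A q = q" using A[of q] by (simp add: F_def)
  ultimately show ?thesis by blast
qed

text \<open>
  Away from the cuts, the ancestor at height \<open>m\<close> is a locally constant function of the point, so two
  points of a connected set of heights at least \<open>m\<close> have the same one and are joined through it. The
  error stems from the points of a chord above its cut, which have to ascend to the upper end first.
\<close>

lemma connected_uncut_bound:
  assumes S: "connectedin mtopology S" and m: "0 \<le> m" "\<And>x. x \<in> S \<Longrightarrow> m \<le> d q x"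
    and \<kappa>: "\<And>e. e \<in> E \<Longrightarrow> 0 < \<kappa> e \<and> \<kappa> e < 1 \<and> d q (e 1) - d q (e (\<kappa> e)) \<le> \<eta>"
    and uncut: "S \<inter> (\<lambda>e. e (\<kappa> e)) ` chords = {}"
    and xy: "x \<in> S" "y \<in> S" and \<eta>: "0 \<le> \<eta>"
  shows "d x y \<le> d q x + d q y - 2 * m + 4 * \<eta>"
proof -
  obtain A where A: "A q = q" "\<And>v. v \<in> V \<Longrightarrow> v \<noteq> q \<Longrightarrow> A v =
     (if d q (parent v 0) \<le> m then point_at (parent v) m else A (parent v 0))"
    using ancestor_exists[of m] by blast
  define down where "down = (\<lambda>e :: real \<Rightarrow> 'a. if d q (e 0) \<le> m then point_at e m else A (e 0))"
  have Adown: "A v = down (parent v)" if "v \<in> V" "v \<noteq> q" for v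
    using A(2)[OF that] by (simp add: down_def)
  have down_step: "down e \<in> M \<and> d (e u) (down e) \<le> d q (e u) - m"
    if e: "e \<in> E" and u: "0 \<le> u" "u \<le> 1" "m \<le> d q (e u)"
      and IH: "m \<le> d q (e 0) \<Longrightarrow> A (e 0) \<in> M \<and> d (e 0) (A (e 0)) \<le> d q (e 0) - m" for e u
  proof (cases "d q (e 0) \<le> m")
    case True
    then show ?thesis using point_at[OF e True u(3,1,2)] by (simp add: down_def)
  next
    case False
    then have A0: "A (e 0) \<in> M" "d (e 0) (A (e 0)) \<le> d q (e 0) - m" using IH by auto
    have "d (e u) (A (e 0)) \<le> d (e 0) (e u) + d (e 0) (A (e 0))"
      using triangle''[OF edge_in[OF e u(1,2)] edge_in[OF e, of 0] A0(1)] by simp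
    then show ?thesis
      using False A0 edge_dist[OF e, of 0 u] u by (simp add: down_def)
  qed
  have A_dist: "A v \<in> M \<and> d v (A v) \<le> d q v - m" if "v \<in> V" "m \<le> d q v" for v
    using that
  proof (induction "card {w \<in> V. d q w < d q v}" arbitrary: v rule: less_induct)
    case less
    show ?case
    proof (cases "v = q")
      case True
      then show ?thesis using A(1) less.prems(2) base_in m(1) by simp
    next
      case False
      note p = parent[OF less.prems(1) False]
      have lt: "d q (parent v 0) < d q v"
        using edge_strict_mono[of "parent v" 0 1] p by simp
      then have "{w \<in> V. d q w < d q (parent v 0)} \<subset> {w \<in> V. d q w < d q v}"
        using edge_ends[of "parent v"] p by auto
      then have "card {w \<in> V. d q w < d q (parent v 0)} < card {w \<in> V. d q w < d q v}"
        using finV by (auto intro: psubset_card_mono)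
      then have "m \<le> d q (parent v 0) \<Longrightarrow> A (parent v 0) \<in> M \<and> d (parent v 0) (A (parent v 0)) \<le> d q (parent v 0) - m"
        using less.hyps edge_ends[of "parent v"] p by blast
      then have "down (parent v) \<in> M \<and> d (parent v 1) (down (parent v)) \<le> d q (parent v 1) - m"
        using down_step[of "parent v" 1] p less.prems(2) by simp
      then show ?thesis using Adown[OF less.prems(1) False] p by simp
    qed
  qed
  have down_dist: "down e \<in> M \<and> d (e u) (down e) \<le> d q (e u) - m"
    if "e \<in> E" "0 \<le> u" "u \<le> 1" "m \<le> d q (e u)" for e u
    using down_step[OF that] A_dist edge_ends(1)[OF that(1)] by blast
  define a where "a = (\<lambda>x. if x \<in> V then A x else
    (THE z. \<exists>e\<in>E. \<exists>u. 0 < u \<and> u < 1 \<and> x = e u \<and> z = (if e \<in> chords \<and> \<kappa> e < u then A (e 1) else down e)))"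
  have aV: "a v = A v" if "v \<in> V" for v
    using that by (simp add: a_def)
  have aE: "a (e u) = (if e \<in> chords \<and> \<kappa> e < u then A (e 1) else down e)" if eu: "e \<in> E" "0 < u" "u < 1" for e u
  proof -
    have "(THE z. \<exists>e'\<in>E. \<exists>u'. 0 < u' \<and> u' < 1 \<and> e u = e' u' \<and> z = (if e' \<in> chords \<and> \<kappa> e' < u' then A (e' 1) else down e'))
        = (if e \<in> chords \<and> \<kappa> e < u then A (e 1) else down e)"
    proof (rule the_equality)
      show "\<exists>e'\<in>E. \<exists>u'. 0 < u' \<and> u' < 1 \<and> e u = e' u' \<and>
          (if e \<in> chords \<and> \<kappa> e < u then A (e 1) else down e) = (if e' \<in> chords \<and> \<kappa> e' < u' then A (e' 1) else down e')"
        using eu by blast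
    next
      fix z assume "\<exists>e'\<in>E. \<exists>u'. 0 < u' \<and> u' < 1 \<and> e u = e' u' \<and> z = (if e' \<in> chords \<and> \<kappa> e' < u' then A (e' 1) else down e')"
      then obtain e' u' where *: "e' \<in> E" "0 < u'" "u' < 1" "e u = e' u'"
          "z = (if e' \<in> chords \<and> \<kappa> e' < u' then A (e' 1) else down e')" by blast
      then have "e = e' \<and> u = u'"
        using edges_disjoint[OF eu(1) *(1) eu(2,3) *(2,3)] by blast
      then show "z = (if e \<in> chords \<and> \<kappa> e < u then A (e 1) else down e)"
        using *(5) by blast
    qed
    then show ?thesis
      using edge_notin_V[OF eu] by (simp add: a_def)
  qed
  have a_dist: "a x \<in> M \<and> d x (a x) \<le> d q x - m + 2 * \<eta>" if xS: "x \<in> S" for x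
  proof (cases "x \<in> V")
    case True
    then show ?thesis using aV A_dist[OF True] m(2)[OF xS] \<eta> by auto
  next
    case False
    have "x \<in> topspace mtopology" using connectedin_subset_topspace[OF S] xS by blast
    then obtain e u where eu: "e \<in> E" "x = e u" "0 < u" "u < 1"
      using False top by auto
    show ?thesis
    proof (cases "e \<in> chords \<and> \<kappa> e < u")
      case True
      have h: "d q (e (\<kappa> e)) \<le> d q (e u)" "d q (e u) \<le> d q (e 1)"
        using edge_mono[OF eu(1)] True \<kappa>[OF eu(1)] eu by auto
      have A1: "A (e 1) \<in> M" "d (e 1) (A (e 1)) \<le> d q (e 1) - m"
        using A_dist[OF edge_ends(2)[OF eu(1)]] h(2) m(2)[OF xS] eu by auto
      have "d (e u) (A (e 1)) \<le> d (e u) (e 1) + d (e 1) (A (e 1))"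
        using triangle[OF edge_in[OF eu(1), of u] edge_in[OF eu(1), of 1] A1(1)] eu by simp
      moreover have "d (e u) (e 1) = d q (e 1) - d q (e u)"
        using edge_dist[OF eu(1), of u 1] eu by simp
      moreover have "d q (e 1) - d q (e u) \<le> \<eta>"
        using h \<kappa>[OF eu(1)] by auto
      ultimately show ?thesis
        using aE[OF eu(1,3,4)] True A1 eu(2) by simp
    next
      case False
      then show ?thesis
        using aE[OF eu(1,3,4)] down_dist[OF eu(1), of u] eu m(2)[OF xS] \<eta> by auto
    qed
  qed
  \<comment> \<open>the neighbourhood of a vertex consists of the parts up to the cut parameter of the edges issuing
    from it, and of the remaining parts of the edges that end in it\<close>
  have "\<exists>N. openin mtopology N \<and> y \<in> N \<and> (\<forall>w\<in>N \<inter> S. a w = a y)" if yS: "y \<in> S" for y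
  proof (cases "y \<in> V")
    case True
    let ?F = "(V - {y}) \<union> (\<Union>e\<in>{e\<in>E. e 0 \<noteq> y}. e ` {0..\<kappa> e}) \<union> (\<Union>e\<in>{e\<in>E. e 1 \<noteq> y}. e ` {\<kappa> e..1})"
    define N where "N = M - ?F"
    have "closedin mtopology (V - {y})"
      using finV V_sub by (intro closedin_Hausdorff_finite[OF hausdorff]) auto
    moreover have "closedin mtopology (\<Union>e\<in>{e\<in>E. e 0 \<noteq> y}. e ` {0..\<kappa> e})"
      using finE \<kappa> by (intro closedin_Union) (auto intro!: closedin_subedge less_imp_le)
    moreover have "closedin mtopology (\<Union>e\<in>{e\<in>E. e 1 \<noteq> y}. e ` {\<kappa> e..1})"
      using finE \<kappa> by (intro closedin_Union) (auto intro!: closedin_subedge less_imp_le)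
    ultimately have "closedin mtopology ?F"
      by (intro closedin_Un)
    then have openN: "openin mtopology N"
      unfolding N_def by (intro openin_diff) auto
    have notE: "y \<noteq> e u" if "e \<in> E" "0 < u" "u < 1" for e u
      using edge_notin_V[OF that] True by auto
    have "y \<notin> e ` {0..\<kappa> e}" if e: "e \<in> E" "e 0 \<noteq> y" for e
    proof
      assume "y \<in> e ` {0..\<kappa> e}"
      then obtain u where u: "y = e u" "0 \<le> u" "u \<le> \<kappa> e" by auto
      then have "0 < u" "u < 1" using e \<kappa>[OF e(1)] by (auto simp: less_le)
      then show False using notE e u by blast
    qed
    moreover have "y \<notin> e ` {\<kappa> e..1}" if e: "e \<in> E" "e 1 \<noteq> y" for e
    proof
      assume "y \<in> e ` {\<kappa> e..1}"
      then obtain u where u: "y = e u" "\<kappa> e \<le> u" "u \<le> 1" by auto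
      then have "0 < u" "u < 1" using e \<kappa>[OF e(1)] by (auto simp: less_le)
      then show False using notE e u by blast
    qed
    moreover have "y \<in> M" using True V_sub by auto
    ultimately have "y \<in> N" by (auto simp: N_def)
    moreover have "a w = a y" if w: "w \<in> N" "w \<in> S" for w
    proof (cases "w \<in> V")
      case True
      then show ?thesis using w by (auto simp: N_def)
    next
      case False
      have "w \<in> topspace mtopology" using w by (auto simp: N_def)
      then obtain e u where eu: "e \<in> E" "w = e u" "0 < u" "u < 1"
        using False top by auto
      have cut: "u \<noteq> \<kappa> e" if "e \<in> chords"
        using that uncut w(2) eu(2) by blast
      have my: "m \<le> d q y" using m(2) yS by blast
      show ?thesis
      proof (cases "u \<le> \<kappa> e")
        case True
        then have "w \<in> e ` {0..\<kappa> e}" using eu by auto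
        then have e0: "e 0 = y" using w(1) eu(1) by (auto simp: N_def)
        have "a w = down e"
          using aE[OF eu(1,3,4)] True eu(2) by auto
        also have "\<dots> = A y"
        proof (cases "d q y \<le> m")
          case True
          then have "d q y = m" using my by simp
          then have "d y (A y) \<le> 0" "A y \<in> M" "d y (down e) \<le> 0" "down e \<in> M"
            using A_dist[OF \<open>y \<in> V\<close>] down_dist[OF eu(1), of 0] e0 by auto
          then have "A y = y" "down e = y"
            using \<open>y \<in> M\<close> nonneg by (metis antisym zero)+
          then show ?thesis by simp
        qed (simp add: down_def e0)
        finally show ?thesis using aV[OF \<open>y \<in> V\<close>] by simp
      next
        case False
        then have "w \<in> e ` {\<kappa> e..1}" using eu by auto
        then have e1: "e 1 = y" using w(1) eu(1) by (auto simp: N_def)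
        have "y \<noteq> q" using edge_top_ne_base[OF eu(1)] e1 by simp
        show ?thesis
        proof (cases "e \<in> chords")
          case True
          then show ?thesis using aE[OF eu(1,3,4)] False e1 eu(2) aV[OF \<open>y \<in> V\<close>] by auto
        next
          case no_chord: False
          then have "e = parent y" using eu(1) e1 by (simp add: chords_def)
          then have "A y = down e" using Adown[OF \<open>y \<in> V\<close> \<open>y \<noteq> q\<close>] by simp
          then show ?thesis using aE[OF eu(1,3,4)] no_chord eu(2) aV[OF \<open>y \<in> V\<close>] by auto
        qed
      qed
    qed
    ultimately show ?thesis using openN by blast
  next
    case False
    have "y \<in> topspace mtopology" using connectedin_subset_topspace[OF S] yS by blast
    then obtain e u where eu: "e \<in> E" "y = e u" "0 < u" "u < 1"
      using False top by auto
    have cut: "u \<noteq> \<kappa> e" if "e \<in> chords"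
      using that uncut yS eu(2) by blast
    define I where "I = (if e \<notin> chords then {0<..<1} else if u < \<kappa> e then {0<..<\<kappa> e} else {\<kappa> e<..<1})"
    have "openin mtopology (e ` I)"
      unfolding I_def using \<kappa>[OF eu(1)] by (auto intro!: openin_subedge[OF eu(1)])
    moreover have "y \<in> e ` I"
      unfolding eu(2) using eu cut by (intro imageI) (auto simp: I_def)
    moreover have "a w = a y" if "w \<in> e ` I" for w
    proof -
      obtain v where v: "w = e v" "v \<in> I" using \<open>w \<in> e ` I\<close> by auto
      then have "0 < v" "v < 1" using \<kappa>[OF eu(1)] by (auto simp: I_def split: if_splits)
      then have "a w = (if e \<in> chords \<and> \<kappa> e < v then A (e 1) else down e)"
        using aE[OF eu(1)] v by simp
      moreover have "(e \<in> chords \<and> \<kappa> e < v) = (e \<in> chords \<and> \<kappa> e < u)"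
        using v cut by (auto simp: I_def split: if_splits)
      ultimately show ?thesis
        using aE[OF eu(1,3,4)] eu(2) by simp
    qed
    ultimately show ?thesis by blast
  qed
  then have "a x = a y"
    using locally_constant_on_connected[OF S _ xy] by blast
  moreover have "x \<in> M" "y \<in> M"
    using connectedin_subset_topspace[OF S] xy by auto
  ultimately show ?thesis
    using a_dist[OF xy(1)] a_dist[OF xy(2)] triangle'[of x "a x" y] by auto
qed

end

text \<open>
  In a tree, with the distance to a root for \<open>g\<close>, the bound holds for every path with no error: take
  for \<open>s\<close> a time at which the path is lowest.
\<close>

definition (in Metric_space) tree_like_off :: "('a \<Rightarrow> real) \<Rightarrow> 'a set \<Rightarrow> real \<Rightarrow> bool" where
  "tree_like_off g C \<epsilon> \<longleftrightarrow> (\<forall>\<gamma>. pathin mtopology \<gamma> \<longrightarrow> \<gamma> ` {0<..<1} \<inter> C = {} \<longrightarrow>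
     (\<exists>s\<in>{0..1}. d (\<gamma> 0) (\<gamma> 1) \<le> g (\<gamma> 0) + g (\<gamma> 1) - 2 * g (\<gamma> s) + \<epsilon>))"

text \<open>
  The previous bound applies to the open path, whose ends may be cut points; it extends to the ends
  by continuity.
\<close>

lemma (in ascending_graph) tree_like_off_chord_points:
  assumes \<epsilon>: "0 < \<epsilon>"
  shows "\<exists>C\<subseteq>M. finite C \<and> card C \<le> card chords \<and> tree_like_off (d q) C \<epsilon>"
proof -
  have "\<exists>t. 0 < t \<and> t < 1 \<and> d q (e 1) - d q (e t) \<le> \<epsilon> / 4" if "e \<in> E" for e
  proof -
    have "\<exists>r>0. \<forall>t\<in>{0..1}. dist t 1 < r \<longrightarrow> dist (d q (e t)) (d q (e 1)) < \<epsilon> / 4"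
      using continuous_height_edge[OF that, unfolded continuous_on_iff, rule_format, of 1 "\<epsilon> / 4"] \<epsilon>
      by simp
    then obtain r where r: "r > 0" "\<forall>t\<in>{0..1}. dist t 1 < r \<longrightarrow> dist (d q (e t)) (d q (e 1)) < \<epsilon> / 4"
      by blast
    define t where "t = max (1/2) (1 - r/2)"
    have "0 < t" "t < 1" "dist t 1 < r" using r(1) by (auto simp: t_def dist_real_def)
    moreover from this have "\<bar>d q (e t) - d q (e 1)\<bar> < \<epsilon> / 4"
      using r(2) by (auto simp: dist_real_def)
    then have "d q (e 1) - d q (e t) \<le> \<epsilon> / 4" by linarith
    ultimately show ?thesis by blast
  qed
  then obtain \<kappa> where \<kappa>: "\<And>e. e \<in> E \<Longrightarrow> 0 < \<kappa> e \<and> \<kappa> e < 1 \<and> d q (e 1) - d q (e (\<kappa> e)) \<le> \<epsilon> / 4"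
    by metis
  define C where "C = (\<lambda>e. e (\<kappa> e)) ` chords"
  have fin: "finite chords" using finE by (simp add: chords_def)
  have "tree_like_off (d q) C \<epsilon>"
    unfolding tree_like_off_def
  proof (intro allI impI)
    fix \<gamma> assume \<gamma>: "pathin mtopology \<gamma>" "\<gamma> ` {0<..<1} \<inter> C = {}"
    have cont: "continuous_map (top_of_set {0..1}) mtopology \<gamma>"
      using \<gamma>(1) by (simp add: pathin_def)
    have height: "continuous_on {0..1} (\<lambda>s. d q (\<gamma> s))"
      using pathin_compose[OF \<gamma>(1) continuous_dist[OF base_in]] by (simp add: path_def comp_def)
    then obtain s where s: "s \<in> {0..1}" "\<And>t. t \<in> {0..1} \<Longrightarrow> d q (\<gamma> s) \<le> d q (\<gamma> t)"
      using continuous_attains_inf[of "{0..1}" "\<lambda>s. d q (\<gamma> s)"] by auto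
    have S: "connectedin mtopology (\<gamma> ` {0<..<1})"
      by (rule connectedin_continuous_map_image[OF cont]) (auto simp: connectedin_subtopology)
    define m where "m = d q (\<gamma> s)"
    \<comment> \<open>the slack in the bound for the middle part of the path from \<open>(1 - r)/2\<close> to \<open>(1 + r)/2\<close>\<close>
    define F where "F = (\<lambda>r. d q (\<gamma> (- 1/2 * r + 1/2)) + d q (\<gamma> (1/2 * r + 1/2)) - 2 * m + \<epsilon> - d (\<gamma> (- 1/2 * r + 1/2)) (\<gamma> (1/2 * r + 1/2)))"
    have half: "continuous_map (top_of_set {0..1}) mtopology (\<lambda>r. \<gamma> (- 1/2 * r + 1/2))"
        "continuous_map (top_of_set {0..1}) mtopology (\<lambda>r. \<gamma> (1/2 * r + 1/2))"
      by (rule pathin_affine[OF \<gamma>(1)]; auto)+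
    have "continuous_on (closure {0..<1::real}) F"
      unfolding F_def closure_atLeastLessThan[OF zero_less_one]
      using half continuous_on_dist_paths[OF continuous_map_const[THEN iffD2] half(1), of q]
        continuous_on_dist_paths[OF continuous_map_const[THEN iffD2] half(2), of q] base_in
      by (intro continuous_intros continuous_on_dist_paths) auto
    moreover have "0 \<le> F r" if r: "r \<in> {0..<1}" for r :: real
    proof -
      have "d (\<gamma> (- 1/2 * r + 1/2)) (\<gamma> (1/2 * r + 1/2)) \<le>
          d q (\<gamma> (- 1/2 * r + 1/2)) + d q (\<gamma> (1/2 * r + 1/2)) - 2 * m + 4 * (\<epsilon> / 4)"
      proof (rule connected_uncut_bound[OF S _ _ \<kappa>])
        show "\<gamma> ` {0<..<1} \<inter> (\<lambda>e. e (\<kappa> e)) ` chords = {}" using \<gamma>(2) by (simp add: C_def)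
        show "m \<le> d q x" if "x \<in> \<gamma> ` {0<..<1}" for x
          using that s(2) by (auto simp: m_def)
      qed (use r \<epsilon> in \<open>auto simp: m_def intro!: imageI\<close>)
      then show ?thesis by (simp add: F_def)
    qed
    ultimately have "0 \<le> F 1"
      using continuous_ge_on_closure[of "{0..<1}" F 1 0] closure_atLeastLessThan[of 0 "1::real"] by auto
    then show "\<exists>s\<in>{0..1}. d (\<gamma> 0) (\<gamma> 1) \<le> d q (\<gamma> 0) + d q (\<gamma> 1) - 2 * d q (\<gamma> s) + \<epsilon>"
      using s(1) by (intro bexI[of _ s]) (auto simp: F_def m_def)
  qed
  moreover have "C \<subseteq> M"
    using edge_in \<kappa> by (force simp: C_def chords_def)
  ultimately show ?thesis
    using fin card_image_le[OF fin] by (intro exI[of _ C]) (auto simp: C_def)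
qed

text \<open>
  Loop erasure: when the path first meets a cut point it may be resumed at its last visit to that
  point, after which one cut point fewer has to be considered. Every uncut piece contributes, besides
  \<open>\<epsilon>\<close>, an error of \<open>r\<close> at each end and of \<open>2 r\<close> at its lowest point.
\<close>

lemma (in Metric_space) tree_like_bound:
  fixes r \<epsilon> :: real
  assumes tree: "tree_like_off g C \<epsilon>" and C: "C \<subseteq> M" and \<epsilon>: "0 \<le> \<epsilon>"
    and \<gamma>: "pathin mtopology \<gamma>"
    and \<theta>: "\<And>s t. 0 \<le> s \<Longrightarrow> s \<le> t \<Longrightarrow> t \<le> 1 \<Longrightarrow> \<theta> s \<le> \<theta> t"
    and close: "\<And>s. s \<in> {0..1} \<Longrightarrow> \<bar>g (\<gamma> s) - h (\<theta> s)\<bar> \<le> r"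
    and D: "finite D" "D \<subseteq> C" and ab: "0 \<le> a" "a \<le> b" "b \<le> 1"
    and avoid: "\<gamma> ` {a<..<b} \<inter> C \<subseteq> D"
  shows "\<exists>ts. sorted ts \<and> set ts \<subseteq> {\<theta> a..\<theta> b} \<and>
    d (\<gamma> a) (\<gamma> b) \<le> chain_length dist (map h ts) + real (card D + 1) * (4 * r + \<epsilon>)"
  using D ab avoid
proof (induction "card D" arbitrary: D a rule: less_induct)
  case less
  note ab = less.prems(3-5)
  have r: "0 \<le> r" using close[of 0] by (auto intro: order_trans[OF abs_ge_zero])
  have mem: "\<gamma> s \<in> M" if "s \<in> {0..1}" for s
    using path_image_subset_topspace[OF \<gamma>] that by auto
  have piece: "\<exists>ts. sorted ts \<and> set ts \<subseteq> {\<theta> a..\<theta> c} \<and> d (\<gamma> a) (\<gamma> c) \<le> chain_length dist (map h ts) + (4 * r + \<epsilon>)"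
    if c: "a \<le> c" "c \<le> b" "\<gamma> ` {a<..<c} \<inter> C = {}" for c
  proof -
    define \<delta> where "\<delta> = (\<lambda>t. \<gamma> ((c - a) * t + a))"
    have p: "a \<le> (c - a) * t + a" "(c - a) * t + a \<le> c" if "t \<in> {0..1}" for t
    proof -
      have "(c - a) * t \<le> (c - a) * 1" using that c by (intro mult_left_mono) auto
      then show "(c - a) * t + a \<le> c" by simp
    qed (use that c in auto)
    show ?thesis
    proof (cases "a = c")
      case True
      then show ?thesis using mem[of a] ab r \<epsilon> by (intro exI[of _ "[]"]) auto
    next
      case False
      have path: "pathin mtopology \<delta>"
        unfolding pathin_def \<delta>_def using p c ab by (intro pathin_affine[OF \<gamma>]) force
      have "\<delta> ` {0<..<1} \<subseteq> \<gamma> ` {a<..<c}"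
      proof -
        have "(c - a) * t + a \<in> {a<..<c}" if "t \<in> {0<..<1}" for t
        proof -
          have "(c - a) * t < (c - a) * 1" using that c False by (intro mult_strict_left_mono) auto
          then have "(c - a) * t + a < c" by (simp only: mult_1_right)
          moreover have "0 < (c - a) * t" using that c False by (intro mult_pos_pos) auto
          ultimately show ?thesis by simp
        qed
        then show ?thesis by (auto simp: \<delta>_def)
      qed
      then have "\<delta> ` {0<..<1} \<inter> C = {}" using c(3) by blast
      then obtain t where t: "t \<in> {0..1}" "d (\<delta> 0) (\<delta> 1) \<le> g (\<delta> 0) + g (\<delta> 1) - 2 * g (\<delta> t) + \<epsilon>"
        using tree[unfolded tree_like_off_def, rule_format, OF path] by blast
      define s where "s = (c - a) * t + a"
      have s: "a \<le> s" "s \<le> c" using p[OF t(1)] by (auto simp: s_def)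
      have "d (\<gamma> a) (\<gamma> c) \<le> g (\<gamma> a) + g (\<gamma> c) - 2 * g (\<gamma> s) + \<epsilon>"
        using t(2) by (simp add: \<delta>_def s_def)
      moreover have "\<bar>g (\<gamma> a) - h (\<theta> a)\<bar> \<le> r" "\<bar>g (\<gamma> s) - h (\<theta> s)\<bar> \<le> r" "\<bar>g (\<gamma> c) - h (\<theta> c)\<bar> \<le> r"
        using close[of a] close[of s] close[of c] s ab c by simp_all
      ultimately have "d (\<gamma> a) (\<gamma> c) \<le> \<bar>h (\<theta> a) - h (\<theta> s)\<bar> + \<bar>h (\<theta> s) - h (\<theta> c)\<bar> + (4 * r + \<epsilon>)"
        by linarith
      then have "d (\<gamma> a) (\<gamma> c) \<le> chain_length dist (map h [\<theta> a, \<theta> s, \<theta> c]) + (4 * r + \<epsilon>)"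
        by (simp add: dist_real_def)
      moreover have "\<theta> a \<le> \<theta> s" "\<theta> s \<le> \<theta> c"
        using \<theta> s ab c by auto
      ultimately show ?thesis by (intro exI[of _ "[\<theta> a, \<theta> s, \<theta> c]"]) auto
    qed
  qed
  have err: "0 \<le> 4 * r + \<epsilon>" using r \<epsilon> by simp
  have closed_visits: "closed {s \<in> {a..b}. \<gamma> s \<in> B}" if B: "finite B" "B \<subseteq> M" for B
  proof -
    have "closedin mtopology B"
      using closedin_Hausdorff_finite[OF Hausdorff_space_mtopology] B by simp
    then have "closedin (top_of_set {0..1}) {s \<in> topspace (top_of_set {0..1}). \<gamma> s \<in> B}"
      using \<gamma> closedin_continuous_map_preimage unfolding pathin_def by blast
    then have "closed {s \<in> {0..1}. \<gamma> s \<in> B}"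
      using closedin_closed_trans by fastforce
    then have "closed ({a..b} \<inter> {s \<in> {0..1}. \<gamma> s \<in> B})"
      by (intro closed_Int) auto
    moreover have "{a..b} \<inter> {s \<in> {0..1}. \<gamma> s \<in> B} = {s \<in> {a..b}. \<gamma> s \<in> B}"
      using ab by auto
    ultimately show ?thesis by simp
  qed
  have compact_visits: "compact {s \<in> {a..b}. \<gamma> s \<in> B}" if "finite B" "B \<subseteq> M" for B
    unfolding compact_eq_bounded_closed
  proof
    show "bounded {s \<in> {a..b}. \<gamma> s \<in> B}"
      by (rule bounded_subset[OF bounded_closed_interval[of a b]]) blast
  qed (rule closed_visits[OF that])
  show ?case
  proof (cases "{s \<in> {a..b}. \<gamma> s \<in> D} = {}")
    case True
    have "\<gamma> ` {a<..<b} \<inter> C = {}"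
    proof -
      have "\<gamma> s \<notin> C" if "s \<in> {a<..<b}" for s
      proof
        assume "\<gamma> s \<in> C"
        then have "\<gamma> s \<in> D" using less.prems(6) that by blast
        then show False using True that by auto
      qed
      then show ?thesis by blast
    qed
    then obtain ts where ts: "sorted ts" "set ts \<subseteq> {\<theta> a..\<theta> b}" "d (\<gamma> a) (\<gamma> b) \<le> chain_length dist (map h ts) + (4 * r + \<epsilon>)"
      using piece[of b] ab by auto
    have "1 * (4 * r + \<epsilon>) \<le> real (card D + 1) * (4 * r + \<epsilon>)"
      using err by (intro mult_right_mono) auto
    then show ?thesis
      using ts by (intro exI[of _ ts]) auto
  next
    case False
    have DM: "finite D" "D \<subseteq> M" using less.prems C by auto
    obtain s1 where s1: "s1 \<in> {s \<in> {a..b}. \<gamma> s \<in> D}" "\<And>s. s \<in> {s \<in> {a..b}. \<gamma> s \<in> D} \<Longrightarrow> s1 \<le> s"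
      using compact_attains_inf[OF compact_visits[OF DM] False] by blast
    define c where "c = \<gamma> s1"
    have cM: "finite {c}" "{c} \<subseteq> M" using s1(1) DM by (auto simp: c_def)
    obtain s2 where s2: "s2 \<in> {s \<in> {a..b}. \<gamma> s \<in> {c}}" "\<And>s. s \<in> {s \<in> {a..b}. \<gamma> s \<in> {c}} \<Longrightarrow> s \<le> s2"
      using compact_attains_sup[OF compact_visits[OF cM]] s1(1) by (force simp: c_def)
    have s12: "s1 \<le> s2" using s2(2)[of s1] s1(1) by (auto simp: c_def)
    have "\<gamma> ` {a<..<s1} \<inter> C = {}"
    proof -
      have "\<gamma> s \<notin> C" if s: "s \<in> {a<..<s1}" for s
      proof
        assume "\<gamma> s \<in> C"
        moreover have "s \<in> {a<..<b}" using s s1(1) by auto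
        ultimately have "\<gamma> s \<in> D" using less.prems(6) by blast
        then show False using s1(2)[of s] s s1(1) by auto
      qed
      then show ?thesis by blast
    qed
    then obtain us where us: "sorted us" "set us \<subseteq> {\<theta> a..\<theta> s1}" "d (\<gamma> a) (\<gamma> s1) \<le> chain_length dist (map h us) + (4 * r + \<epsilon>)"
      using piece[of s1] s1(1) by auto
    have avoid2: "\<gamma> ` {s2<..<b} \<inter> C \<subseteq> D - {c}"
    proof
      fix x assume "x \<in> \<gamma> ` {s2<..<b} \<inter> C"
      then obtain s where s: "x = \<gamma> s" "s2 < s" "s < b" "x \<in> C" by auto
      then have "s \<in> {a<..<b}" using s2(1) by auto
      then have "x \<in> D" using less.prems(6) s by blast
      moreover have "x \<noteq> c" using s2(2)[of s] s s2(1) by auto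
      ultimately show "x \<in> D - {c}" by blast
    qed
    have cD: "c \<in> D" using s1(1) by (simp add: c_def)
    then have card: "card D = Suc (card (D - {c}))"
      by (rule card.remove[OF DM(1)])
    then have less: "card (D - {c}) < card D" by linarith
    obtain vs where vs: "sorted vs" "set vs \<subseteq> {\<theta> s2..\<theta> b}"
      "d (\<gamma> s2) (\<gamma> b) \<le> chain_length dist (map h vs) + real (card (D - {c}) + 1) * (4 * r + \<epsilon>)"
      using less.hyps[OF less _ _ _ _ _ avoid2] less.prems s2(1) by auto
    have \<theta>s: "\<theta> a \<le> \<theta> s1" "\<theta> s1 \<le> \<theta> s2" "\<theta> s2 \<le> \<theta> b"
      using \<theta> s1(1) s2(1) s12 ab by auto
    have "d (\<gamma> a) (\<gamma> b) \<le> d (\<gamma> a) (\<gamma> s1) + d (\<gamma> s2) (\<gamma> b)"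
      using triangle[of "\<gamma> a" "\<gamma> s1" "\<gamma> b"] mem s1(1) s2(1) ab by (auto simp: c_def)
    also have "\<dots> \<le> chain_length dist (map h us) + chain_length dist (map h vs) + real (card (D - {c}) + 2) * (4 * r + \<epsilon>)"
      using us(3) vs(3) by (simp add: algebra_simps)
    also have "\<dots> \<le> chain_length dist (map h (us @ vs)) + real (card D + 1) * (4 * r + \<epsilon>)"
      using chain_length_append_ge[of dist "map h us" "map h vs"] by (simp add: card)
    finally have "d (\<gamma> a) (\<gamma> b) \<le> chain_length dist (map h (us @ vs)) + real (card D + 1) * (4 * r + \<epsilon>)" .
    moreover have "sorted (us @ vs)" "set (us @ vs) \<subseteq> {\<theta> a..\<theta> b}"
      using us(1,2) vs(1,2) \<theta>s by (force simp: sorted_append subset_iff)+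
    ultimately show ?thesis by (intro exI[of _ "us @ vs"]) auto
  qed
qed

section \<open>Winding numbers as real cocycles\<close>

definition pairing :: "('s \<Rightarrow> real) \<Rightarrow> ('s \<Rightarrow>\<^sub>0 real) \<Rightarrow> real" where
  "pairing \<phi> c = (\<Sum>s\<in>Poly_Mapping.keys c. Poly_Mapping.lookup c s * \<phi> s)"

lemma pairing_superset:
  assumes "finite A" "Poly_Mapping.keys c \<subseteq> A"
  shows "pairing \<phi> c = (\<Sum>s\<in>A. Poly_Mapping.lookup c s * \<phi> s)"
  unfolding pairing_def using assms by (intro sum.mono_neutral_left) (auto simp: in_keys_iff)

lemma pairing_add: "pairing \<phi> (a + b) = pairing \<phi> a + pairing \<phi> b"
proof -
  let ?A = "Poly_Mapping.keys a \<union> Poly_Mapping.keys b"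
  have "pairing \<phi> (a + b) = (\<Sum>s\<in>?A. Poly_Mapping.lookup (a + b) s * \<phi> s)"
    using keys_add[of a b] by (intro pairing_superset) auto
  also have "\<dots> = (\<Sum>s\<in>?A. Poly_Mapping.lookup a s * \<phi> s) + (\<Sum>s\<in>?A. Poly_Mapping.lookup b s * \<phi> s)"
    by (simp add: lookup_add algebra_simps sum.distrib)
  also have "\<dots> = pairing \<phi> a + pairing \<phi> b"
    by (simp add: pairing_superset[of ?A])
  finally show ?thesis .
qed

lemma pairing_diff: "pairing \<phi> (a - b) = pairing \<phi> a - pairing \<phi> b"
  using pairing_add[of \<phi> "a - b" b] by simp

lemma pairing_zero [simp]: "pairing \<phi> 0 = 0"
  by (simp add: pairing_def)

lemma pairing_single [simp]: "pairing \<phi> (Poly_Mapping.single s r) = r * \<phi> s"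
  by (simp add: pairing_def)

lemma pairing_sum: "pairing \<phi> (sum f I) = (\<Sum>i\<in>I. pairing \<phi> (f i))"
  by (induction I rule: infinite_finite_induct) (auto simp: pairing_add)

lemma pairing_scaleR: "pairing \<phi> (r *\<^sub>R c) = r * pairing \<phi> c"
proof -
  have "Poly_Mapping.keys (r *\<^sub>R c) \<subseteq> Poly_Mapping.keys c"
    by (auto simp: in_keys_iff lookup_scaleR)
  then have "pairing \<phi> (r *\<^sub>R c) = (\<Sum>s\<in>Poly_Mapping.keys c. Poly_Mapping.lookup (r *\<^sub>R c) s * \<phi> s)"
    by (intro pairing_superset) auto
  then show ?thesis
    by (simp add: lookup_scaleR pairing_def sum_distrib_left mult.assoc)
qed

lemma real_chain_boundary_superset:
  assumes "finite A" "Poly_Mapping.keys c \<subseteq> A"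
  shows "real_chain_boundary (Suc n) c = (\<Sum>s\<in>A. \<Sum>k\<le>Suc n.
    Poly_Mapping.single (singular_face (Suc n) k s) ((-1) ^ k * Poly_Mapping.lookup c s))"
  unfolding real_chain_boundary_def if_not_P[OF nat.distinct(2)] using assms
  by (intro sum.mono_neutral_left) (auto simp: in_keys_iff)

lemma real_chain_boundary_add:
  "real_chain_boundary (Suc n) (a + b) = real_chain_boundary (Suc n) a + real_chain_boundary (Suc n) b"
proof -
  let ?A = "Poly_Mapping.keys a \<union> Poly_Mapping.keys b"
  have fin: "finite ?A" by simp
  have sub: "Poly_Mapping.keys (a + b) \<subseteq> ?A" "Poly_Mapping.keys a \<subseteq> ?A" "Poly_Mapping.keys b \<subseteq> ?A"
    using keys_add[of a b] by auto
  show ?thesis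
    unfolding real_chain_boundary_superset[OF fin sub(1)] real_chain_boundary_superset[OF fin sub(2)]
      real_chain_boundary_superset[OF fin sub(3)]
    by (simp only: lookup_add distrib_left single_add sum.distrib)
qed

lemma real_chain_boundary_zero: "real_chain_boundary n 0 = 0"
  by (simp add: real_chain_boundary_def)

lemma real_chain_boundary_diff:
  "real_chain_boundary (Suc n) (a - b) = real_chain_boundary (Suc n) a - real_chain_boundary (Suc n) b"
  using real_chain_boundary_add[of n "a - b" b] by simp

lemma real_chain_boundary_1_single:
  "real_chain_boundary 1 (Poly_Mapping.single s 1) =
     Poly_Mapping.single (singular_face 1 0 s) 1 - Poly_Mapping.single (singular_face 1 1 s) 1"
proof -
  have "{..1::nat} = {0, 1}" by auto
  then show ?thesis
    by (simp add: real_chain_boundary_def single_uminus)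
qed

lemma pairing_boundary_zero:
  assumes cocycle: "\<And>s. singular_simplex 2 X s \<Longrightarrow>
      \<phi> (singular_face 2 0 s) - \<phi> (singular_face 2 1 s) + \<phi> (singular_face 2 2 s) = 0"
    and b: "b \<in> real_boundaries 1 X"
  shows "pairing \<phi> b = 0"
proof -
  obtain c where c: "b = real_chain_boundary 2 c" "Poly_Mapping.keys c \<subseteq> singular_simplex_set 2 X"
    using b by (auto simp: real_boundaries_def real_singular_chains_def numeral_2_eq_2)
  have "{..2::nat} = {0, 1, 2}" by auto
  then have "(\<Sum>k\<le>2. (-1) ^ k * x * \<phi> (singular_face 2 k s)) =
      x * (\<phi> (singular_face 2 0 s) - \<phi> (singular_face 2 1 s) + \<phi> (singular_face 2 2 s))" for x s
    by (simp add: algebra_simps)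
  then have "pairing \<phi> b = (\<Sum>s\<in>Poly_Mapping.keys c. Poly_Mapping.lookup c s *
      (\<phi> (singular_face 2 0 s) - \<phi> (singular_face 2 1 s) + \<phi> (singular_face 2 2 s)))"
    by (simp add: c(1) real_chain_boundary_def pairing_sum)
  also have "\<dots> = 0"
    using c(2) cocycle by (intro sum.neutral) auto
  finally show ?thesis .
qed

text \<open>
  The increment of the argument along a path that has a continuous logarithm, in full turns.
  Without a logarithm the value is arbitrary.
\<close>

definition turning :: "(real \<Rightarrow> complex) \<Rightarrow> real" where
  "turning f = (let l = SOME l. continuous_on {0..1} l \<and> (\<forall>t\<in>{0..1}. f t = exp (l t))
     in Im (l 1 - l 0) / (2 * pi))"

lemma exp_one_path_constant:
  assumes "continuous_on {0..1::real} k" "\<And>t. t \<in> {0..1} \<Longrightarrow> exp (k t) = (1::complex)"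
  shows "k 1 = k 0"
proof -
  have "k constant_on {0..1}"
  proof (rule continuous_discrete_range_constant)
    fix s :: real assume s: "s \<in> {0..1}"
    have "1 \<le> norm (k t - k s)" if t: "t \<in> {0..1}" "k t \<noteq> k s" for t
    proof -
      obtain m n :: int where mn: "Re (k s) = 0" "Im (k s) = of_int (2 * m) * pi" "Re (k t) = 0" "Im (k t) = of_int (2 * n) * pi"
        using assms(2)[OF s] assms(2)[OF t(1)] by (auto simp: exp_eq_1)
      then have "m \<noteq> n" using t(2) by (auto simp: complex_eq_iff)
      then have "1 \<le> \<bar>n - m\<bar>" by simp
      then have "1 \<le> \<bar>real_of_int (n - m)\<bar>" by linarith
      then have "1 * 1 \<le> \<bar>real_of_int (n - m)\<bar> * (2 * pi)"
        using pi_gt3 by (intro mult_mono) auto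
      also have "\<dots> = \<bar>Im (k t - k s)\<bar>"
      proof -
        have "Im (k t - k s) = real_of_int (n - m) * (2 * pi)"
          using mn by (simp add: algebra_simps)
        then show ?thesis by (simp add: abs_mult)
      qed
      also have "\<dots> \<le> norm (k t - k s)" by (rule abs_Im_le_cmod)
      finally show ?thesis by simp
    qed
    then show "\<exists>e>0. \<forall>y. y \<in> {0..1} \<and> k y \<noteq> k s \<longrightarrow> e \<le> norm (k y - k s)"
      by (intro exI[of _ 1]) auto
  qed (use assms in auto)
  then show ?thesis unfolding constant_on_def by force
qed

lemma turning_eq:
  assumes "continuous_on {0..1} l" "\<And>t. t \<in> {0..1} \<Longrightarrow> f t = exp (l t)"
  shows "turning f = Im (l 1 - l 0) / (2 * pi)"
proof -
  define k where "k = (SOME l. continuous_on {0..1} l \<and> (\<forall>t\<in>{0..1}. f t = exp (l t)))"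
  have "continuous_on {0..1} k \<and> (\<forall>t\<in>{0..1}. f t = exp (k t))"
    unfolding k_def by (rule someI[of _ l]) (use assms in blast)
  then have k: "continuous_on {0..1} k" "\<And>t. t \<in> {0..1} \<Longrightarrow> f t = exp (k t)" by blast+
  have "(\<lambda>t. k t - l t) 1 = (\<lambda>t. k t - l t) 0"
  proof (rule exp_one_path_constant)
    show "exp (k t - l t) = 1" if "t \<in> {0..1}" for t
      using k(2)[OF that] assms(2)[OF that] by (simp add: exp_diff)
  qed (intro continuous_intros k assms)
  then have "k 1 - k 0 = l 1 - l 0" by (simp add: algebra_simps)
  then show ?thesis unfolding turning_def Let_def k_def[symmetric] by simp
qed

definition edge_point :: "real \<Rightarrow> nat \<Rightarrow> real" where
  "edge_point t = (\<lambda>i. if i = 0 then 1 - t else if i = 1 then t else 0)"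

definition triangle_point :: "real \<times> real \<Rightarrow> nat \<Rightarrow> real" where
  "triangle_point z = (\<lambda>i. if i = 0 then 1 - fst z - snd z else if i = 1 then fst z else if i = 2 then snd z else 0)"

definition simplex_turning :: "('a \<Rightarrow> complex) \<Rightarrow> ((nat \<Rightarrow> real) \<Rightarrow> 'a) \<Rightarrow> real" where
  "simplex_turning \<omega> s = turning (\<lambda>t. \<omega> (s (edge_point t)))"

lemma edge_point_in_simplex: "t \<in> {0..1} \<Longrightarrow> edge_point t \<in> standard_simplex 1"
proof -
  have "{..1::nat} = {0, 1}" by auto
  then show "t \<in> {0..1} \<Longrightarrow> edge_point t \<in> standard_simplex 1"
    by (auto simp: standard_simplex_def edge_point_def)
qed

lemma simplical_face_edge_point:
  "simplical_face 0 (edge_point t) = triangle_point (1 - t, t)"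
  "simplical_face 1 (edge_point t) = triangle_point (0, t)"
  "simplical_face 2 (edge_point t) = triangle_point (t, 0)"
  by (auto simp: simplical_face_def edge_point_def triangle_point_def fun_eq_iff)

text \<open>
  On a triangle a nowhere vanishing function has a logarithm, whose increments along the three
  sides add up to zero.
\<close>

lemma simplex_turning_cocycle:
  assumes \<omega>: "continuous_map X euclidean \<omega>" "\<And>x. x \<in> topspace X \<Longrightarrow> \<omega> x \<noteq> 0"
    and s: "singular_simplex 2 X s"
  shows "simplex_turning \<omega> (singular_face 2 0 s) - simplex_turning \<omega> (singular_face 2 1 s)
    + simplex_turning \<omega> (singular_face 2 2 s) = 0"
proof -
  define T where "T = {z :: real \<times> real. 0 \<le> fst z \<and> 0 \<le> snd z \<and> fst z + snd z \<le> 1}"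
  have convT: "convex T"
  proof -
    have "T = {z. (1, 0) \<bullet> z \<ge> 0} \<inter> {z. (0, 1) \<bullet> z \<ge> 0} \<inter> {z. (1, 1) \<bullet> z \<le> 1}"
      by (auto simp: T_def inner_prod_def)
    then show ?thesis
      by (auto intro!: convex_Int convex_halfspace_ge convex_halfspace_le)
  qed
  have mem: "triangle_point z \<in> standard_simplex 2" if "z \<in> T" for z
  proof -
    have "{..2::nat} = {0, 1, 2}" by auto
    then show ?thesis
      using that by (auto simp: standard_simplex_def triangle_point_def T_def)
  qed
  have "continuous_map (top_of_set T) (powertop_real UNIV) triangle_point"
    unfolding continuous_map_componentwise_UNIV
  proof
    fix i :: nat
    show "continuous_map (top_of_set T) euclideanreal (\<lambda>z. triangle_point z i)"
      by (cases "i = 0"; cases "i = 1"; cases "i = 2") (auto simp: triangle_point_def intro!: continuous_intros)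
  qed
  then have "continuous_map (top_of_set T) (subtopology (powertop_real UNIV) (standard_simplex 2)) triangle_point"
    using mem by (auto simp: continuous_map_in_subtopology)
  then have cont: "continuous_map (top_of_set T) X (s \<circ> triangle_point)"
    using s unfolding singular_simplex_def by (blast intro: continuous_map_compose)
  then have "continuous_on T (\<lambda>z. \<omega> (s (triangle_point z)))"
    using continuous_map_compose[OF cont \<omega>(1)] by (simp add: comp_def)
  moreover have "\<omega> (s (triangle_point z)) \<noteq> 0" if "z \<in> T" for z
    using \<omega>(2) continuous_map_image_subset_topspace[OF cont] that by auto
  ultimately obtain l where l: "continuous_on T l" "\<And>z. z \<in> T \<Longrightarrow> \<omega> (s (triangle_point z)) = exp (l z)"
    using continuous_logarithm_on_contractible[OF _ convex_imp_contractible[OF convT]] by metis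
  have side: "simplex_turning \<omega> (singular_face 2 k s) = Im (l (\<pi> 1) - l (\<pi> 0)) / (2 * pi)"
    if \<pi>: "\<And>t. simplical_face k (edge_point t) = triangle_point (\<pi> t)" "\<And>t. t \<in> {0..1} \<Longrightarrow> \<pi> t \<in> T" "continuous_on {0..1} \<pi>"
    for k \<pi>
    unfolding simplex_turning_def
  proof (rule turning_eq[of "\<lambda>t. l (\<pi> t)"])
    show "continuous_on {0..1} (\<lambda>t. l (\<pi> t))"
      by (rule continuous_on_compose2[OF l(1) \<pi>(3)]) (use \<pi>(2) in auto)
    show "\<omega> (singular_face 2 k s (edge_point t)) = exp (l (\<pi> t))" if "t \<in> {0..1}" for t
      using edge_point_in_simplex[OF that] l(2)[OF \<pi>(2)[OF that]] \<pi>(1)[of t]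
      by (simp add: singular_face_def)
  qed
  have "simplex_turning \<omega> (singular_face 2 0 s) = Im (l (0, 1) - l (1, 0)) / (2 * pi)"
  proof -
    have "continuous_on {0..1} (\<lambda>t :: real. (1 - t, t))" by (intro continuous_intros)
    from side[OF simplical_face_edge_point(1) _ this] show ?thesis by (simp add: T_def)
  qed
  moreover have "simplex_turning \<omega> (singular_face 2 1 s) = Im (l (0, 1) - l (0, 0)) / (2 * pi)"
  proof -
    have "continuous_on {0..1} (\<lambda>t :: real. (0 :: real, t))" by (intro continuous_intros)
    from side[OF simplical_face_edge_point(2) _ this] show ?thesis by (simp add: T_def)
  qed
  moreover have "simplex_turning \<omega> (singular_face 2 2 s) = Im (l (1, 0) - l (0, 0)) / (2 * pi)"
  proof -
    have "continuous_on {0..1} (\<lambda>t :: real. (t, 0 :: real))" by (intro continuous_intros)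
    from side[OF simplical_face_edge_point(3) _ this] show ?thesis by (simp add: T_def)
  qed
  ultimately show ?thesis
    by (simp only: minus_complex.sel flip: add_divide_distrib diff_divide_distrib) simp
qed

section \<open>Chords are independent cycles\<close>

definition path_simplex :: "(real \<Rightarrow> 'a) \<Rightarrow> (nat \<Rightarrow> real) \<Rightarrow> 'a" where
  "path_simplex e = restrict (\<lambda>x. e (x 1)) (standard_simplex 1)"

definition point_simplex :: "'a \<Rightarrow> (nat \<Rightarrow> real) \<Rightarrow> 'a" where
  "point_simplex v = restrict (\<lambda>_. v) (standard_simplex 0)"

lemma singular_simplex_path:
  assumes "pathin X e"
  shows "singular_simplex 1 X (path_simplex e)"
proof -
  have "continuous_map (subtopology (powertop_real UNIV) (standard_simplex 1)) (top_of_set {0..1}) (\<lambda>x. x 1)"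
    by (auto simp: continuous_map_in_subtopology standard_simplex_def
        intro!: continuous_map_from_subtopology continuous_map_product_projection)
  then have "continuous_map (subtopology (powertop_real UNIV) (standard_simplex 1)) X (e \<circ> (\<lambda>x. x 1))"
    using assms unfolding pathin_def by (rule continuous_map_compose)
  then have "continuous_map (subtopology (powertop_real UNIV) (standard_simplex 1)) X (path_simplex e)"
    by (rule continuous_map_eq) (auto simp: path_simplex_def)
  then show ?thesis
    by (simp add: singular_simplex_def path_simplex_def)
qed

lemma path_simplex_faces:
  "singular_face 1 0 (path_simplex e) = point_simplex (e 1)"
  "singular_face 1 1 (path_simplex e) = point_simplex (e 0)"
proof -
  have x: "x = (\<lambda>j. if j = 0 then 1 else 0)" if "x \<in> standard_simplex 0" for x
    using that standard_simplex_0 by blast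
  have "singular_face 1 k (path_simplex e) = point_simplex (e (if k = 0 then 1 else 0))" if "k \<le> 1" for k
  proof
    fix x
    show "singular_face 1 k (path_simplex e) x = point_simplex (e (if k = 0 then 1 else 0)) x"
    proof (cases "x \<in> standard_simplex 0")
      case True
      then have "simplical_face k x \<in> standard_simplex 1"
        using simplical_face_in_standard_simplex[of 1 k x] that by simp
      moreover have "simplical_face k x 1 = (if k = 0 then 1 else 0)"
        using x[OF True] that by (cases "k = 0") (auto simp: simplical_face_def)
      ultimately show ?thesis
        using True by (simp add: singular_face_def path_simplex_def point_simplex_def)
    qed (simp add: singular_face_def point_simplex_def)
  qed
  from this[of 0] this[of 1] show
    "singular_face 1 0 (path_simplex e) = point_simplex (e 1)"
    "singular_face 1 1 (path_simplex e) = point_simplex (e 0)" by simp_all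
qed

lemma path_simplex_edge_point: "t \<in> {0..1} \<Longrightarrow> path_simplex e (edge_point t) = e t"
  using edge_point_in_simplex[of t] by (simp add: path_simplex_def edge_point_def)

context ascending_graph
begin

text \<open>
  Collapsing the complement of the open edge to a point turns the graph into a circle. Heights
  increase strictly along the edge, so they serve as its parameter.
\<close>

definition circle_map :: "(real \<Rightarrow> 'a) \<Rightarrow> 'a \<Rightarrow> complex" where
  "circle_map e x = (if x \<in> e ` {0<..<1}
     then exp (2 * of_real pi * \<i> * of_real ((d q x - d q (e 0)) / (d q (e 1) - d q (e 0)))) else 1)"

lemma circle_map_edge:
  assumes e: "e \<in> E" and u: "u \<in> {0..1}"
  shows "circle_map e (e u) = exp (2 * of_real pi * \<i> * of_real ((d q (e u) - d q (e 0)) / (d q (e 1) - d q (e 0))))"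
proof -
  have len: "d q (e 0) < d q (e 1)" using edge_strict_mono[OF e, of 0 1] by simp
  consider "u = 0" | "u = 1" | "0 < u" "u < 1" using u by force
  then show ?thesis
  proof cases
    case 1
    have "e 0 \<notin> e ` {0<..<1}" using edge_ends[OF e] edge_notin_V[OF e] by auto
    then show ?thesis using 1 by (simp add: circle_map_def)
  next
    case 2
    have "e 1 \<notin> e ` {0<..<1}" using edge_ends[OF e] edge_notin_V[OF e] by auto
    then show ?thesis using 2 len by (simp add: circle_map_def)
  next
    case 3
    then show ?thesis by (simp add: circle_map_def)
  qed
qed

lemma circle_map_continuous:
  assumes e: "e \<in> E"
  shows "continuous_map mtopology euclidean (circle_map e)"
proof -
  define F where "F = (\<lambda>b x. if b then exp (2 * of_real pi * \<i> * of_real ((d q x - d q (e 0)) / (d q (e 1) - d q (e 0)))) else (1 :: complex))"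
  define A where "A = (\<lambda>b. if b then e ` {0..1} else M - e ` {0<..<1})"
  have "continuous_map mtopology euclidean (\<lambda>x. exp (2 * of_real pi * \<i> * of_real ((d q x - d q (e 0)) / (d q (e 1) - d q (e 0)))))"
  proof -
    have "continuous_on UNIV (\<lambda>r. exp (2 * of_real pi * \<i> * of_real ((r - d q (e 0)) / (d q (e 1) - d q (e 0)))))"
      using edge_strict_mono[OF e, of 0 1] by (intro continuous_intros) auto
    then have "continuous_map euclideanreal euclidean (\<lambda>r. exp (2 * of_real pi * \<i> * of_real ((r - d q (e 0)) / (d q (e 1) - d q (e 0)))))"
      by simp
    from continuous_map_compose[OF continuous_dist[OF base_in] this] show ?thesis
      by (simp add: comp_def)
  qed
  then have cont: "continuous_map mtopology euclidean (F b)" for b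
    by (cases b) (simp_all add: F_def)
  have same: "F True x = F False x" if x: "x \<in> e ` {0..1}" "x \<notin> e ` {0<..<1}" for x
  proof -
    obtain u where u: "x = e u" "0 \<le> u" "u \<le> 1" using x(1) by auto
    then have "u = 0 \<or> u = 1" using x(2) by (force simp: less_le)
    then show ?thesis
      using u(1) edge_strict_mono[OF e, of 0 1] by (auto simp: F_def)
  qed
  show ?thesis
  proof (rule pasting_lemma_closed[where I = UNIV and T = A and f = F])
    show "closedin mtopology (A b)" for b
      using closedin_subedge[OF e, of 0 1] openin_subedge[OF e, of 0 1]
      by (auto simp: A_def intro: closedin_diff)
    show "continuous_map (subtopology mtopology (A b)) euclidean (F b)" for b
      using cont by (rule continuous_map_from_subtopology)
    show "F i x = F j x" if "x \<in> topspace mtopology \<inter> A i \<inter> A j" for i j x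
      using same[of x] that by (cases i; cases j) (auto simp: A_def)
    show "\<exists>j. j \<in> UNIV \<and> x \<in> A j \<and> circle_map e x = F j x" if "x \<in> topspace mtopology" for x
      using that by (intro exI[of _ "x \<in> e ` {0<..<1}"]) (auto simp: A_def F_def circle_map_def)
  qed simp
qed

lemma turning_own_edge:
  assumes "e \<in> E"
  shows "simplex_turning (circle_map e) (path_simplex e) = 1"
proof -
  define l where "l = (\<lambda>u. 2 * of_real pi * \<i> * of_real ((d q (e u) - d q (e 0)) / (d q (e 1) - d q (e 0))))"
  have len: "d q (e 1) - d q (e 0) \<noteq> 0" using edge_strict_mono[OF assms, of 0 1] by simp
  have "simplex_turning (circle_map e) (path_simplex e) = Im (l 1 - l 0) / (2 * pi)"
    unfolding simplex_turning_def
  proof (rule turning_eq)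
    show "continuous_on {0..1} l"
      unfolding l_def using len by (intro continuous_intros continuous_height_edge[OF assms]) auto
  qed (use assms in \<open>simp add: path_simplex_edge_point circle_map_edge l_def\<close>)
  also have "\<dots> = 1"
    using len by (simp add: l_def)
  finally show ?thesis .
qed

lemma turning_other_edge:
  assumes "e \<in> E" "e' \<in> E" "e' \<noteq> e"
  shows "simplex_turning (circle_map e) (path_simplex e') = 0"
proof -
  have "circle_map e (e' t) = 1" if "t \<in> {0..1}" for t
  proof -
    have "e' t \<noteq> e u" if "0 < u" "u < 1" for u
      using edge_eq_interior[OF assms(1,2) that, of t] assms(3) \<open>t \<in> {0..1}\<close> by auto
    then have "e' t \<notin> e ` {0<..<1}" by (metis imageE greaterThanLessThan_iff)
    then show ?thesis by (simp add: circle_map_def)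
  qed
  then have "simplex_turning (circle_map e) (path_simplex e') = Im ((\<lambda>_. 0) (1::real) - (\<lambda>_. 0) (0::real)) / (2 * pi)"
    unfolding simplex_turning_def by (intro turning_eq) (auto simp: path_simplex_edge_point)
  then show ?thesis by simp
qed

text \<open>The sum of the parent edges on the way down to the base.\<close>

lemma descent_chain_exists:
  assumes "v \<in> V"
  shows "\<exists>a. Poly_Mapping.keys a \<subseteq> path_simplex ` (E - chords) \<and>
    real_chain_boundary 1 a = Poly_Mapping.single (point_simplex v) 1 - Poly_Mapping.single (point_simplex q) 1"
  using assms
proof (induction "card {w \<in> V. d q w < d q v}" arbitrary: v rule: less_induct)
  case less
  show ?case
  proof (cases "v = q")
    case True
    then show ?thesis by (intro exI[of _ 0]) (simp add: real_chain_boundary_zero)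
  next
    case False
    note p = parent[OF less.prems False]
    have "d q (parent v 0) < d q v"
      using edge_strict_mono[of "parent v" 0 1] p by simp
    then have "{w \<in> V. d q w < d q (parent v 0)} \<subset> {w \<in> V. d q w < d q v}"
      using edge_ends[of "parent v"] p by auto
    then have "card {w \<in> V. d q w < d q (parent v 0)} < card {w \<in> V. d q w < d q v}"
      using finV by (auto intro: psubset_card_mono)
    then obtain a where a: "Poly_Mapping.keys a \<subseteq> path_simplex ` (E - chords)"
        "real_chain_boundary 1 a = Poly_Mapping.single (point_simplex (parent v 0)) 1 - Poly_Mapping.single (point_simplex q) 1"
      using less.hyps edge_ends(1)[of "parent v"] p by blast
    let ?b = "a + Poly_Mapping.single (path_simplex (parent v)) 1"
    have "parent v \<in> E - chords"
      using p by (simp add: chords_def)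
    then have "Poly_Mapping.keys ?b \<subseteq> path_simplex ` (E - chords)"
      using a(1) keys_add[of a "Poly_Mapping.single (path_simplex (parent v)) 1"] by auto
    moreover have "real_chain_boundary 1 ?b =
        Poly_Mapping.single (point_simplex v) 1 - Poly_Mapping.single (point_simplex q) 1"
      using real_chain_boundary_add[of 0 a "Poly_Mapping.single (path_simplex (parent v)) 1"]
        real_chain_boundary_1_single[of "path_simplex (parent v)"] path_simplex_faces[of "parent v"] a(2) p
      by simp
    ultimately show ?thesis by blast
  qed
qed

text \<open>
  The descents from the ends of a chord consist of parent edges, so the cocycle of a chord sees only
  the chord itself: the matrix of all values of these cocycles on the cycles of the chords is the
  unit matrix.
\<close>

lemma card_chords_le_betti: "enat (card chords) \<le> betti_number 1 mtopology"
proof -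
  obtain a where a: "\<And>v. v \<in> V \<Longrightarrow> Poly_Mapping.keys (a v) \<subseteq> path_simplex ` (E - chords) \<and>
    real_chain_boundary 1 (a v) = Poly_Mapping.single (point_simplex v) 1 - Poly_Mapping.single (point_simplex q) 1"
    using descent_chain_exists by metis
  define z where "z = (\<lambda>e. Poly_Mapping.single (path_simplex e) 1 + a (e 0) - a (e 1))"
  define w where "w = (\<lambda>e. pairing (simplex_turning (circle_map e)))"
  have chE: "chords \<subseteq> E" by (auto simp: chords_def)
  have wa: "w e (a v) = 0" if ev: "e \<in> chords" "v \<in> V" for e v
    unfolding w_def pairing_def
  proof (intro sum.neutral ballI)
    fix s assume "s \<in> Poly_Mapping.keys (a v)"
    then obtain e' where "s = path_simplex e'" "e' \<in> E" "e' \<notin> chords"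
      using a[OF ev(2)] by blast
    then show "Poly_Mapping.lookup (a v) s * simplex_turning (circle_map e) s = 0"
      using turning_other_edge[of e e'] ev chE by auto
  qed
  have wz: "w e (z e') = (if e' = e then 1 else 0)" if "e \<in> chords" "e' \<in> chords" for e e'
  proof -
    have "e \<in> E" "e' \<in> E" using that chE by auto
    then have "w e (z e') = simplex_turning (circle_map e) (path_simplex e')"
      using wa[OF that(1)] edge_ends[of e'] unfolding z_def by (simp add: w_def pairing_add pairing_diff)
    then show ?thesis
      using turning_own_edge turning_other_edge \<open>e \<in> E\<close> \<open>e' \<in> E\<close> by auto
  qed
  have wB: "w e b = 0" if "e \<in> chords" "b \<in> real_boundaries 1 mtopology" for e b
    unfolding w_def
  proof (rule pairing_boundary_zero[OF simplex_turning_cocycle that(2)])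
    show "continuous_map mtopology euclidean (circle_map e)"
      using circle_map_continuous that chE by auto
  qed (auto simp: circle_map_def)
  have cycles: "z e \<in> real_cycles 1 mtopology" if "e \<in> chords" for e
  proof -
    have e: "e \<in> E" using that chE by auto
    have "Poly_Mapping.keys (a (e 0)) \<subseteq> path_simplex ` E" "Poly_Mapping.keys (a (e 1)) \<subseteq> path_simplex ` E"
        "path_simplex e \<in> path_simplex ` E"
      using a[OF edge_ends(1)[OF e]] a[OF edge_ends(2)[OF e]] e by blast+
    then have "Poly_Mapping.keys (z e) \<subseteq> path_simplex ` E"
      unfolding z_def using
        keys_diff[of "Poly_Mapping.single (path_simplex e) (1::real) + a (e 0)" "a (e 1)"]
        keys_add[of "Poly_Mapping.single (path_simplex e) (1::real)" "a (e 0)"] by (simp, blast)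
    moreover have "path_simplex ` E \<subseteq> singular_simplex_set 1 mtopology"
      using singular_simplex_path edge_path by auto
    moreover have "real_chain_boundary 1 (z e) = 0"
      unfolding z_def
      using real_chain_boundary_diff[of 0 "Poly_Mapping.single (path_simplex e) 1 + a (e 0)" "a (e 1)"]
        real_chain_boundary_add[of 0 "Poly_Mapping.single (path_simplex e) 1" "a (e 0)"]
        a[OF edge_ends(1)[OF e]] a[OF edge_ends(2)[OF e]]
        real_chain_boundary_1_single[of "path_simplex e"] path_simplex_faces[of e] by simp
    ultimately show ?thesis
      by (auto simp: real_cycles_def real_singular_chains_def)
  qed
  have fin: "finite chords" using finE chE finite_subset by blast
  have inj: "inj_on z chords"
  proof (rule inj_onI)
    fix e e' assume "e \<in> chords" "e' \<in> chords" "z e = z e'"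
    then show "e = e'" using wz[of e e'] wz[of e e] by (auto split: if_splits)
  qed
  have "independent_mod (real_boundaries 1 mtopology) (z ` chords)"
    unfolding independent_mod_def
  proof (intro conjI allI impI ballI)
    fix u v assume sum: "(\<Sum>v\<in>z ` chords. u v *\<^sub>R v) \<in> real_boundaries 1 mtopology" and "v \<in> z ` chords"
    then obtain e where e: "e \<in> chords" "v = z e" by auto
    have "0 = w e (\<Sum>v\<in>z ` chords. u v *\<^sub>R v)"
      using wB[OF e(1) sum] by simp
    also have "\<dots> = (\<Sum>e'\<in>chords. u (z e') * w e (z e'))"
      unfolding sum.reindex[OF inj] by (simp add: w_def pairing_sum pairing_scaleR)
    also have "\<dots> = (\<Sum>e'\<in>chords. if e' = e then u (z e') else 0)"
      using wz[OF e(1)] by (intro sum.cong) auto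
    also have "\<dots> = u v"
      using fin e by simp
    finally show "u v = 0" by simp
  qed (use fin in simp)
  moreover have "z ` chords \<subseteq> real_cycles 1 mtopology"
    using cycles by auto
  ultimately have "enat (card (z ` chords)) \<le> betti_number 1 mtopology"
    unfolding betti_number_def quotient_dim_def by (intro SUP_upper) auto
  then show ?thesis
    by (simp add: card_image[OF inj])
qed

end

section \<open>Transporting paths of the Reeb graph\<close>

text \<open>A connected set can be traversed in steps of any given size.\<close>

lemma (in Metric_space) connected_chain_induct:
  assumes K: "connectedin mtopology K" and xy: "x \<in> K" "y \<in> K" and \<epsilon>: "0 < \<epsilon>"
    and base: "P x" and step: "\<And>z w. z \<in> K \<Longrightarrow> w \<in> K \<Longrightarrow> P z \<Longrightarrow> d z w < \<epsilon> \<Longrightarrow> P w"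
  shows "P y"
proof (rule ccontr)
  assume "\<not> P y"
  let ?A = "\<Union>z\<in>{z\<in>K. P z}. mball z \<epsilon>" and ?B = "\<Union>z\<in>{z\<in>K. \<not> P z}. mball z \<epsilon>"
  have KM: "K \<subseteq> M" using connectedin_subset_topspace[OF K] by simp
  have opens: "openin mtopology ?A" "openin mtopology ?B"
    by (auto intro!: openin_Union)
  have cover: "K \<subseteq> ?A \<union> ?B"
  proof
    fix z assume "z \<in> K"
    then have "z \<in> mball z \<epsilon>" using KM \<epsilon> by auto
    then show "z \<in> ?A \<union> ?B" using \<open>z \<in> K\<close> by blast
  qed
  have disj: "?A \<inter> ?B \<inter> K = {}"
  proof -
    have False if w: "w \<in> K" and z: "z \<in> K" "P z" "w \<in> mball z \<epsilon>" and z': "z' \<in> K" "\<not> P z'" "w \<in> mball z' \<epsilon>" for w z z'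
    proof -
      have "P w" using step[OF z(1) w z(2)] z(3) by simp
      then have "P z'" using step[OF w z'(1)] z'(3) by (simp add: commute)
      then show False using z'(2) by simp
    qed
    then show ?thesis by blast
  qed
  have "x \<in> mball x \<epsilon>" "y \<in> mball y \<epsilon>" using KM xy \<epsilon> by auto
  then have "x \<in> ?A \<inter> K" "y \<in> ?B \<inter> K"
    using xy base \<open>\<not> P y\<close> by blast+
  then show False
    using connectedinD[OF K opens cover disj] by blast
qed

text \<open>
  The clock \<open>\<theta>\<close> is monotone but need not be continuous. It is what survives the removal of detours:
  the times of the remaining pieces still occur in order, so the variations of the profile over them
  add up to at most its length.
\<close>

definition (in Metric_space) follows ::
    "('a \<Rightarrow> real) \<Rightarrow> (real \<Rightarrow> real) \<Rightarrow> real \<Rightarrow> 'a \<Rightarrow> 'a \<Rightarrow> real \<Rightarrow> real \<Rightarrow> bool" where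
  "follows g h r u v s t \<longleftrightarrow> (\<exists>\<gamma> \<theta>. pathin mtopology \<gamma> \<and> \<gamma> 0 = u \<and> \<gamma> 1 = v \<and>
     (\<forall>a b. 0 \<le> a \<longrightarrow> a \<le> b \<longrightarrow> b \<le> 1 \<longrightarrow> \<theta> a \<le> \<theta> b) \<and>
     (\<forall>a\<in>{0..1}. s \<le> \<theta> a \<and> \<theta> a \<le> t \<and> \<bar>g (\<gamma> a) - h (\<theta> a)\<bar> \<le> r))"

context Metric_space
begin

lemma follows_weaken: "follows g h r u v s t \<Longrightarrow> t \<le> t' \<Longrightarrow> follows g h r u v s t'"
proof -
  assume f: "follows g h r u v s t" and t: "t \<le> t'"
  obtain \<gamma> \<theta> where \<gamma>: "pathin mtopology \<gamma>" "\<gamma> 0 = u" "\<gamma> 1 = v"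
    "\<forall>a b. 0 \<le> a \<longrightarrow> a \<le> b \<longrightarrow> b \<le> 1 \<longrightarrow> \<theta> a \<le> \<theta> b"
    "\<forall>a\<in>{0..1}. s \<le> \<theta> a \<and> \<theta> a \<le> t \<and> \<bar>g (\<gamma> a) - h (\<theta> a)\<bar> \<le> r"
    using f unfolding follows_def by blast
  then have "\<forall>a\<in>{0..1}. s \<le> \<theta> a \<and> \<theta> a \<le> t' \<and> \<bar>g (\<gamma> a) - h (\<theta> a)\<bar> \<le> r"
    using t by force
  then show "follows g h r u v s t'"
    unfolding follows_def using \<gamma>(1-4) by blast
qed

lemma follows_trans:
  assumes "follows g h r u v s t" "follows g h r v w t' z" "t \<le> t'"
  shows "follows g h r u w s z"
proof -
  obtain \<gamma> \<theta> where \<gamma>: "pathin mtopology \<gamma>" "\<gamma> 0 = u" "\<gamma> 1 = v"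
    "\<And>a b. 0 \<le> a \<Longrightarrow> a \<le> b \<Longrightarrow> b \<le> 1 \<Longrightarrow> \<theta> a \<le> \<theta> b"
    "\<And>a. a \<in> {0..1} \<Longrightarrow> s \<le> \<theta> a \<and> \<theta> a \<le> t \<and> \<bar>g (\<gamma> a) - h (\<theta> a)\<bar> \<le> r"
    using assms(1) unfolding follows_def by blast
  obtain \<gamma>' \<theta>' where \<gamma>': "pathin mtopology \<gamma>'" "\<gamma>' 0 = v" "\<gamma>' 1 = w"
    "\<And>a b. 0 \<le> a \<Longrightarrow> a \<le> b \<Longrightarrow> b \<le> 1 \<Longrightarrow> \<theta>' a \<le> \<theta>' b"
    "\<And>a. a \<in> {0..1} \<Longrightarrow> t' \<le> \<theta>' a \<and> \<theta>' a \<le> z \<and> \<bar>g (\<gamma>' a) - h (\<theta>' a)\<bar> \<le> r"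
    using assms(2) unfolding follows_def by blast
  have "pathin mtopology (join_paths \<gamma> \<gamma>')"
    using pathin_join \<gamma>(1,3) \<gamma>'(1,2) by metis
  moreover have "join_paths \<theta> \<theta>' a \<le> join_paths \<theta> \<theta>' b" if ab: "0 \<le> a" "a \<le> b" "b \<le> 1" for a b
  proof -
    consider "b \<le> 1/2" | "a \<le> 1/2" "1/2 < b" | "1/2 < a" using ab by linarith
    then show ?thesis
    proof cases
      case 1
      then show ?thesis using \<gamma>(4)[of "2 * a" "2 * b"] ab by (simp add: join_paths_def)
    next
      case 2
      then show ?thesis
        using \<gamma>(5)[of "2 * a"] \<gamma>'(5)[of "2 * b - 1"] ab assms(3) by (simp add: join_paths_def)
    next
      case 3
      then show ?thesis using \<gamma>'(4)[of "2 * a - 1" "2 * b - 1"] ab by (simp add: join_paths_def)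
    qed
  qed
  moreover have "s \<le> join_paths \<theta> \<theta>' a \<and> join_paths \<theta> \<theta>' a \<le> z \<and>
      \<bar>g (join_paths \<gamma> \<gamma>' a) - h (join_paths \<theta> \<theta>' a)\<bar> \<le> r" if "a \<in> {0..1}" for a
  proof (cases "a \<le> 1/2")
    case True
    then show ?thesis
      using \<gamma>(5)[of "2 * a"] \<gamma>'(5)[of 0] that assms(3) by (auto simp: join_paths_def)
  next
    case False
    then show ?thesis
      using \<gamma>'(5)[of "2 * a - 1"] \<gamma>(5)[of 1] that assms(3) by (auto simp: join_paths_def)
  qed
  ultimately show ?thesis
    unfolding follows_def using \<gamma>(2) \<gamma>'(3)
    by (intro exI[of _ "join_paths \<gamma> \<gamma>'"] exI[of _ "join_paths \<theta> \<theta>'"]) simp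
qed

lemma follows_geodesic:
  assumes "geodesic_space M d" "q \<in> M" "u \<in> M" "v \<in> M" "\<bar>d q u - h t\<bar> + d u v \<le> r"
  shows "follows (d q) h r u v t t"
proof -
  obtain \<gamma> where \<gamma>: "pathin mtopology \<gamma>" "\<gamma> 0 = u" "\<gamma> 1 = v"
    "\<And>a b. 0 \<le> a \<Longrightarrow> a \<le> b \<Longrightarrow> b \<le> 1 \<Longrightarrow> d u (\<gamma> a) + d (\<gamma> a) (\<gamma> b) + d (\<gamma> b) v \<le> d u v"
    using geodesicE[OF assms(1,3,4)] by metis
  have "\<bar>d q (\<gamma> a) - h t\<bar> \<le> r" if "a \<in> {0..1}" for a
  proof -
    have "\<gamma> a \<in> M" using path_image_subset_topspace[OF \<gamma>(1)] that by auto
    then have "\<bar>d q u - d q (\<gamma> a)\<bar> \<le> d u (\<gamma> a)"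
      using mdist_reverse_triangle[of u q "\<gamma> a"] assms(2,3) commute[of u q] by simp
    moreover have "d u (\<gamma> a) + d (\<gamma> a) (\<gamma> a) + d (\<gamma> a) v \<le> d u v"
      using \<gamma>(4)[of a a] that by simp
    then have "d u (\<gamma> a) \<le> d u v"
      using nonneg[of "\<gamma> a" "\<gamma> a"] nonneg[of "\<gamma> a" v] by linarith
    ultimately show ?thesis using assms(5) by linarith
  qed
  then show ?thesis
    unfolding follows_def using \<gamma>(1-3) by (intro exI[of _ \<gamma>] exI[of _ "\<lambda>_. t"]) simp
qed

end

text \<open>
  The height on the graph is the distance to the image of the base point, so it agrees with the
  height on the metric space up to the distortion of \<open>k\<close>.
\<close>

locale reeb_approximation = X: reeb_graph M d p + G: ascending_graph N e V E q
  for M :: "'a set" and d p and N :: "'b set" and e V E q +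
  fixes k :: "'a \<Rightarrow> 'b" and \<delta> :: real
  assumes k: "\<And>x. x \<in> M \<Longrightarrow> k x \<in> N" and q: "q = k p"
    and almost_isometry: "\<And>x y. x \<in> M \<Longrightarrow> y \<in> M \<Longrightarrow> \<bar>d x y - e (k x) (k y)\<bar> \<le> 2 * \<delta>"
begin

lemma \<delta>_nonneg: "0 \<le> \<delta>"
  using almost_isometry[OF X.base X.base] by linarith

text \<open>
  The error is the deviation \<open>2 \<delta> + \<epsilon>\<close> of the heights at the images of the points of a chain, plus the
  length \<open>2 \<delta> + \<epsilon>\<close> of a geodesic that joins two consecutive images. Time stands still on the piece.
\<close>

lemma follows_piece:
  assumes \<beta>: "pathin (reeb_topology M d p) \<beta>" and st: "0 \<le> s" "s \<le> t" "t \<le> 1"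
    and zw: "z \<in> M" "w \<in> M" "\<beta> s = X.cls z" "\<beta> t = X.cls w"
    and \<epsilon>: "0 < \<epsilon>" "\<And>u. s \<le> u \<Longrightarrow> u \<le> t \<Longrightarrow> \<bar>X.height (\<beta> u) - X.height (\<beta> s)\<bar> < \<epsilon>"
  shows "G.follows (e q) (X.height \<circ> \<beta>) (4 * \<delta> + 2 * \<epsilon>) (k z) (k w) s s"
proof -
  let ?c = "X.height (\<beta> s)"
  have bounds: "?c - \<epsilon> < X.height (\<beta> u) \<and> X.height (\<beta> u) < ?c + \<epsilon>" if "s \<le> u" "u \<le> t" for u
    using \<epsilon>(2)[OF that] unfolding abs_less_iff by auto
  obtain K where K: "connectedin X.mtopology K" "z \<in> K" "w \<in> K" "K \<subseteq> {y \<in> M. ?c - \<epsilon> < d p y \<and> d p y < ?c + \<epsilon>}"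
    by (rule X.connected_lift_path[OF \<beta> st bounds zw])
  have KM: "y \<in> M" "\<bar>d p y - ?c\<bar> < \<epsilon>" if "y \<in> K" for y
    using K(4) that unfolding abs_less_iff by auto
  have near: "\<bar>e q (k y) - (X.height \<circ> \<beta>) s\<bar> \<le> 2 * \<delta> + \<epsilon>" if "y \<in> K" for y
    using almost_isometry[OF X.base KM(1)[OF that]] KM(2)[OF that] unfolding q comp_def by linarith
  show ?thesis
  proof (rule X.connected_chain_induct[OF K(1-3) \<epsilon>(1)])
    show "G.follows (e q) (X.height \<circ> \<beta>) (4 * \<delta> + 2 * \<epsilon>) (k z) (k z) s s"
      using near[OF K(2)] \<delta>_nonneg \<epsilon>(1) k[OF zw(1)]
      by (intro G.follows_geodesic[OF G.geodesic G.base_in]) auto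
    fix y y' assume y: "y \<in> K" "y' \<in> K" "G.follows (e q) (X.height \<circ> \<beta>) (4 * \<delta> + 2 * \<epsilon>) (k z) (k y) s s" "d y y' < \<epsilon>"
    have "\<bar>d y y' - e (k y) (k y')\<bar> \<le> 2 * \<delta>"
      using almost_isometry KM y by blast
    then have "\<bar>e q (k y) - (X.height \<circ> \<beta>) s\<bar> + e (k y) (k y') \<le> 4 * \<delta> + 2 * \<epsilon>"
      using near[OF y(1)] y(4) by linarith
    then have "G.follows (e q) (X.height \<circ> \<beta>) (4 * \<delta> + 2 * \<epsilon>) (k y) (k y') s s"
      using k KM y by (intro G.follows_geodesic[OF G.geodesic G.base_in]) auto
    with y(3) show "G.follows (e q) (X.height \<circ> \<beta>) (4 * \<delta> + 2 * \<epsilon>) (k z) (k y') s s"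
      by (rule G.follows_trans) simp
  qed
qed

lemma follows_reeb_path:
  assumes \<beta>: "pathin (reeb_topology M d p) \<beta>"
    and xy: "x \<in> M" "y \<in> M" "\<beta> 0 = X.cls x" "\<beta> 1 = X.cls y" and \<epsilon>: "0 < \<epsilon>"
  shows "G.follows (e q) (X.height \<circ> \<beta>) (4 * \<delta> + 2 * \<epsilon>) (k x) (k y) 0 1"
proof -
  let ?h = "X.height \<circ> \<beta>"
  have "uniformly_continuous_on {0..1} ?h"
    by (rule compact_uniformly_continuous[OF X.height_path_continuous[OF \<beta>]]) simp
  then obtain \<rho> where \<rho>: "\<rho> > 0" "\<And>s t. s \<in> {0..1} \<Longrightarrow> t \<in> {0..1} \<Longrightarrow> dist t s < \<rho> \<Longrightarrow> dist (?h t) (?h s) < \<epsilon>"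
    using \<epsilon> unfolding uniformly_continuous_on_def by metis
  obtain n where n: "inverse (real (Suc n)) < \<rho>"
    using reals_Archimedean[OF \<rho>(1)] by blast
  define \<tau> where "\<tau> = (\<lambda>i. real i / real (Suc n))"
  have \<tau>: "0 \<le> \<tau> i" "\<tau> i \<le> \<tau> (Suc i)" "\<tau> (Suc i) - \<tau> i < \<rho>" for i
    using n by (auto simp: \<tau>_def field_simps)
  have \<tau>1: "\<tau> i \<le> 1" if "i \<le> Suc n" for i
    using that by (simp add: \<tau>_def)
  have close: "\<bar>X.height (\<beta> u) - X.height (\<beta> s)\<bar> < \<epsilon>" if "s \<in> {0..1}" "u \<in> {0..1}" "\<bar>u - s\<bar> < \<rho>" for u s
    using \<rho>(2)[of s u] that by (simp add: dist_real_def)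
  \<comment> \<open>quantifying over all representatives of \<open>\<beta> (\<tau> i)\<close> lets consecutive pieces be joined at any of them\<close>
  have "\<forall>z\<in>M. \<beta> (\<tau> i) = X.cls z \<longrightarrow> G.follows (e q) ?h (4 * \<delta> + 2 * \<epsilon>) (k x) (k z) 0 (\<tau> i)"
    if "i \<le> Suc n" for i
    using that
  proof (induction i)
    case 0
    show ?case
    proof (intro ballI impI)
      fix z assume z: "z \<in> M" "\<beta> (\<tau> 0) = X.cls z"
      have "G.follows (e q) ?h (4 * \<delta> + 2 * \<epsilon>) (k x) (k z) 0 0"
        using z \<epsilon> by (intro follows_piece[OF \<beta> _ _ _ xy(1) _ xy(3), of 0]) (auto simp: \<tau>_def)
      then show "G.follows (e q) ?h (4 * \<delta> + 2 * \<epsilon>) (k x) (k z) 0 (\<tau> 0)"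
        by (simp add: \<tau>_def)
    qed
  next
    case (Suc i)
    have "\<beta> (\<tau> i) \<in> reeb_space M d p"
      using path_image_subset_topspace[OF \<beta>] \<tau>(1)[of i] \<tau>1[of i] Suc.prems by (auto simp: X.topspace_reeb)
    then obtain w where w: "w \<in> M" "\<beta> (\<tau> i) = X.cls w"
      by (auto simp: reeb_space_def)
    have to_w: "G.follows (e q) ?h (4 * \<delta> + 2 * \<epsilon>) (k x) (k w) 0 (\<tau> i)"
      using Suc.IH[OF Suc_leD[OF Suc.prems]] w by blast
    show ?case
    proof (intro ballI impI)
      fix z assume z: "z \<in> M" "\<beta> (\<tau> (Suc i)) = X.cls z"
      have "G.follows (e q) ?h (4 * \<delta> + 2 * \<epsilon>) (k w) (k z) (\<tau> i) (\<tau> i)"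
      proof (rule follows_piece[OF \<beta> \<tau>(1) \<tau>(2) \<tau>1[OF Suc.prems] w(1) z(1) w(2) z(2) \<epsilon>])
        fix u assume "\<tau> i \<le> u" "u \<le> \<tau> (Suc i)"
        then show "\<bar>X.height (\<beta> u) - X.height (\<beta> (\<tau> i))\<bar> < \<epsilon>"
          using \<tau>[of i] \<tau>1[OF Suc.prems] by (intro close) auto
      qed
      then show "G.follows (e q) ?h (4 * \<delta> + 2 * \<epsilon>) (k x) (k z) 0 (\<tau> (Suc i))"
        using G.follows_trans[OF to_w _ order_refl] G.follows_weaken \<tau>(2) by blast
    qed
  qed
  moreover have "\<tau> (Suc n) = 1" by (simp add: \<tau>_def)
  ultimately show ?thesis using xy by fastforce
qed

text \<open>
  Up to arbitrarily small terms: with \<open>N\<close> chords the path has at most \<open>N + 1\<close> uncut pieces with an error of four times \<open>4 \<delta>\<close> each, and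
  going back from the graph costs another \<open>2 \<delta>\<close>.
\<close>

lemma dist_le_reeb_metric:
  assumes xy: "x \<in> M" "y \<in> M"
  shows "d x y \<le> reeb_metric M d p (X.cls x) (X.cls y) + 2 * ((8 * real (card G.chords) + 9) * \<delta>)"
proof -
  let ?R = "reeb_metric M d p (X.cls x) (X.cls y)" and ?n = "real (card G.chords)"
  have bound: "d x y \<le> ?R + 2 * ((8 * ?n + 9) * \<delta>) + (9 * ?n + 10) * \<epsilon>" if \<epsilon>: "0 < \<epsilon>" for \<epsilon>
  proof -
    have R: "0 \<le> ?R" by (simp add: reeb_metric_def)
    obtain \<beta> where \<beta>: "X.reeb_connects (?R + \<epsilon>) \<beta> (X.cls x) (X.cls y)"
      using X.reeb_metric_lessE[of "X.cls x" "X.cls y" "?R + \<epsilon>"] xy \<epsilon> by (auto simp: reeb_space_def)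
    let ?h = "X.height \<circ> \<beta>" and ?r = "4 * \<delta> + 2 * \<epsilon>"
    have "G.follows (e q) ?h ?r (k x) (k y) 0 1"
      using \<beta> xy \<epsilon> by (intro follows_reeb_path) (auto simp: X.reeb_connects_def)
    then obtain \<gamma> \<theta> where \<gamma>: "pathin G.mtopology \<gamma>" "\<gamma> 0 = k x" "\<gamma> 1 = k y"
      "\<And>a b. 0 \<le> a \<Longrightarrow> a \<le> b \<Longrightarrow> b \<le> 1 \<Longrightarrow> \<theta> a \<le> \<theta> b"
      "\<And>a. a \<in> {0..1} \<Longrightarrow> 0 \<le> \<theta> a \<and> \<theta> a \<le> 1 \<and> \<bar>e q (\<gamma> a) - ?h (\<theta> a)\<bar> \<le> ?r"
      unfolding G.follows_def by blast
    obtain C where C: "C \<subseteq> N" "finite C" "card C \<le> card G.chords" "G.tree_like_off (e q) C \<epsilon>"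
      using G.tree_like_off_chord_points[OF \<epsilon>] by blast
    have "\<exists>ts. sorted ts \<and> set ts \<subseteq> {\<theta> 0..\<theta> 1} \<and>
        e (\<gamma> 0) (\<gamma> 1) \<le> chain_length dist (map ?h ts) + real (card C + 1) * (4 * ?r + \<epsilon>)"
      using G.tree_like_bound[OF C(4,1) less_imp_le[OF \<epsilon>] \<gamma>(1), of \<theta> ?h ?r C 0 1] \<gamma>(4,5) C(2) by auto
    then obtain ts where ts: "sorted ts" "set ts \<subseteq> {\<theta> 0..\<theta> 1}"
        "e (k x) (k y) \<le> chain_length dist (map ?h ts) + real (card C + 1) * (4 * ?r + \<epsilon>)"
      using \<gamma>(2,3) by auto
    have "set ts \<subseteq> {0..1}"
      using ts(2) \<gamma>(5)[of 0] \<gamma>(5)[of 1] by force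
    then have "chain_length dist (map ?h ts) \<le> ?R + \<epsilon>"
      using \<beta> ts(1) R \<epsilon> path_length_le_iff[of dist "?R + \<epsilon>" ?h]
      by (auto simp: X.reeb_connects_def simp del: ennreal_plus)
    moreover have "real (card C + 1) * (4 * ?r + \<epsilon>) \<le> (?n + 1) * (4 * ?r + \<epsilon>)"
      using C(3) \<delta>_nonneg \<epsilon> by (intro mult_right_mono) auto
    moreover have "d x y \<le> e (k x) (k y) + 2 * \<delta>"
      using almost_isometry[OF xy] by linarith
    ultimately have "d x y \<le> ?R + \<epsilon> + (?n + 1) * (4 * ?r + \<epsilon>) + 2 * \<delta>"
      using ts(3) by linarith
    then show ?thesis by (simp add: algebra_simps)
  qed
  show ?thesis
  proof (rule field_le_epsilon)
    fix \<epsilon> :: real assume "0 < \<epsilon>"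
    moreover have "0 < 9 * ?n + 10" by (simp add: add_nonneg_pos)
    ultimately show "d x y \<le> ?R + 2 * ((8 * ?n + 9) * \<delta>) + \<epsilon>"
      using bound[of "\<epsilon> / (9 * ?n + 10)"] by simp
  qed
qed

end

theorem theorem6:
  fixes X :: "'a set" and d\<^sub>X :: "'a \<Rightarrow> 'a \<Rightarrow> real" and p :: 'a
    and G :: "'b set" and d\<^sub>G :: "'b \<Rightarrow> 'b \<Rightarrow> real"
  assumes "geodesic_space X d\<^sub>X"
    and "compact_space (Metric_space.mtopology X d\<^sub>X)"
    and "p \<in> X"
    and "finite_metric_graph G d\<^sub>G"
  shows "gh_distance X d\<^sub>X (reeb_space X d\<^sub>X p) (reeb_metric X d\<^sub>X p) \<le>
    ennreal_of_enat (8 * betti_number 1 (Metric_space.mtopology X d\<^sub>X)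
        + 8 * betti_number 1 (Metric_space.mtopology G d\<^sub>G) + 13)
      * gh_distance X d\<^sub>X G d\<^sub>G"
proof -
  interpret X: Metric_space X d\<^sub>X
    using assms(1) by (simp add: geodesic_space_def)
  interpret X: reeb_graph X d\<^sub>X p
    using assms by unfold_locales
  let ?R = "gh_distance X d\<^sub>X (reeb_space X d\<^sub>X p) (reeb_metric X d\<^sub>X p)" and ?D = "gh_distance X d\<^sub>X G d\<^sub>G"
  let ?b = "betti_number 1 (Metric_space.mtopology G d\<^sub>G)"
  obtain K where K: "\<forall>q\<in>G. \<exists>V E. ascending_graph G d\<^sub>G V E q \<and> card E \<le> K"
    using ascending_graph_exists[OF assms(4)] by blast
  have step: "\<exists>n\<le>K. enat n \<le> ?b \<and> ?R \<le> ennreal ((8 * real n + 9) * \<delta>)" if D: "?D < ennreal \<delta>" for \<delta>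
  proof -
    have \<delta>: "0 < \<delta>"
      using D by (metis ennreal_neg linorder_not_less not_less_zero)
    obtain k where k: "\<And>x. x \<in> X \<Longrightarrow> k x \<in> G"
      "\<And>x y. x \<in> X \<Longrightarrow> y \<in> X \<Longrightarrow> \<bar>d\<^sub>X x y - d\<^sub>G (k x) (k y)\<bar> \<le> 2 * \<delta>"
      using gh_distance_lessE[OF D] by blast
    obtain V E where VE: "ascending_graph G d\<^sub>G V E (k p)" "card E \<le> K"
      using K k(1)[OF assms(3)] by blast
    interpret A: ascending_graph G d\<^sub>G V E "k p"
      by (rule VE(1))
    interpret A: reeb_approximation X d\<^sub>X p G d\<^sub>G V E "k p" k \<delta>
      using k by unfold_locales auto
    have "?R \<le> ennreal ((8 * real (card A.chords) + 9) * \<delta>)"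
    proof (rule gh_distance_le_if_contraction[OF X.Metric_space_axioms X.Metric_space_reeb[OF assms(2)]])
      show "X.cls ` X = reeb_space X d\<^sub>X p" by (simp add: reeb_space_def)
      show "0 < (8 * real (card A.chords) + 9) * \<delta>"
        using \<delta> by (simp add: add_nonneg_pos)
    qed (rule X.reeb_metric_le_dist A.dist_le_reeb_metric; assumption)+
    moreover have "card A.chords \<le> K"
      using card_mono[OF A.finE, of A.chords] VE(2) by (auto simp: A.chords_def)
    ultimately show ?thesis
      using A.card_chords_le_betti by blast
  qed
  \<comment> \<open>The graph depends on \<open>\<delta>\<close> through the image of \<open>p\<close>; to let \<open>\<delta>\<close> tend to the distance, one finite
    bound on the number of chords has to serve for all \<open>\<delta>\<close>.\<close>
  define n where "n = (case ?b of enat b \<Rightarrow> b | \<infinity> \<Rightarrow> K)"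
  have nb: "enat n \<le> ?b"
    by (cases ?b) (simp_all add: n_def)
  have bound: "?R \<le> ennreal ((8 * real n + 9) * \<delta>)" if D: "?D < ennreal \<delta>" for \<delta>
  proof -
    have \<delta>: "0 < \<delta>"
      using D by (metis ennreal_neg linorder_not_less not_less_zero)
    obtain m where m: "m \<le> K" "enat m \<le> ?b" "?R \<le> ennreal ((8 * real m + 9) * \<delta>)"
      using step[OF D] by blast
    have "m \<le> n" using m(1,2) by (cases ?b) (auto simp: n_def)
    then have "(8 * real m + 9) * \<delta> \<le> (8 * real n + 9) * \<delta>"
      using \<delta> by (intro mult_right_mono) auto
    with m(3) show ?thesis by (meson ennreal_leI order_trans)
  qed
  have linear: "?R \<le> ennreal (8 * real n + 9) * ?D"
  proof (cases ?D)
    case top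
    then show ?thesis by (simp add: ennreal_mult_top)
  next
    case (real t)
    have "?R \<le> ennreal ((8 * real n + 9) * t)"
    proof (rule ennreal_le_epsilon)
      fix \<epsilon> :: real assume "0 < \<epsilon>"
      have pos: "0 < 8 * real n + 9" by (simp add: add_nonneg_pos)
      have "?D < ennreal (t + \<epsilon> / (8 * real n + 9))"
        unfolding real(2) using real(1) \<open>0 < \<epsilon>\<close> pos
        by (intro ennreal_lessI add_nonneg_pos divide_pos_pos) (auto simp del: of_nat_0_le_iff)
      then have "?R \<le> ennreal ((8 * real n + 9) * (t + \<epsilon> / (8 * real n + 9)))"
        by (rule bound)
      also have "(8 * real n + 9) * (t + \<epsilon> / (8 * real n + 9)) = (8 * real n + 9) * t + \<epsilon>"
        using pos by (simp add: distrib_left)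
      also have "ennreal \<dots> = ennreal ((8 * real n + 9) * t) + ennreal \<epsilon>"
        using real(1) pos \<open>0 < \<epsilon>\<close> by (intro ennreal_plus) auto
      finally show "?R \<le> ennreal ((8 * real n + 9) * t) + ennreal \<epsilon>" .
    qed
    then show ?thesis
      unfolding real(2) using real(1) by (simp add: ennreal_mult)
  qed
  have "ennreal (8 * real n + 9) \<le>
      ennreal_of_enat (8 * betti_number 1 (Metric_space.mtopology X d\<^sub>X) + 8 * ?b + 13)"
  proof -
    have "enat (8 * n + 9) \<le> 8 * betti_number 1 (Metric_space.mtopology X d\<^sub>X) + 8 * ?b + 13"
      using nb by (cases ?b; cases "betti_number 1 (Metric_space.mtopology X d\<^sub>X)") (auto simp: numeral_eq_enat)
    moreover have "ennreal (8 * real n + 9) = ennreal_of_enat (enat (8 * n + 9))"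
      by (simp add: ennreal_of_nat_eq_real_of_nat)
    ultimately show ?thesis
      by (simp only: ennreal_of_enat_le_iff)
  qed
  then show ?thesis
    using linear by (meson mult_right_mono order_trans zero_le)
qed

end
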